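(* $\mathrm{Aut}(\mathcal{E})=\mathrm{Inn}(\mathcal{E})\rtimes\langle\Psi_T\rangle\cong\mathcal{E}\rtimes\mathbb{Z}/2\mathbb{Z}$.
   Context: Identify $\mathbb{T}^1=\mathbb{R}/\mathbb{Z}$ with $[0,1)$. An interval exchange transformation is a bijection $f:\mathbb{T}^1\to\mathbb{T}^1$ for which there is a partition of $[0,1)$ into finitely many half-open intervals $[a,b)$ on each of which $f$ is a translation $x\mapsto x+c\pmod 1$; such maps are right-continuous. $\mathcal{E}$ is the group of all interval exchange transformations under composition; $\mathrm{Inn}(\mathcal{E})$ is its group of inner automorphisms. Let $T:\mathbb{T}^1\to\mathbb{T}^1$, $T(x)=-x$. For $f\in\mathcal{E}$, $T^{-1}fT$ is an invertible piecewise translation which is left-continuous; $\Psi_T(f)\in\mathcal{E}$ is defined as the right-continuous interval exchange corresponding to it (obtained by replacing the half-open pieces $(a,b]$ by $[a,b)$, i.e. the natural isomorphism from left-continuous interval exchanges to $\mathcal{E}$). $\Psi_T$ is an automorphism of $\mathcal{E}$. *)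

theory Defs
  imports "HOL-Analysis.Analysis" "HOL-Algebra.Bij" "HOL-Algebra.Generated_Groups"
begin

text \<open>The circle T^1 = R/Z is identified with [0,1). A map of the circle is represented
  by a function real => real which is the identity outside [0,1) (canonical representative).\<close>

definition circ :: "real set" where "circ = {0..<1}"

definition is_iet :: "(real \<Rightarrow> real) \<Rightarrow> bool" where
  "is_iet f \<longleftrightarrow>
     (\<forall>x. x \<notin> circ \<longrightarrow> f x = x) \<and>
     bij_betw f circ circ \<and>
     (\<exists>(n::nat) (a::nat \<Rightarrow> real) (c::nat \<Rightarrow> real).
        a 0 = 0 \<and> a n = 1 \<and> (\<forall>i<n. a i < a (Suc i)) \<and>
        (\<forall>i<n. \<forall>x\<in>{a i..<a (Suc i)}. f x = frac (x + c i)))"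

definition IET_group :: "(real \<Rightarrow> real) monoid" where
  "IET_group = \<lparr>carrier = {f. is_iet f}, mult = (\<lambda>f g. f \<circ> g), one = id\<rparr>"

definition Tref :: "real \<Rightarrow> real" where
  "Tref x = (if x \<in> circ then frac (- x) else x)"

text \<open>Psi_T(f): the (unique) right-continuous interval exchange corresponding to the
  left-continuous piecewise translation T^-1 f T, i.e. the element of E that agrees with
  T^-1 f T except at finitely many points.\<close>
definition Psi_T :: "(real \<Rightarrow> real) \<Rightarrow> (real \<Rightarrow> real)" where
  "Psi_T f = (THE g. is_iet g \<and> finite {x \<in> circ. g x \<noteq> (Tref \<circ> f \<circ> Tref) x})"

text \<open>Inner automorphisms of a group (as extensional maps, as in AutoGroup).\<close>
definition Inn :: "('a, 'b) monoid_scheme \<Rightarrow> ('a \<Rightarrow> 'a) set" where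
  "Inn G = {(\<lambda>x\<in>carrier G. g \<otimes>\<^bsub>G\<^esub> x \<otimes>\<^bsub>G\<^esub> inv\<^bsub>G\<^esub> g) | g. g \<in> carrier G}"

definition sdp_Z2 :: "('a, 'b) monoid_scheme \<Rightarrow> ('a \<Rightarrow> 'a) \<Rightarrow> ('a \<times> bool) monoid" where
  "sdp_Z2 G phi =
    \<lparr>carrier = carrier G \<times> (UNIV :: bool set),
     mult = (\<lambda>(g, a) (h, b). (g \<otimes>\<^bsub>G\<^esub> (if a then phi h else h), a \<noteq> b)),
     one = (\<one>\<^bsub>G\<^esub>, False)\<rparr>"

end

theory Submission
  imports Defs
begin

text \<open>
  An automorphism \<open>\<Phi>\<close> of the group of interval exchanges is reconstructed from its action on supports.
  For an involution \<open>p\<close>, the set of elements supported in \<open>supp p\<close> can be described by iterated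
  centralizers (as in Fremlin's treatment of full groups of Boolean algebras), and every finite union of
  half-open intervals is the support of an involution. So \<open>\<Phi>\<close> induces an automorphism \<open>\<theta>\<close> of the Boolean
  algebra of such unions with \<open>\<theta> (g ` b) = \<Phi> g ` \<theta> b\<close>.

  The dual of \<open>\<theta>\<close> on ultrafilters, that is on one-sided germs of points, yields a right-continuous point
  map \<open>\<phi>\<close>. For a rotation \<open>r\<close> by \<open>\<alpha>\<close> the map \<open>\<Phi> r\<close> is piecewise a translation, so
  \<open>\<phi> (x + \<alpha>) - \<phi> x\<close> is constant for \<open>x\<close> near \<open>0\<close>. Baire's theorem makes the size of the neighbourhood uniform
  in \<open>\<alpha>\<close>, hence \<open>\<phi>\<close> satisfies Cauchy's functional equation there and is affine near \<open>0\<close>. Since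
  rotations carry this behaviour to every point and preserve Lebesgue measure, the slope is \<open>1\<close> or
  \<open>- 1\<close>; slope \<open>1\<close> makes \<open>\<theta>\<close> the action of an interval exchange that conjugates \<open>g\<close> to \<open>\<Phi> g\<close>, and
  slope \<open>- 1\<close> is reduced to slope \<open>1\<close> by composing with the reflection.
\<close>

section \<open>Germs and half-open sets\<close>

text \<open>No continuity of an automorphism is assumed, and two features of the problem dictate the
  route. A reflection sends right germs to left germs, so \<theta> is in general not the image map
  of any point map of [0, 1): as t decreases to x, the sets \<theta> [x, t) may shrink to a left
  germ and have empty intersection. Ultrafilters are indifferent to sides; a point map is obtained
  only as the limit of the image germ, which forgets the side. The other feature is that conjugation
  by any affine map turns translations into translations. Local algebra therefore leaves the slope
  free, and only the total length of the circle fixes it.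

  In the algebraic part the test elements are thirds of a turn, because the argument compares an
  element with its inverse at a point and needs the two values to differ. Baire category replaces
  the missing continuity in the rotation angle: the neighbourhood on which an increment is constant
  depends on the angle, with no bound given in advance.\<close>

text \<open>
  The germs \<open>rgerm x\<close> (which, unlike \<open>at_right x\<close>, see the point \<open>x\<close> itself) and \<open>at_left x\<close> are the
  ultrafilters of the Boolean algebra of finite unions of intervals \<open>[s, t)\<close> in the circle; \<open>clopen\<close>
  describes this algebra, and \<open>iet\<close> the interval exchanges, by a condition at every germ.
\<close>

definition rgerm :: "real \<Rightarrow> real filter" where
  "rgerm x = inf (nhds x) (principal {x..})"

definition germs :: "real filter set" where
  "germs = rgerm ` {0..<1} \<union> at_left ` {0<..1}"

definition clopen :: "real set \<Rightarrow> bool" where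
  "clopen b \<longleftrightarrow> b \<subseteq> circ \<and>
     (\<forall>F\<in>germs. (\<forall>\<^sub>F y in F. y \<in> b) \<or> (\<forall>\<^sub>F y in F. y \<notin> b))"

definition iet :: "(real \<Rightarrow> real) \<Rightarrow> bool" where
  "iet f \<longleftrightarrow> (\<forall>x. x \<notin> circ \<longrightarrow> f x = x) \<and> bij_betw f circ circ \<and>
     (\<forall>F\<in>germs. \<exists>c. \<forall>\<^sub>F y in F. f y = y + c)"

lemma eventually_rgerm:
  "eventually P (rgerm x) \<longleftrightarrow> (\<exists>e>x. \<forall>y. x \<le> y \<longrightarrow> y < e \<longrightarrow> P y)"
proof
  assume "eventually P (rgerm x)"
  then obtain d where d: "d > 0" "\<And>y. dist y x < d \<Longrightarrow> y \<ge> x \<Longrightarrow> P y"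
    unfolding rgerm_def eventually_inf_principal eventually_nhds_metric by auto
  show "\<exists>e>x. \<forall>y. x \<le> y \<longrightarrow> y < e \<longrightarrow> P y"
    by (rule exI[of _ "x + d"]) (use d in \<open>auto simp: dist_real_def\<close>)
next
  assume "\<exists>e>x. \<forall>y. x \<le> y \<longrightarrow> y < e \<longrightarrow> P y"
  then obtain e where "e > x" "\<forall>y. x \<le> y \<longrightarrow> y < e \<longrightarrow> P y" by blast
  then show "eventually P (rgerm x)"
    unfolding rgerm_def eventually_inf_principal eventually_nhds_metric
    by (intro exI[of _ "e - x"]) (auto simp: dist_real_def)
qed

lemma germ_cases [consumes 1, case_names right left]:
  assumes "F \<in> germs"
  obtains x where "0 \<le> x" "x < 1" "F = rgerm x" | x where "0 < x" "x \<le> 1" "F = at_left x"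
  using assms by (auto simp: germs_def)

lemma rgerm_in_germs [simp]: "0 \<le> x \<Longrightarrow> x < 1 \<Longrightarrow> rgerm x \<in> germs"
  and at_left_in_germs [simp]: "0 < x \<Longrightarrow> x \<le> 1 \<Longrightarrow> at_left x \<in> germs"
  by (auto simp: germs_def)

lemma germ_neq_bot [simp]: assumes "F \<in> germs" shows "F \<noteq> bot"
  using assms
proof (cases rule: germ_cases)
  case (right x)
  then show ?thesis by (auto simp: trivial_limit_def eventually_rgerm)
next
  case (left x)
  then show ?thesis by simp
qed

lemma germ_circ: assumes "F \<in> germs" shows "\<forall>\<^sub>F y in F. y \<in> circ"
  using assms
proof (cases rule: germ_cases)
  case (right x)
  then show ?thesis by (auto simp: circ_def eventually_rgerm intro!: exI[of _ 1])
next
  case (left x)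
  then show ?thesis by (auto simp: circ_def eventually_at_left_field intro!: exI[of _ 0])
qed

lemma germ_not_both:
  assumes "F \<in> germs" "eventually P F" "\<forall>\<^sub>F y in F. \<not> P y" shows False
proof -
  have "\<forall>\<^sub>F y in F. False" using assms(2,3) by eventually_elim simp
  then show False using germ_neq_bot[OF assms(1)] by simp
qed

lemma rgerm_self: "eventually P (rgerm x) \<Longrightarrow> P x"
  by (auto simp: eventually_rgerm)

lemma germ_interval_decide:
  fixes s t :: real
  assumes "F \<in> germs"
  shows "(\<forall>\<^sub>F y in F. y \<in> {s..<t}) \<or> (\<forall>\<^sub>F y in F. y \<notin> {s..<t})"
  using assms
proof (cases rule: germ_cases)
  case (right x)
  consider "x < s" | "x \<ge> t" | "s \<le> x" "x < t" by linarith
  then show ?thesis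
  proof cases
    case 1
    then show ?thesis using right by (auto simp: eventually_rgerm intro!: exI[of _ s])
  next
    case 2
    then show ?thesis using right by (auto simp: eventually_rgerm intro!: exI[of _ "x+1"])
  next
    case 3
    then show ?thesis using right by (auto simp: eventually_rgerm intro!: exI[of _ t])
  qed
next
  case (left x)
  consider "x \<le> s" | "x > t" | "s < x" "x \<le> t" by linarith
  then show ?thesis
  proof cases
    case 1
    then show ?thesis using left by (auto simp: eventually_at_left_field intro!: exI[of _ "x-1"])
  next
    case 2
    then show ?thesis using left by (auto simp: eventually_at_left_field intro!: exI[of _ t])
  next
    case 3
    then show ?thesis using left by (auto simp: eventually_at_left_field intro!: exI[of _ s])
  qed
qed

lemma clopen_decide:
  "clopen b \<Longrightarrow> F \<in> germs \<Longrightarrow> (\<forall>\<^sub>F y in F. y \<in> b) \<or> (\<forall>\<^sub>F y in F. y \<notin> b)"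
  by (auto simp: clopen_def)

lemma clopen_subset: "clopen b \<Longrightarrow> b \<subseteq> circ"
  by (simp add: clopen_def)

lemma clopen_interval: "0 \<le> s \<Longrightarrow> t \<le> 1 \<Longrightarrow> clopen {s..<t}"
  using germ_interval_decide by (auto simp: clopen_def circ_def)

lemma clopen_circ [simp]: "clopen circ"
  by (simp add: circ_def clopen_interval)

lemma clopen_empty [simp]: "clopen {}"
  by (simp add: clopen_def)

lemma clopen_Int: assumes "clopen a" "clopen b" shows "clopen (a \<inter> b)"
  unfolding clopen_def
proof (intro conjI ballI)
  show "a \<inter> b \<subseteq> circ" using assms by (auto simp: clopen_def)
  fix F assume F: "F \<in> germs"
  show "(\<forall>\<^sub>F y in F. y \<in> a \<inter> b) \<or> (\<forall>\<^sub>F y in F. y \<notin> a \<inter> b)"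
    using clopen_decide[OF assms(1) F] clopen_decide[OF assms(2) F]
      eventually_conj[of "\<lambda>y. y \<in> a" F "\<lambda>y. y \<in> b"]
      eventually_mono[of "\<lambda>y. y \<notin> a" F "\<lambda>y. y \<notin> a \<inter> b"]
      eventually_mono[of "\<lambda>y. y \<notin> b" F "\<lambda>y. y \<notin> a \<inter> b"]
    by auto
qed

lemma clopen_Compl: assumes "clopen b" shows "clopen (circ - b)"
  unfolding clopen_def
proof (intro conjI ballI)
  fix F assume F: "F \<in> germs"
  show "(\<forall>\<^sub>F y in F. y \<in> circ - b) \<or> (\<forall>\<^sub>F y in F. y \<notin> circ - b)"
    using clopen_decide[OF assms F] eventually_conj[OF germ_circ[OF F], of "\<lambda>y. y \<notin> b"]
      eventually_mono[of "\<lambda>y. y \<in> b" F "\<lambda>y. y \<notin> circ - b"]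
    by auto
qed auto

lemma clopen_Un: assumes "clopen a" "clopen b" shows "clopen (a \<union> b)"
proof -
  have "a \<union> b = circ - ((circ - a) \<inter> (circ - b))" using assms by (auto simp: clopen_def)
  then show ?thesis using assms by (metis clopen_Int clopen_Compl)
qed

lemma clopen_Diff: assumes "clopen a" "clopen b" shows "clopen (a - b)"
proof -
  have "a - b = a \<inter> (circ - b)" using assms by (auto simp: clopen_def)
  then show ?thesis using assms by (metis clopen_Int clopen_Compl)
qed

lemma rgerm_clopen:
  assumes "clopen b" "x \<in> b" shows "\<forall>\<^sub>F y in rgerm x. y \<in> b"
proof -
  have "x \<in> circ" using assms clopen_subset by blast
  then have "rgerm x \<in> germs" by (simp add: circ_def)
  then show ?thesis using clopen_decide[OF assms(1)] assms(2) rgerm_self[of "\<lambda>y. y \<notin> b" x] by blast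
qed

lemma clopen_contains_interval:
  assumes "clopen b" "x \<in> b" "e > x"
  obtains t where "x < t" "t \<le> e" "{x..<t} \<subseteq> b"
proof -
  obtain e' where e': "e' > x" "\<And>y. x \<le> y \<Longrightarrow> y < e' \<Longrightarrow> y \<in> b"
    using rgerm_clopen[OF assms(1,2)] unfolding eventually_rgerm by blast
  then show thesis using assms(3) by (intro that[of "min e e'"]) auto
qed

text \<open>Clopen sets form a base of every germ, so questions about germs reduce to the Boolean
  algebra.\<close>

lemma germ_clopen_base:
  assumes "F \<in> germs" "eventually P F"
  obtains b where "clopen b" "\<forall>\<^sub>F y in F. y \<in> b" "\<And>y. y \<in> b \<Longrightarrow> P y"
  using assms(1)
proof (cases rule: germ_cases)
  case (right x)
  obtain e where e: "e > x" "\<And>y. x \<le> y \<Longrightarrow> y < e \<Longrightarrow> P y"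
    using assms(2) unfolding right eventually_rgerm by blast
  show thesis
    by (rule that[of "{x..<min e 1}"])
      (use right e in \<open>auto simp: eventually_rgerm intro!: clopen_interval exI[of _ "min e 1"]\<close>)
next
  case (left x)
  obtain e where e: "e < x" "\<And>y. e < y \<Longrightarrow> y < x \<Longrightarrow> P y"
    using assms(2) unfolding left eventually_at_left_field by blast
  \<comment> \<open>Starting at the midpoint excludes \<open>e\<close>, where \<open>P\<close> is
    not known; the maximum with 0 keeps the interval inside the circle.\<close>
  define d where "d = max ((e + x) / 2) 0"
  have d: "d < x" "e < d" "d \<ge> 0" using e(1) left by (auto simp: d_def less_max_iff_disj)
  have "\<forall>\<^sub>F y in F. y \<in> {d..<x}"
    using left d by (auto simp: eventually_at_left_field intro!: exI[of _ d])
  then show thesis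
    by (intro that[of "{d..<x}"]) (use left e d in \<open>auto intro!: clopen_interval\<close>)
qed

text \<open>One inclusion suffices, as for ultrafilters: a clopen set missing from \<open>F\<close>
  has its complement in \<open>F\<close>, hence in \<open>G\<close>.\<close>

lemma germ_eqI:
  assumes "F \<in> germs" "G \<in> germs"
    and "\<And>b. clopen b \<Longrightarrow> \<forall>\<^sub>F y in F. y \<in> b \<Longrightarrow> \<forall>\<^sub>F y in G. y \<in> b"
  shows "F = G"
proof -
  have 1: "eventually P G" if ev: "eventually P F" for P
  proof -
    obtain b where "clopen b" "\<forall>\<^sub>F y in F. y \<in> b" "\<And>y. y \<in> b \<Longrightarrow> P y"
      using germ_clopen_base[OF assms(1) ev] by blast
    then show ?thesis using assms(3) by (metis (mono_tags, lifting) eventually_mono)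
  qed
  have 2: "eventually P F" if ev: "eventually P G" for P
  proof -
    obtain b where b: "clopen b" "\<forall>\<^sub>F y in G. y \<in> b" "\<And>y. y \<in> b \<Longrightarrow> P y"
      using germ_clopen_base[OF assms(2) ev] by blast
    have "\<not> (\<forall>\<^sub>F y in F. y \<notin> b)" using 1[of "\<lambda>y. y \<notin> b"] germ_not_both[OF assms(2) b(2)] by blast
    then have "\<forall>\<^sub>F y in F. y \<in> b" using clopen_decide[OF b(1) assms(1)] by blast
    then show ?thesis using b(3) by (metis (mono_tags, lifting) eventually_mono)
  qed
  show ?thesis using 1 2 by (auto simp: filter_eq_iff)
qed

text \<open>Compactness of the space of germs, in the form of an induction over subdivisions of \<open>[0, 1)\<close>.\<close>

lemma germ_interval_induct [consumes 0, case_names refl trans local]: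
  fixes Q :: "real \<Rightarrow> real \<Rightarrow> bool"
  assumes refl: "\<And>x. Q x x"
    and trans: "\<And>r s t. 0 \<le> r \<Longrightarrow> r < s \<Longrightarrow> s < t \<Longrightarrow> t \<le> 1 \<Longrightarrow> Q r s \<Longrightarrow> Q s t \<Longrightarrow> Q r t"
    and loc: "\<And>F. F \<in> germs \<Longrightarrow> \<exists>P. eventually P F \<and>
      (\<forall>s t. 0 \<le> s \<longrightarrow> s < t \<longrightarrow> t \<le> 1 \<longrightarrow> (\<forall>y\<in>{s..<t}. P y) \<longrightarrow> Q s t)"
  shows "Q 0 1"
proof -
  have trans': "Q r t" if "0 \<le> r" "r \<le> s" "s \<le> t" "t \<le> 1" "Q r s" "Q s t" for r s t
  proof (cases "r = s \<or> s = t")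
    case True
    then show ?thesis using that by blast
  next
    case False
    then show ?thesis using that by (intro trans[of r s t]) simp_all
  qed
  have "0 \<le> (0::real) \<longrightarrow> (1::real) \<le> 1 \<longrightarrow> Q 0 1"
  \<comment> \<open>Bisection: a short interval around \<open>x\<close> is cut at \<open>x\<close>,
    and the right and left germs at \<open>x\<close> settle the two pieces. A degenerate piece, as
    at the ends 0 and 1, is covered by \<open>refl\<close>.\<close>
  proof (rule Bolzano[where P="\<lambda>r t. 0 \<le> r \<longrightarrow> t \<le> 1 \<longrightarrow> Q r t"], goal_cases)
    case (2 r s t)
    then show ?case using trans'[of r s t] by auto
  next
    case (3 x)
    have R: "\<exists>e>x. \<forall>t. x \<le> t \<longrightarrow> t < e \<longrightarrow> t \<le> 1 \<longrightarrow> Q x t"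
    proof (cases "x = 1")
      case False
      then obtain P where P: "eventually P (rgerm x)"
          "\<And>s t. 0 \<le> s \<Longrightarrow> s < t \<Longrightarrow> t \<le> 1 \<Longrightarrow> (\<forall>y\<in>{s..<t}. P y) \<Longrightarrow> Q s t"
        using loc[of "rgerm x"] 3 by auto
      then obtain e where e: "e > x" "\<And>y. x \<le> y \<Longrightarrow> y < e \<Longrightarrow> P y"
        unfolding eventually_rgerm by blast
      have "Q x t" if "x \<le> t" "t < e" "t \<le> 1" for t
        using P(2)[of x t] e 3 that refl by (cases "x = t") auto
      then show ?thesis using e(1) by blast
    next
      case True
      then show ?thesis using 3 refl by (intro exI[of _ 2]) auto
    qed
    have L: "\<exists>e<x. \<forall>s. s \<le> x \<longrightarrow> e < s \<longrightarrow> 0 \<le> s \<longrightarrow> Q s x"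
    proof (cases "x = 0")
      case False
      then obtain P where P: "eventually P (at_left x)"
          "\<And>s t. 0 \<le> s \<Longrightarrow> s < t \<Longrightarrow> t \<le> 1 \<Longrightarrow> (\<forall>y\<in>{s..<t}. P y) \<Longrightarrow> Q s t"
        using loc[of "at_left x"] 3 by auto
      then obtain e where e: "e < x" "\<And>y. e < y \<Longrightarrow> y < x \<Longrightarrow> P y"
        unfolding eventually_at_left_field by blast
      have "Q s x" if "s \<le> x" "e < s" "0 \<le> s" for s
        using P(2)[of s x] e 3 that refl by (cases "s = x") auto
      then show ?thesis using e(1) by blast
    next
      case True
      then show ?thesis using 3 refl by (intro exI[of _ "-1"]) auto
    qed
    obtain e1 e2 where e: "e1 > x" "\<And>t. x \<le> t \<Longrightarrow> t < e1 \<Longrightarrow> t \<le> 1 \<Longrightarrow> Q x t"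
      "e2 < x" "\<And>s. s \<le> x \<Longrightarrow> e2 < s \<Longrightarrow> 0 \<le> s \<Longrightarrow> Q s x"
      using R L by blast
    show ?case
    proof (intro exI[of _ "min (e1 - x) (x - e2)"] conjI allI impI, goal_cases)
      case (2 a b)
      then show ?case using trans'[of a x b] e(2)[of b] e(4)[of a] by auto
    qed (use e in auto)
  qed auto
  then show ?thesis by simp
qed

section \<open>Interval exchanges as local translations\<close>

lemma filtermap_cong_eventually:
  assumes "\<forall>\<^sub>F y in F. f y = g y" shows "filtermap f F = filtermap g F"
proof -
  have "eventually (\<lambda>y. P (f y)) F = eventually (\<lambda>y. P (g y)) F" for P
    by (rule eventually_subst) (use assms in \<open>auto elim: eventually_mono\<close>)
  then show ?thesis by (simp add: filter_eq_iff eventually_filtermap)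
qed

lemma filtermap_shift_rgerm: "filtermap (\<lambda>y. y + c) (rgerm x) = rgerm (x + c)"
proof -
  have "(\<exists>e>x. \<forall>y. x \<le> y \<longrightarrow> y < e \<longrightarrow> P (y + c)) \<longleftrightarrow>
        (\<exists>e>x + c. \<forall>y. x + c \<le> y \<longrightarrow> y < e \<longrightarrow> P y)" (is "?A \<longleftrightarrow> ?B") for P
  proof
    assume ?A
    then obtain e where "e > x" and e: "\<And>y. x \<le> y \<Longrightarrow> y < e \<Longrightarrow> P (y + c)" by blast
    moreover have "P y" if "x + c \<le> y" "y < e + c" for y using e[of "y - c"] that by simp
    ultimately show ?B by (intro exI[of _ "e + c"]) simp
  next
    assume ?B
    then obtain e where "e > x + c" and e: "\<And>y. x + c \<le> y \<Longrightarrow> y < e \<Longrightarrow> P y" by blast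
    then show ?A by (intro exI[of _ "e - c"]) simp
  qed
  then show ?thesis by (simp add: filter_eq_iff eventually_filtermap eventually_rgerm)
qed

lemma filtermap_shift_at_left: "filtermap (\<lambda>y. y + c) (at_left x) = at_left (x + c)" for x :: real
proof -
  have "(\<exists>e<x. \<forall>y>e. y < x \<longrightarrow> P (y + c)) \<longleftrightarrow>
        (\<exists>e<x + c. \<forall>y>e. y < x + c \<longrightarrow> P y)" (is "?A \<longleftrightarrow> ?B") for P
  proof
    assume ?A
    then obtain e where "e < x" and e: "\<And>y. e < y \<Longrightarrow> y < x \<Longrightarrow> P (y + c)" by blast
    moreover have "P y" if "y < x + c" "e + c < y" for y using e[of "y - c"] that by simp
    ultimately show ?B by (intro exI[of _ "e + c"]) simp
  next
    assume ?B
    then obtain e where "e < x + c" and e: "\<And>y. e < y \<Longrightarrow> y < x + c \<Longrightarrow> P y" by blast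
    then show ?A by (intro exI[of _ "e - c"]) simp
  qed
  then show ?thesis by (simp add: filter_eq_iff eventually_filtermap eventually_at_left_field)
qed

section \<open>Action of interval exchanges on germs, and the group operations\<close>

lemma iet_circ: "iet f \<Longrightarrow> f x \<in> circ \<longleftrightarrow> x \<in> circ"
  unfolding iet_def by (metis bij_betwE)

lemma iet_outside: "iet f \<Longrightarrow> x \<notin> circ \<Longrightarrow> f x = x"
  by (simp add: iet_def)

lemma iet_translation:
  assumes "iet f" "F \<in> germs" obtains c where "\<forall>\<^sub>F y in F. f y = y + c"
  using assms by (auto simp: iet_def)

lemma iet_bij: assumes "iet f" shows "bij f"
proof -
  have "bij_betw f (circ \<union> - circ) (circ \<union> - circ)"
  proof (rule bij_betw_combine)
    show "bij_betw f circ circ" using assms by (simp add: iet_def)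
    show "bij_betw f (- circ) (- circ)"
      using assms by (subst bij_betw_cong[of _ _ id]) (auto simp: iet_def)
  qed auto
  then show ?thesis by simp
qed

lemma iet_inj: "iet f \<Longrightarrow> f x = f y \<longleftrightarrow> x = y"
  using iet_bij by (metis bij_def injD)

lemma iet_inv_f [simp]: "iet f \<Longrightarrow> inv_into UNIV f (f x) = x"
  by (simp add: iet_bij bij_is_inj)

lemma iet_f_inv [simp]: "iet f \<Longrightarrow> f (inv_into UNIV f x) = x"
  by (meson bij_inv_eq_iff iet_bij)

lemma iet_shift_interval:
  assumes "iet f" "\<And>y. y \<in> {s..<t} \<Longrightarrow> f y = y + c"
  shows "f ` {s..<t} = {s + c..<t + c}"
proof -
  have "f ` {s..<t} = (\<lambda>y. y + c) ` {s..<t}" using assms(2) by auto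
  then show ?thesis by simp
qed

lemma iet_rgerm:
  assumes "iet f" "x \<in> circ" shows "filtermap f (rgerm x) = rgerm (f x)"
proof -
  have "rgerm x \<in> germs" using assms by (simp add: circ_def)
  then obtain c where c: "\<forall>\<^sub>F y in rgerm x. f y = y + c" using assms iet_translation by blast
  then have "f x = x + c" using rgerm_self by fastforce
  then show ?thesis using filtermap_cong_eventually[OF c] by (simp add: filtermap_shift_rgerm)
qed

text \<open>A left germ moves by the translation constant valid below \<open>x\<close>, not by the
  value \<open>f x\<close>, which may belong to another piece. Its base point stays in (0, 1]
  because the translated neighbourhood stays in the circle.\<close>

lemma iet_at_left:
  assumes "iet f" "0 < x" "x \<le> 1" "\<forall>\<^sub>F y in at_left x. f y = y + c"
  shows "filtermap f (at_left x) = at_left (x + c)" "0 < x + c" "x + c \<le> 1"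
proof -
  show "filtermap f (at_left x) = at_left (x + c)"
    using filtermap_cong_eventually[OF assms(4)] by (simp add: filtermap_shift_at_left)
  have "\<forall>\<^sub>F y in at_left x. y \<in> circ" using assms germ_circ by simp
  with assms(4) have "\<forall>\<^sub>F y in at_left x. y + c \<in> circ"
    by eventually_elim (use iet_circ[OF assms(1)] in metis)
  then obtain e where e: "e < x" "\<And>y. e < y \<Longrightarrow> y < x \<Longrightarrow> 0 \<le> y + c \<and> y + c < 1"
    unfolding eventually_at_left_field by (auto simp: circ_def)
  show "0 < x + c" using e(1) e(2)[of "(e + x) / 2"] by (simp add: field_simps)
  show "x + c \<le> 1"
  proof (rule ccontr)
    assume "\<not> x + c \<le> 1"
    \<comment> \<open>If \<open>x + c\<close> exceeded 1, a point \<open>m\<close> just below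
      \<open>x\<close> would already have \<open>m + c\<close> at least 1, outside the
      circle.\<close>
    moreover define m where "m = max ((e + x) / 2) (1 - c)"
    ultimately have "e < m" "m < x" "1 - c \<le> m" using e(1) by (auto simp: less_max_iff_disj)
    then show False using e(2)[of m] by simp
  qed
qed

lemma iet_germ: assumes "iet f" "F \<in> germs" shows "filtermap f F \<in> germs"
  using assms(2)
proof (cases rule: germ_cases)
  case (right x)
  then show ?thesis using iet_rgerm[OF assms(1), of x] iet_circ[OF assms(1), of x] by (simp add: circ_def)
next
  case (left x)
  obtain c where "\<forall>\<^sub>F y in F. f y = y + c" using iet_translation[OF assms] .
  then show ?thesis using iet_at_left[OF assms(1)] left by simp
qed

text \<open>For a right germ the preimage point serves. A left germ at \<open>y\<close> has no such
  candidate, so compactness is used: if no germ were mapped to it, the image of each short interval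
  would miss a left neighbourhood of \<open>y\<close>, and so would the image of the whole
  circle.\<close>

lemma iet_germ_surj:
  assumes f: "iet f" and G: "G \<in> germs" shows "\<exists>F\<in>germs. filtermap f F = G"
  using G
proof (cases rule: germ_cases)
  case (right y)
  let ?x = "inv_into UNIV f y"
  have y: "y \<in> circ" using right by (simp add: circ_def)
  have x: "?x \<in> circ" using iet_circ[OF f, of ?x] iet_f_inv[OF f] y by simp
  then have "rgerm ?x \<in> germs" by (simp add: circ_def)
  then show ?thesis using iet_rgerm[OF f x] iet_f_inv[OF f] right by auto
next
  case (left y)
  show ?thesis
  proof (rule ccontr)
    assume no: "\<not> ?thesis"
    have "\<forall>\<^sub>F z in at_left y. z \<notin> f ` {0..<1}"
    proof (induction rule: germ_interval_induct[where Q="\<lambda>s t. \<forall>\<^sub>F z in at_left y. z \<notin> f ` {s..<t}"])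
      case (trans r s t)
      have "{r..<t} = {r..<s} \<union> {s..<t}" using trans by auto
      then show ?case using eventually_conj[OF trans(5,6)] by (simp add: image_Un)
    next
      case (local F)
      obtain c where c: "\<forall>\<^sub>F z in F. f z = z + c" using iet_translation[OF f local] .
      have "\<forall>\<^sub>F z in at_left y. z \<notin> f ` {s..<t}"
        if st: "0 \<le> s" "s < t" "t \<le> 1" "\<forall>z\<in>{s..<t}. f z = z + c" for s t
      proof -
        have img: "f ` {s..<t} = {s + c..<t + c}" using iet_shift_interval[OF f] st(4) by blast
        have "\<not> (s + c < y \<and> y \<le> t + c)"
        proof
          assume a: "s + c < y \<and> y \<le> t + c"
          have "\<forall>\<^sub>F z in at_left (y - c). f z = z + c"
            unfolding eventually_at_left_field using a st(4) by (intro exI[of _ s]) auto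
          moreover have "0 < y - c" "y - c \<le> 1" using a st by auto
          ultimately have "filtermap f (at_left (y - c)) = G" "at_left (y - c) \<in> germs"
            using iet_at_left(1)[OF f, of "y - c" c] left by auto
          then show False using no by blast
        qed
        then consider "y \<le> s + c" | "t + c < y" by linarith
        then show ?thesis
        proof cases
          case 1
          then show ?thesis unfolding img by (auto simp: eventually_at_left_field intro!: exI[of _ "y - 1"])
        next
          case 2
          then show ?thesis unfolding img by (auto simp: eventually_at_left_field intro!: exI[of _ "t + c"])
        qed
      qed
      then show ?case using c by blast
    qed auto
    moreover have "f ` {0..<1} = circ" using f by (simp add: iet_def bij_betw_def circ_def)
    ultimately show False using germ_not_both[OF G germ_circ[OF G]] left by simp
  qed
qed

lemma iet_id [simp]: "iet id"
  by (auto simp: iet_def intro!: exI[of _ 0])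

lemma iet_comp: assumes f: "iet f" and g: "iet g" shows "iet (f \<circ> g)"
  unfolding iet_def
proof (intro conjI allI impI ballI)
  show "bij_betw (f \<circ> g) circ circ" using f g by (auto simp: iet_def intro: bij_betw_trans)
  show "(f \<circ> g) x = x" if "x \<notin> circ" for x using that f g by (simp add: iet_def)
  fix F assume F: "F \<in> germs"
  obtain c where c: "\<forall>\<^sub>F y in F. g y = y + c" using iet_translation[OF g F] .
  obtain d where "\<forall>\<^sub>F y in filtermap g F. f y = y + d" using iet_translation[OF f iet_germ[OF g F]] .
  then have "\<forall>\<^sub>F y in F. f (g y) = g y + d" by (simp add: eventually_filtermap)
  with c have "\<forall>\<^sub>F y in F. (f \<circ> g) y = y + (c + d)" by eventually_elim simp
  then show "\<exists>c. \<forall>\<^sub>F y in F. (f \<circ> g) y = y + c" ..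
qed

text \<open>The translation constant of the inverse at a germ is read off at a preimage germ, so
  closure under inverses rests on surjectivity on germs.\<close>

lemma iet_inv: assumes f: "iet f" shows "iet (inv_into UNIV f)"
  unfolding iet_def
proof (intro conjI allI impI ballI)
  let ?g = "inv_into UNIV f"
  show "?g x = x" if "x \<notin> circ" for x
    using iet_inv_f[OF f, of x] iet_outside[OF f that] by simp
  show "bij_betw ?g circ circ"
  proof (rule bij_betw_byWitness[where f'=f])
    show "?g ` circ \<subseteq> circ" using iet_circ[OF f] iet_f_inv[OF f] by (metis image_subsetI)
    show "f ` circ \<subseteq> circ" using iet_circ[OF f] by blast
  qed (use f in auto)
  fix G assume "G \<in> germs"
  then obtain F where F: "F \<in> germs" "filtermap f F = G" using iet_germ_surj[OF f] by blast
  obtain c where "\<forall>\<^sub>F y in F. f y = y + c" using iet_translation[OF f F(1)] .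
  then have "\<forall>\<^sub>F y in F. ?g (f y) = f y + (- c)" 
    by eventually_elim (metis add_diff_cancel_right' diff_conv_add_uminus f iet_inv_f)
  then have "\<forall>\<^sub>F y in G. ?g y = y + (- c)" unfolding F(2)[symmetric] eventually_filtermap .
  then show "\<exists>c. \<forall>\<^sub>F y in G. ?g y = y + c" ..
qed

lemma clopen_vimage: assumes "iet f" "clopen b" shows "clopen (f -` b)"
  unfolding clopen_def
proof (intro conjI ballI)
  show "f -` b \<subseteq> circ" using iet_circ[OF assms(1)] clopen_subset[OF assms(2)] by blast
  fix F assume "F \<in> germs"
  then show "(\<forall>\<^sub>F y in F. y \<in> f -` b) \<or> (\<forall>\<^sub>F y in F. y \<notin> f -` b)"
    using clopen_decide[OF assms(2) iet_germ[OF assms(1)]] by (simp add: eventually_filtermap)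
qed

lemma iet_image_eq: "iet f \<Longrightarrow> f ` b = inv_into UNIV f -` b"
  by (metis bij_imp_bij_inv bij_vimage_eq_inv_image iet_bij inv_inv_eq)

lemma clopen_image: "iet f \<Longrightarrow> clopen b \<Longrightarrow> clopen (f ` b)"
  by (simp add: iet_image_eq iet_inv clopen_vimage)

text \<open>On a germ both maps are translations, which coincide everywhere or nowhere. Together
  with \<open>clopen_finite_empty\<close> this determines an exchange by its values up to finitely
  many points.\<close>

lemma clopen_neq: assumes "iet f" "iet g" shows "clopen {x. f x \<noteq> g x}"
  unfolding clopen_def
proof (intro conjI ballI)
  show "{x. f x \<noteq> g x} \<subseteq> circ" 
    using iet_outside[OF assms(1)] iet_outside[OF assms(2)] by force
  fix F assume F: "F \<in> germs"
  obtain c where c: "\<forall>\<^sub>F y in F. f y = y + c" using iet_translation[OF assms(1) F] .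
  obtain d where d: "\<forall>\<^sub>F y in F. g y = y + d" using iet_translation[OF assms(2) F] .
  show "(\<forall>\<^sub>F y in F. y \<in> {x. f x \<noteq> g x}) \<or> (\<forall>\<^sub>F y in F. y \<notin> {x. f x \<noteq> g x})"
  proof (cases "c = d")
    case True
    from c d have "\<forall>\<^sub>F y in F. y \<notin> {x. f x \<noteq> g x}" by eventually_elim (simp add: True)
    then show ?thesis ..
  next
    case False
    from c d have "\<forall>\<^sub>F y in F. y \<in> {x. f x \<noteq> g x}" by eventually_elim (simp add: False)
    then show ?thesis ..
  qed
qed

lemma clopen_finite_empty: assumes "clopen b" "finite b" shows "b = {}"
proof (rule ccontr)
  assume "b \<noteq> {}"
  then obtain x where "x \<in> b" by blast
  then obtain t where "x < t" "{x..<t} \<subseteq> b"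
    using clopen_contains_interval[OF assms(1), of x "x + 1"] by auto
  then show False using assms(2) infinite_Ico finite_subset by blast
qed

definition supp :: "(real \<Rightarrow> real) \<Rightarrow> real set" where
  "supp f = {x. f x \<noteq> x}"

lemma clopen_supp: "iet f \<Longrightarrow> clopen (supp f)"
  using clopen_neq[of f id] by (simp add: supp_def)

lemma supp_conj: assumes "iet g" shows "supp (g \<circ> f \<circ> inv_into UNIV g) = g ` supp f"
proof -
  have "x \<in> supp (g \<circ> f \<circ> inv_into UNIV g) \<longleftrightarrow> inv_into UNIV g x \<in> supp f" for x
    unfolding supp_def using iet_inj[OF assms, of "f (inv_into UNIV g x)" "inv_into UNIV g x"] assms by auto
  then show ?thesis unfolding iet_image_eq[OF assms] by auto
qed

lemma iet_restrict_involution: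
  assumes p: "iet p" "\<And>x. p (p x) = x" and c: "clopen c" "\<And>x. x \<in> c \<Longrightarrow> p x \<in> c"
  shows "iet (\<lambda>x. if x \<in> c then p x else x)"
  unfolding iet_def
proof (intro conjI allI impI ballI)
  let ?q = "\<lambda>x. if x \<in> c then p x else x"
  have q: "?q ` circ \<subseteq> circ" using iet_circ[OF p(1)] by auto
  show "bij_betw ?q circ circ" by (rule bij_betw_byWitness[where f'="?q"]) (use q p c in auto)
  show "?q x = x" if "x \<notin> circ" for x using that clopen_subset[OF c(1)] by auto
  fix F assume F: "F \<in> germs"
  obtain d where d: "\<forall>\<^sub>F y in F. p y = y + d" using iet_translation[OF p(1) F] .
  from clopen_decide[OF c(1) F] show "\<exists>d. \<forall>\<^sub>F y in F. ?q y = y + d"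
  proof
    assume "\<forall>\<^sub>F y in F. y \<in> c"
    with d have "\<forall>\<^sub>F y in F. ?q y = y + d" by eventually_elim simp
    then show ?thesis ..
  next
    assume "\<forall>\<^sub>F y in F. y \<notin> c"
    then have "\<forall>\<^sub>F y in F. ?q y = y + 0" by eventually_elim simp
    then show ?thesis ..
  qed
qed

section \<open>Rotations of subintervals and involutions with prescribed support\<close>

definition rot :: "real \<Rightarrow> real \<Rightarrow> real \<Rightarrow> real \<Rightarrow> real" where
  "rot s t h y = (if y \<in> {s..<t - h} then y + h else if y \<in> {t - h..<t} then y - (t - s - h) else y)"

text \<open>The two amounts add up to one full turn of the block [s, t), so the complementary
  rotation is the inverse.\<close>

lemma rot_rot:
  assumes "0 \<le> h" "h \<le> t - s" shows "rot s t (t - s - h) (rot s t h y) = y"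
  using assms by (auto simp: rot_def)

lemma iet_rot:
  assumes "0 \<le> s" "t \<le> 1" "0 \<le> h" "h \<le> t - s" shows "iet (rot s t h)"
  unfolding iet_def
proof (intro conjI allI impI ballI)
  show "rot s t h x = x" if "x \<notin> circ" for x using that assms by (auto simp: rot_def circ_def)
  have r: "rot s t h ` circ \<subseteq> circ" if "0 \<le> h" "h \<le> t - s" for h
    using that assms(1,2) by (auto simp: rot_def circ_def)
  show "bij_betw (rot s t h) circ circ"
    by (rule bij_betw_byWitness[where f'="rot s t (t - s - h)"])
      (use r[of h] r[of "t - s - h"] rot_rot[of h t s] rot_rot[of "t - s - h" t s] assms in auto)
  fix F assume F: "F \<in> germs"
  consider "\<forall>\<^sub>F y in F. y \<in> {s..<t - h}" | "\<forall>\<^sub>F y in F. y \<in> {t - h..<t}"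
    | "\<forall>\<^sub>F y in F. y \<notin> {s..<t - h}" "\<forall>\<^sub>F y in F. y \<notin> {t - h..<t}"
    using germ_interval_decide[OF F] by blast
  then show "\<exists>c. \<forall>\<^sub>F y in F. rot s t h y = y + c"
  proof cases
    case 1
    then have "\<forall>\<^sub>F y in F. rot s t h y = y + h" by eventually_elim (simp add: rot_def)
    then show ?thesis ..
  next
    case 2
    then have "\<forall>\<^sub>F y in F. rot s t h y = y + - (t - s - h)" by eventually_elim (simp add: rot_def)
    then show ?thesis ..
  next
    case 3
    then have "\<forall>\<^sub>F y in F. rot s t h y = y + 0" by eventually_elim (simp only: rot_def if_False add_0_right)
    then show ?thesis ..
  qed
qed

text \<open>A rotation of the whole circle acts as the shift wherever it does not wrap around; a
  negative \<open>d\<close> is a rotation by \<open>1 + d\<close>.\<close>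

lemma exists_iet_shift:
  assumes "\<bar>d\<bar> < 1"
  obtains r where "iet r" "\<And>y. y \<in> circ \<Longrightarrow> y + d \<in> circ \<Longrightarrow> r y = y + d"
proof (cases "d \<ge> 0")
  case True
  show thesis
    by (rule that[of "rot 0 1 d"]) (use True assms in \<open>auto intro!: iet_rot simp: rot_def circ_def\<close>)
next
  case False
  show thesis
    by (rule that[of "rot 0 1 (1 + d)"]) (use False assms in \<open>auto intro!: iet_rot simp: rot_def circ_def\<close>)
qed

text \<open>The half-turn of an interval is an involution moving each of its points. Involutions
  with disjoint supports commute, so half-turns can be composed along a subdivision adapted to
  \<open>b\<close>.\<close>

lemma exists_involution_supp:
  assumes b: "clopen b"
  obtains p where "iet p" "\<And>x. p (p x) = x" "supp p = b"
proof -
  have "\<exists>p. iet p \<and> (\<forall>x. p (p x) = x) \<and> supp p = b \<inter> {0..<1}"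
  proof (induction rule: germ_interval_induct[where
      Q="\<lambda>s t. \<exists>p. iet p \<and> (\<forall>x. p (p x) = x) \<and> supp p = b \<inter> {s..<t}"])
    case (refl x)
    show ?case by (rule exI[of _ id]) (auto simp: supp_def)
  next
    case (trans r s t)
    obtain p where p: "iet p" "\<And>x. p (p x) = x" "\<And>x. p x \<noteq> x \<longleftrightarrow> x \<in> b \<inter> {r..<s}"
      using trans(5) unfolding supp_def by blast
    obtain q where q: "iet q" "\<And>x. q (q x) = x" "\<And>x. q x \<noteq> x \<longleftrightarrow> x \<in> b \<inter> {s..<t}"
      using trans(6) unfolding supp_def by blast
    have pp: "p x \<in> b \<inter> {r..<s} \<longleftrightarrow> x \<in> b \<inter> {r..<s}" for x using p(2,3) by metis
    have qq: "q x \<in> b \<inter> {s..<t} \<longleftrightarrow> x \<in> b \<inter> {s..<t}" for x using q(2,3) by metis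
    have disj: "x \<notin> b \<inter> {s..<t}" if "x \<in> b \<inter> {r..<s}" for x using that by auto
    have *: "p (q x) = (if x \<in> b \<inter> {s..<t} then q x else p x)" for x
      using p(3) q(3) qq disj by metis
    have "p (q (p (q x))) = x" for x unfolding * using pp qq disj p(2,3) q(2,3) by metis
    moreover have "supp (p \<circ> q) = b \<inter> {r..<t}"
    proof -
      have "b \<inter> {r..<t} = b \<inter> {r..<s} \<union> b \<inter> {s..<t}" using trans by auto
      then show ?thesis unfolding supp_def o_def * using p(3) q(3) by auto
    qed
    ultimately show ?case using iet_comp[OF p(1) q(1)] by (intro exI[of _ "p \<circ> q"]) simp
  next
    case (local F)
    from clopen_decide[OF b local] show ?case
    proof
      assume ev: "\<forall>\<^sub>F y in F. y \<in> b"
      have "\<exists>p. iet p \<and> (\<forall>x. p (p x) = x) \<and> supp p = b \<inter> {s..<t}"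
        if "0 \<le> s" "s < t" "t \<le> 1" "\<forall>y\<in>{s..<t}. y \<in> b" for s t
      proof -
        let ?h = "(t - s) / 2"
        have "iet (rot s t ?h)" by (rule iet_rot) (use that in auto)
        moreover have half: "t - s - ?h = ?h" by (simp add: field_simps)
        have "rot s t ?h (rot s t ?h x) = x" for x
          using rot_rot[of ?h t s x] that unfolding half by simp
        moreover have "supp (rot s t ?h) = {s..<t}"
          using that(2) by (auto simp: supp_def rot_def field_simps)
        then have "supp (rot s t ?h) = b \<inter> {s..<t}" using that(4) by auto
        ultimately show ?thesis by blast
      qed
      then show ?case using ev by blast
    next
      assume "\<forall>\<^sub>F y in F. y \<notin> b"
      moreover have "\<exists>p. iet p \<and> (\<forall>x. p (p x) = x) \<and> supp p = b \<inter> {s..<t}"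
        if "\<forall>y\<in>{s..<t}. y \<notin> b" for s t
        by (rule exI[of _ id]) (use that in \<open>auto simp: supp_def\<close>)
      ultimately show ?case by blast
    qed
  qed
  moreover have "b \<inter> {0..<1} = b" using clopen_subset[OF b] by (auto simp: circ_def)
  ultimately show thesis using that by metis
qed

section \<open>Equivalence with the definition by finite partitions\<close>

lemma frac_germ:
  assumes "F \<in> germs" shows "\<exists>d. \<forall>\<^sub>F y in F. frac (y + c) = y + d"
  using assms
proof (cases rule: germ_cases)
  case (right x)
  have "frac (y + c) = y + (c - of_int \<lfloor>x + c\<rfloor>)" if "x \<le> y" "y < of_int \<lfloor>x + c\<rfloor> + 1 - c" for y
  proof -
    have "\<lfloor>y + c\<rfloor> = \<lfloor>x + c\<rfloor>" using that by linarith
    then show ?thesis by (simp add: frac_def)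
  qed
  moreover have "of_int \<lfloor>x + c\<rfloor> + 1 - c > x" by linarith
  ultimately have "\<forall>\<^sub>F y in F. frac (y + c) = y + (c - of_int \<lfloor>x + c\<rfloor>)"
    unfolding right eventually_rgerm by blast
  then show ?thesis ..
next
  case (left x)
  \<comment> \<open>Just below \<open>x\<close> the integer part is
    \<open>\<lceil>x + c\<rceil> - 1\<close>, also when \<open>x + c\<close> is an integer, where
    the floor of \<open>x + c\<close> would be too large.\<close>
  have "frac (y + c) = y + (c - (of_int \<lceil>x + c\<rceil> - 1))" if "y < x" "of_int \<lceil>x + c\<rceil> - 1 - c < y" for y
  proof -
    have "\<lfloor>y + c\<rfloor> = \<lceil>x + c\<rceil> - 1" using that by linarith
    then show ?thesis by (simp add: frac_def)
  qed
  moreover have "of_int \<lceil>x + c\<rceil> - 1 - c < x" by linarith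
  ultimately have "\<forall>\<^sub>F y in F. frac (y + c) = y + (c - (of_int \<lceil>x + c\<rceil> - 1))"
    unfolding left eventually_at_left_field by blast
  then show ?thesis ..
qed

lemma is_iet_imp_iet: assumes "is_iet f" shows "iet f"
proof -
  obtain n a c where a: "a 0 = (0::real)" "a n = 1" "\<forall>i<n. a i < a (Suc i)"
    and f: "\<forall>i<n. \<forall>x\<in>{a i..<a (Suc i)}. f x = frac (x + c i)"
    using assms unfolding is_iet_def by blast
  have cover: "\<exists>i<n. x \<in> {a i..<a (Suc i)}" if "x \<in> circ" for x
  proof -
    have "\<exists>i<m. x \<in> {a i..<a (Suc i)}" if "x < a m" "m \<le> n" for m
      using that
    proof (induction m)
      case 0
      then show ?case using \<open>x \<in> circ\<close> a(1) by (simp add: circ_def)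
    next
      case (Suc m)
      then show ?case by (cases "x < a m") (auto simp: less_Suc_eq)
    qed
    then show ?thesis using that a(2) by (simp add: circ_def)
  qed
  have "\<exists>d. \<forall>\<^sub>F y in F. f y = y + d" if F: "F \<in> germs" for F
  proof -
    \<comment> \<open>A germ decides each of the finitely many pieces and cannot avoid them all,
      since they cover the circle.\<close>
    have "\<exists>i<n. \<forall>\<^sub>F y in F. y \<in> {a i..<a (Suc i)}"
    proof (rule ccontr)
      assume "\<not> ?thesis"
      then have "\<forall>i\<in>{..<n}. \<forall>\<^sub>F y in F. y \<notin> {a i..<a (Suc i)}"
        using germ_interval_decide[OF F] by blast
      then have "\<forall>\<^sub>F y in F. \<forall>i\<in>{..<n}. y \<notin> {a i..<a (Suc i)}"
        by (intro eventually_ball_finite) auto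
      then have "\<forall>\<^sub>F y in F. y \<notin> circ" by eventually_elim (use cover in auto)
      then show False using germ_not_both[OF F germ_circ[OF F]] by blast
    qed
    then obtain i where i: "i < n" "\<forall>\<^sub>F y in F. y \<in> {a i..<a (Suc i)}" by blast
    obtain d where "\<forall>\<^sub>F y in F. frac (y + c i) = y + d" using frac_germ[OF F] by blast
    with i(2) have "\<forall>\<^sub>F y in F. f y = y + d" by eventually_elim (use f i(1) in auto)
    then show ?thesis ..
  qed
  then show ?thesis using assms by (simp add: iet_def is_iet_def)
qed

text \<open>Compactness turns local translations into a finite partition, by concatenating
  subdivisions of adjacent intervals. The induction carries exact translations; \<open>frac\<close>
  is inserted at the end, where it changes nothing because the values of \<open>f\<close> lie in the
  circle.\<close>

lemma iet_imp_is_iet: assumes "iet f" shows "is_iet f"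
proof -
  define Q where "Q s t \<longleftrightarrow> (\<exists>(n::nat) a c. a 0 = s \<and> a n = t \<and> (\<forall>i<n. a i < a (Suc i)) \<and>
        (\<forall>i<n. \<forall>x\<in>{a i..<a (Suc i)}. f x = x + c i))" for s t :: real
  have "Q 0 1"
  proof (induction rule: germ_interval_induct[where Q=Q])
    case (refl x)
    show ?case unfolding Q_def by (rule exI[of _ 0]) auto
  next
    case (trans r s t)
    obtain n a c where 1: "a 0 = r" "a n = s" "\<forall>i<n. a i < a (Suc i)"
        "\<forall>i<n. \<forall>x\<in>{a i..<a (Suc i)}. f x = x + c i"
      using trans(5) unfolding Q_def by blast
    obtain m b d where 2: "b 0 = s" "b m = t" "\<forall>i<m. b i < b (Suc i)"
        "\<forall>i<m. \<forall>x\<in>{b i..<b (Suc i)}. f x = x + d i"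
      using trans(6) unfolding Q_def by blast
    \<comment> \<open>Division points switch to the second list after index \<open>n\<close>,
      translation constants already at \<open>n\<close>: the piece with index \<open>n\<close> is
      the first piece of the second list, and \<open>a n = b 0\<close>.\<close>
    define a' where "a' = (\<lambda>i. if i \<le> n then a i else b (i - n))"
    define c' where "c' = (\<lambda>i. if i < n then c i else d (i - n))"
    have step: "(a' i = a i \<and> a' (Suc i) = a (Suc i) \<and> c' i = c i \<and> i < n) \<or>
        (\<exists>j<m. a' i = b j \<and> a' (Suc i) = b (Suc j) \<and> c' i = d j)" if "i < n + m" for i
    proof (cases "i < n")
      case False
      then have "a' i = b (i - n)" "a' (Suc i) = b (Suc (i - n))" "c' i = d (i - n)" "i - n < m"
        using that 1(2) 2(1) by (auto simp: a'_def c'_def Suc_diff_le)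
      then show ?thesis by blast
    qed (simp add: a'_def c'_def)
    show ?case unfolding Q_def
    proof (rule exI[of _ "n + m"], rule exI[of _ a'], rule exI[of _ c'], intro conjI allI impI)
      show "a' 0 = r" using 1 by (simp add: a'_def)
      show "a' (n + m) = t" using 1 2 by (cases "m = 0") (auto simp: a'_def)
      show "a' i < a' (Suc i)" if "i < n + m" for i using step[OF that] 1(3) 2(3) by metis
      show "\<forall>x\<in>{a' i..<a' (Suc i)}. f x = x + c' i" if "i < n + m" for i
        using step[OF that] 1(4) 2(4) by metis
    qed
  next
    case (local F)
    obtain d where d: "\<forall>\<^sub>F y in F. f y = y + d" using iet_translation[OF assms local] .
    have "Q s t" if "s < t" "\<forall>y\<in>{s..<t}. f y = y + d" for s t
      unfolding Q_def
      by (rule exI[of _ 1], rule exI[of _ "\<lambda>i::nat. if i = 0 then s else t"], rule exI[of _ "\<lambda>i. d"])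
        (use that in auto)
    then show ?case using d by blast
  qed
  then obtain n a c where a: "a 0 = 0" "a n = 1" "\<forall>i<n. a i < a (Suc i)"
      "\<forall>i<n. \<forall>x\<in>{a i..<a (Suc i)}. f x = x + c i"
    unfolding Q_def by blast
  have mono: "i \<le> j \<Longrightarrow> j \<le> n \<Longrightarrow> a i \<le> a j" for i j
  proof (induction j)
    case (Suc j)
    show ?case
    proof (cases "i = Suc j")
      case False
      then have "a i \<le> a j" using Suc by simp
      moreover have "a j < a (Suc j)" using a(3) Suc.prems by simp
      ultimately show ?thesis by linarith
    qed simp
  qed simp
  have "f x = frac (x + c i)" if "i < n" "x \<in> {a i..<a (Suc i)}" for i x
  proof -
    have "x \<in> circ" using that mono[of 0 i] mono[of "Suc i" n] a(1,2) by (auto simp: circ_def)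
    then have "f x \<in> circ" using iet_circ[OF assms] by blast
    then have "frac (f x) = f x" by (simp add: frac_eq circ_def)
    moreover have "f x = x + c i" using a(4) that by blast
    ultimately show ?thesis by metis
  qed
  then show ?thesis using assms a(1-3) unfolding is_iet_def iet_def by blast
qed

lemma is_iet_iff_iet: "is_iet f \<longleftrightarrow> iet f"
  using is_iet_imp_iet iet_imp_is_iet by blast

section \<open>Supports of involutions in terms of the group\<close>

lemma separate_points:
  assumes "x \<in> circ" "x \<noteq> z"
  obtains b where "clopen b" "x \<in> b" "z \<notin> b"
proof (cases "x < z")
  case True
  show thesis
    by (rule that[of "{x..<min 1 z}"])
      (use True assms in \<open>auto simp: circ_def intro!: clopen_interval\<close>)
next
  case False
  show thesis
    by (rule that[of "{x..<1}"])
      (use False assms in \<open>auto simp: circ_def intro!: clopen_interval\<close>)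
qed

text \<open>From a neighbourhood of \<open>x\<close> that misses \<open>f x\<close>, discard the
  points which \<open>f\<close> sends back into it; the rest is disjoint from its image.\<close>

lemma displaced_nbhd:
  assumes f: "iet f" and x: "x \<in> circ" "f x \<noteq> x"
  obtains J where "clopen J" "x \<in> J" "\<And>y. y \<in> J \<Longrightarrow> f y \<notin> J"
proof -
  obtain b where b: "clopen b" "x \<in> b" "f x \<notin> b" using separate_points[OF x(1), of "f x"] x(2) by metis
  show thesis
  proof (rule that[of "b - f -` b"])
    show "clopen (b - f -` b)" using b f by (intro clopen_Diff clopen_vimage)
  qed (use b in auto)
qed

text \<open>\<open>g\<close> rotates a small interval by a third of its length and is copied by
  \<open>p\<close> onto the image interval, which makes it commute with \<open>p\<close>. A third of
  a turn separates \<open>g x\<close> from the inverse value \<open>h x\<close>; a half-turn would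
  not.\<close>

lemma exists_commuting_order3:
  assumes p: "iet p" "\<And>x. p (p x) = x" and J: "clopen J" "x \<in> J"
  obtains g h where "iet g" "iet h" "g \<circ> h = id" "g \<circ> p = p \<circ> g" "g x \<noteq> h x" "h x \<in> J"
    "\<And>y. y \<notin> J \<Longrightarrow> p y \<notin> J \<Longrightarrow> g y = y" "\<And>y. y \<notin> J \<Longrightarrow> p y \<notin> J \<Longrightarrow> h y = y"
proof -
  have xc: "x \<in> circ" using J clopen_subset by blast
  \<comment> \<open>A small enough neighbourhood is either fixed pointwise by the involution or
    displaced by it, so only these two cases remain.\<close>
  obtain K where K: "clopen K" "x \<in> K" "K \<subseteq> J" "(\<forall>y\<in>K. p y = y) \<or> (\<forall>y\<in>K. p y \<notin> K)"
  proof (cases "p x = x")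
    case True
    show thesis
    proof (rule that[of "J - supp p"])
      show "clopen (J - supp p)" using J p by (intro clopen_Diff clopen_supp)
    qed (use True J in \<open>auto simp: supp_def\<close>)
  next
    case False
    obtain J' where "clopen J'" "x \<in> J'" "\<And>y. y \<in> J' \<Longrightarrow> p y \<notin> J'"
      using displaced_nbhd[OF p(1) xc False] by blast
    then show thesis using J by (intro that[of "J \<inter> J'"]) (auto intro: clopen_Int)
  qed
  obtain t where t: "x < t" "t \<le> 1" "{x..<t} \<subseteq> K"
    using clopen_contains_interval[OF K(1,2), of 1] xc by (auto simp: circ_def)
  define I where "I = {x..<t}"
  define l where "l = (t - x) / 3"
  define \<sigma> where "\<sigma> = rot x t l"
  define \<tau> where "\<tau> = rot x t (2 * l)"
  have l: "0 < l" "t = x + 3 * l" using t by (auto simp: l_def field_simps)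
  have iets: "iet \<sigma>" "iet \<tau>"
    unfolding \<sigma>_def \<tau>_def using t xc l by (auto intro!: iet_rot simp: circ_def)
  have st: "\<sigma> (\<tau> y) = y" "\<tau> (\<sigma> y) = y" for y
    using rot_rot[of "2 * l" t x y] rot_rot[of l t x y] l by (auto simp: \<sigma>_def \<tau>_def)
  have out: "\<sigma> y = y" "\<tau> y = y" if "y \<notin> I" for y
    using that l by (auto simp: \<sigma>_def \<tau>_def I_def rot_def)
  have ins: "\<sigma> y \<in> I \<longleftrightarrow> y \<in> I" "\<tau> y \<in> I \<longleftrightarrow> y \<in> I" for y
    using st out by metis+
  have x: "x \<in> I" "\<sigma> x \<noteq> \<tau> x" using l by (auto simp: I_def \<sigma>_def \<tau>_def rot_def)
  have I: "(\<forall>y\<in>I. p y = y) \<or> (\<forall>y\<in>I. p y \<notin> I)" using K(4) t(3) unfolding I_def by blast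
  have IJ: "I \<subseteq> J" using K(3) t(3) unfolding I_def by blast
  \<comment> \<open>\<open>E \<rho>\<close> acts by \<open>\<rho>\<close> on \<open>I\<close>, by
    the conjugate of \<open>\<rho>\<close> under \<open>p\<close> on the \<open>p\<close>-image of
    \<open>I\<close>, and trivially elsewhere. If \<open>p\<close> fixes \<open>I\<close> pointwise,
    it is \<open>\<rho>\<close> itself.\<close>
  define E where "E \<rho> y = (if y \<in> I then \<rho> y else if p y \<in> I then p (\<rho> (p y)) else y)" for \<rho> y
  have E_iet: "iet (E \<rho>)" if r: "iet \<rho>" "\<And>y. \<rho> y \<in> I \<longleftrightarrow> y \<in> I" "\<And>y. y \<notin> I \<Longrightarrow> \<rho> y = y" for \<rho>
    using I
  proof
    assume a: "\<forall>y\<in>I. p y = y"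
    have "E \<rho> y = \<rho> y" for y using a r(2,3) p(2) unfolding E_def by metis
    then have "E \<rho> = \<rho>" by (rule ext)
    then show ?thesis using r by simp
  next
    assume a: "\<forall>y\<in>I. p y \<notin> I"
    have "E \<rho> y = (\<rho> \<circ> p \<circ> \<rho> \<circ> p) y" for y using a r(2,3) p(2) unfolding E_def o_def by metis
    then have "E \<rho> = \<rho> \<circ> p \<circ> \<rho> \<circ> p" by (rule ext)
    then show ?thesis using r p by (simp add: iet_comp)
  qed
  have "E \<sigma> (E \<tau> y) = y \<and> E \<sigma> (p y) = p (E \<sigma> y)" for y
    using I
  proof
    assume a: "\<forall>y\<in>I. p y = y"
    then have "p y \<in> I \<longleftrightarrow> y \<in> I" for y using p(2) by metis
    then show ?thesis using a by (simp add: E_def ins st)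
  next
    assume a: "\<forall>y\<in>I. p y \<notin> I"
    then show ?thesis by (simp add: E_def ins st p(2))
  qed
  moreover have "E \<sigma> x \<noteq> E \<tau> x" "E \<tau> x \<in> J" using x ins IJ by (auto simp: E_def)
  moreover have "E \<rho> y = y" if "y \<notin> J" "p y \<notin> J" for y \<rho>
    using that IJ by (auto simp: E_def)
  ultimately show thesis
    using E_iet[OF iets(1) ins(1) out(1)] E_iet[OF iets(2) ins(2) out(2)]
    by (intro that[of "E \<sigma>" "E \<tau>"]) (auto simp: fun_eq_iff)
qed

text \<open>
  For an involution \<open>p\<close>, \<open>locU p\<close> consists of the restrictions of \<open>p\<close> to invariant sets, an element of
  \<open>locV p\<close> agrees with the identity or with \<open>p\<close> at each point of \<open>supp p\<close> and is arbitrary elsewhere,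
  so squares of such elements are the identity on \<open>supp p\<close>.
\<close>

definition locU :: "(real \<Rightarrow> real) \<Rightarrow> (real \<Rightarrow> real) set" where
  "locU p = {f. iet f \<and> f \<circ> f = id \<and> f \<circ> p = p \<circ> f \<and>
     (\<forall>g h. iet g \<longrightarrow> iet h \<longrightarrow> g \<circ> h = id \<longrightarrow> g \<circ> p = p \<circ> g \<longrightarrow> f \<circ> g \<circ> f \<circ> h = g \<circ> f \<circ> h \<circ> f)}"

definition locV :: "(real \<Rightarrow> real) \<Rightarrow> (real \<Rightarrow> real) set" where
  "locV p = {f. iet f \<and> (\<forall>u\<in>locU p. f \<circ> u = u \<circ> f)}"

text \<open>Squaring erases the action as \<open>p\<close> on \<open>supp p\<close>, so the squares
  are supported off \<open>supp p\<close>, and commuting with all of them detects containment in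
  \<open>supp p\<close>. Only group words and quantifiers over the group occur in the three sets,
  hence automorphisms transport them.\<close>

definition locW :: "(real \<Rightarrow> real) \<Rightarrow> (real \<Rightarrow> real) set" where
  "locW p = {f. iet f \<and> (\<forall>v\<in>locV p. f \<circ> v \<circ> v = v \<circ> v \<circ> f)}"

lemma comp_id_commute:
  assumes "iet g" "iet h" "g \<circ> h = id" shows "h (g x) = x" "g (h x) = x"
proof -
  show gh: "g (h x) = x" for x using assms(3) by (metis comp_apply id_apply)
  show "h (g x) = x" using gh[of "g x"] iet_inj[OF assms(1)] by simp
qed

text \<open>By definition \<open>f\<close> commutes with its conjugates
  \<open>g \<circ> f \<circ> h\<close> by the centralizer of \<open>p\<close>. If \<open>f x\<close>
  were neither \<open>x\<close> nor \<open>p x\<close>, a third-turn \<open>g\<close> concentrated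
  near \<open>x\<close> and \<open>p x\<close> would fix \<open>f x\<close>, and evaluating the
  commutation at \<open>x\<close> would give \<open>h x = g x\<close>.\<close>

lemma locU_pointwise:
  assumes p: "iet p" "\<And>x. p (p x) = x" and f: "f \<in> locU p"
  shows "f x = x \<or> f x = p x"
proof (rule ccontr)
  assume a: "\<not> ?thesis"
  have fi: "iet f" "\<And>x. f (f x) = x"
    and comm: "\<And>g h. iet g \<Longrightarrow> iet h \<Longrightarrow> g \<circ> h = id \<Longrightarrow> g \<circ> p = p \<circ> g \<Longrightarrow> f \<circ> g \<circ> f \<circ> h = g \<circ> f \<circ> h \<circ> f"
    using f unfolding locU_def by (auto simp: fun_eq_iff)
  have x: "x \<in> circ" using a iet_outside[OF fi(1)] by blast
  \<comment> \<open>Displacement by \<open>p \<circ> f\<close> keeps \<open>f y\<close> out of the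
    \<open>p\<close>-image of the neighbourhood, displacement by \<open>f\<close> out of the
    neighbourhood itself; these are the two places where \<open>g\<close> may act.\<close>
  have "(p \<circ> f) x \<noteq> x" using a p(2) by (metis comp_apply)
  then obtain J1 where J1: "clopen J1" "x \<in> J1" "\<And>y. y \<in> J1 \<Longrightarrow> (p \<circ> f) y \<notin> J1"
    using displaced_nbhd[OF iet_comp[OF p(1) fi(1)] x] by blast
  obtain J2 where J2: "clopen J2" "x \<in> J2" "\<And>y. y \<in> J2 \<Longrightarrow> f y \<notin> J2"
    using displaced_nbhd[OF fi(1) x] a by blast
  have "clopen (J1 \<inter> J2)" "x \<in> J1 \<inter> J2" using J1 J2 by (auto intro: clopen_Int)
  then obtain g h where gh: "iet g" "iet h" "g \<circ> h = id" "g \<circ> p = p \<circ> g" "g x \<noteq> h x" "h x \<in> J1 \<inter> J2"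
    "\<And>y. y \<notin> J1 \<inter> J2 \<Longrightarrow> p y \<notin> J1 \<inter> J2 \<Longrightarrow> g y = y"
    "\<And>y. y \<notin> J1 \<inter> J2 \<Longrightarrow> p y \<notin> J1 \<inter> J2 \<Longrightarrow> h y = y"
    using exists_commuting_order3[OF p] by metis
  have "f (g (f (h x))) = g (f (h (f x)))"
    using comm[OF gh(1-4)] by (metis comp_apply)
  moreover have "g (f (h x)) = f (h x)" using gh(6) J1(3) J2(3) by (intro gh(7)) auto
  moreover have "h (f x) = f x" using J1(2,3) J2(2,3) by (intro gh(8)) auto
  ultimately show False using fi(2) gh(5) by simp
qed

text \<open>Conjugating a restriction of \<open>p\<close> by an element commuting with
  \<open>p\<close> gives the restriction to the moved set, and any two restrictions of
  \<open>p\<close> to invariant sets commute.\<close>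

lemma restrict_in_locU:
  assumes p: "iet p" "\<And>x. p (p x) = x" and c: "clopen c" "\<And>x. x \<in> c \<Longrightarrow> p x \<in> c"
  shows "(\<lambda>x. if x \<in> c then p x else x) \<in> locU p"
proof -
  let ?q = "\<lambda>x. if x \<in> c then p x else x"
  have c': "p x \<in> c \<longleftrightarrow> x \<in> c" for x using c(2) p(2) by metis
  have "?q (g (?q (h y))) = g (?q (h (?q y)))"
    if gh: "iet g" "iet h" "g \<circ> h = id" "g \<circ> p = p \<circ> g" for g h y
  proof -
    have 1: "h (g y) = y" "g (h y) = y" for y using comp_id_commute[OF gh(1-3)] by auto
    have 2: "g (p y) = p (g y)" for y using gh(4) by (metis comp_apply)
    have 3: "h (p y) = p (h y)" for y using 1 2 by metis
    show ?thesis by (auto simp: 1 2 3 p(2) c')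
  qed
  then show ?thesis unfolding locU_def
    using iet_restrict_involution[OF p c] by (auto simp: fun_eq_iff p(2) c')
qed

text \<open>Otherwise some \<open>p\<close>-invariant clopen set contains \<open>x\<close> but not
  \<open>v x\<close>. Commuting with the restriction of \<open>p\<close> to it forces
  \<open>v (p x) = v x\<close>, against \<open>x \<in> supp p\<close>.\<close>

lemma locV_pointwise:
  assumes p: "iet p" "\<And>x. p (p x) = x" and v: "v \<in> locV p" and x: "x \<in> supp p"
  shows "v x = x \<or> v x = p x"
proof (rule ccontr)
  assume a: "\<not> ?thesis"
  have v': "iet v" "\<And>u. u \<in> locU p \<Longrightarrow> v \<circ> u = u \<circ> v" using v unfolding locV_def by auto
  have xc: "x \<in> circ" using x clopen_subset[OF clopen_supp[OF p(1)]] by blast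
  obtain b where b: "clopen b" "x \<in> b" "v x \<notin> b" using separate_points[OF xc, of "v x"] a by metis
  have "x \<noteq> p (v x)" using a p(2) by metis
  then obtain b' where b': "clopen b'" "x \<in> b'" "p (v x) \<notin> b'" using separate_points[OF xc] by metis
  define c where "c = (b \<inter> b') \<union> p -` (b \<inter> b')"
  have "clopen c" unfolding c_def using b(1) b'(1) p(1) by (intro clopen_Un clopen_vimage clopen_Int)
  moreover have "p y \<in> c" if "y \<in> c" for y using that p(2) by (auto simp: c_def)
  ultimately have "(\<lambda>x. if x \<in> c then p x else x) \<in> locU p" by (rule restrict_in_locU[OF p])
  from v'(2)[OF this] have "v (if x \<in> c then p x else x) = (if v x \<in> c then p (v x) else v x)"
    unfolding fun_eq_iff o_def by blast
  moreover have "x \<in> c" "v x \<notin> c" using b b' by (auto simp: c_def)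
  ultimately have "p x = x" using iet_inj[OF v'(1)] by simp
  then show False using x by (simp add: supp_def)
qed

text \<open>\<open>p\<close> itself lies in \<open>locU p\<close>, so \<open>v\<close> commutes with
  it and acts on the orbit of \<open>x\<close> under \<open>p\<close> as the identity or as the
  swap.\<close>

lemma locV_square:
  assumes p: "iet p" "\<And>x. p (p x) = x" and v: "v \<in> locV p" and x: "x \<in> supp p"
  shows "v (v x) = x"
proof -
  have "(\<lambda>x. if x \<in> circ then p x else x) = p" using iet_outside[OF p(1)] by auto
  then have "p \<in> locU p" using restrict_in_locU[OF p clopen_circ] iet_circ[OF p(1)] by simp
  then have "v (p x) = p (v x)" using v unfolding locV_def by (auto simp: fun_eq_iff)
  then show ?thesis using locV_pointwise[OF assms] p(2) by metis
qed

text \<open>Squares from \<open>locV p\<close> fix \<open>supp p\<close> pointwise, hence preserve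
  its complement, and commute with everything supported in \<open>supp p\<close>. Conversely, if
  \<open>f\<close> moves a point \<open>x\<close> off \<open>supp p\<close>, a third-turn near
  \<open>x\<close> lies in \<open>locV p\<close>, since \<open>locU p\<close> acts trivially there,
  and its square does not commute with \<open>f\<close> at \<open>x\<close>.\<close>

theorem locW_eq:
  assumes p: "iet p" "\<And>x. p (p x) = x"
  shows "locW p = {f. iet f \<and> supp f \<subseteq> supp p}"
proof (intro subset_antisym subsetI)
  fix f assume "f \<in> {f. iet f \<and> supp f \<subseteq> supp p}"
  then have f: "iet f" "supp f \<subseteq> supp p" by auto
  have "f (v (v y)) = v (v (f y))" if v: "v \<in> locV p" for v y
  proof (cases "y \<in> supp p")
    case True
    have "f y \<in> supp p"
    proof (cases "f y = y")
      case False
      then have "f y \<in> supp f" using iet_inj[OF f(1)] by (simp add: supp_def)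
      then show ?thesis using f by blast
    qed (use True in simp)
    then show ?thesis using locV_square[OF p v] True by simp
  next
    case False
    have iv: "iet v" using v by (simp add: locV_def)
    have "v (v y) \<notin> supp f"
    proof
      assume a: "v (v y) \<in> supp f"
      then have "v (v (v (v y))) = v (v y)" using locV_square[OF p v] f by blast
      then have "v (v y) = y" using iet_inj[OF iv] by simp
      then show False using a False f by auto
    qed
    moreover have "y \<notin> supp f" using False f by blast
    ultimately show ?thesis by (simp add: supp_def)
  qed
  then show "f \<in> locW p" using f by (simp add: locW_def fun_eq_iff)
next
  fix f assume "f \<in> locW p"
  then have f: "iet f" "\<And>v. v \<in> locV p \<Longrightarrow> f \<circ> v \<circ> v = v \<circ> v \<circ> f" by (auto simp: locW_def)
  have "x \<in> supp p" if x: "x \<in> supp f" for x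
  proof (rule ccontr)
    assume xp: "x \<notin> supp p"
    have xc: "x \<in> circ" using x clopen_subset[OF clopen_supp[OF f(1)]] by blast
    obtain J' where J': "clopen J'" "x \<in> J'" "\<And>y. y \<in> J' \<Longrightarrow> f y \<notin> J'"
      using displaced_nbhd[OF f(1) xc] x by (auto simp: supp_def)
    define J where "J = J' - supp p"
    have J: "clopen J" "x \<in> J" "f x \<notin> J" "\<And>y. y \<in> J \<Longrightarrow> p y = y"
      using J' xp clopen_supp[OF p(1)] by (auto simp: J_def clopen_Diff supp_def)
    obtain g h where gh: "iet g" "iet h" "g \<circ> h = id" "g x \<noteq> h x"
        "\<And>y. y \<notin> J \<Longrightarrow> p y \<notin> J \<Longrightarrow> g y = y"
      using exists_commuting_order3[OF p J(1,2)] by metis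
    have pJ: "p y \<in> J \<longleftrightarrow> y \<in> J" for y using J(4) p(2) by metis
    then have out: "g y = y" if "y \<notin> J" for y using gh(5) that by blast
    have ins: "g y \<in> J \<longleftrightarrow> y \<in> J" for y using out iet_inj[OF gh(1)] by metis
    have "g (u y) = u (g y)" if u: "u \<in> locU p" for u y
      using locU_pointwise[OF p u] J(4) pJ out ins by metis
    then have "g \<in> locV p" using gh(1) by (simp add: locV_def fun_eq_iff)
    then have "f (g (g x)) = g (g (f x))" using f(2) by (metis comp_apply)
    then have "g (g x) = x" using out J(3) iet_inj[OF f(1)] by simp
    then show False using comp_id_commute[OF gh(1-3)] gh(4) by metis
  qed
  then show "f \<in> {f. iet f \<and> supp f \<subseteq> supp p}" using f by blast
qed

section \<open>The Boolean automorphism induced by a group automorphism\<close>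

text \<open>Conditions are imposed on exchanges only, without extensionality, so that
  \<open>reflect\<close> and plain compositions are instances as they stand.\<close>

locale iet_automorphism =
  fixes \<Phi> :: "(real \<Rightarrow> real) \<Rightarrow> (real \<Rightarrow> real)"
  assumes bij: "bij_betw \<Phi> (Collect iet) (Collect iet)"
    and hom: "iet f \<Longrightarrow> iet g \<Longrightarrow> \<Phi> (f \<circ> g) = \<Phi> f \<circ> \<Phi> g"
begin

lemma iet_\<Phi> [simp]: "iet f \<Longrightarrow> iet (\<Phi> f)"
  using bij by (auto simp: bij_betw_def)

lemma \<Phi>_surj: assumes "iet g" obtains f where "iet f" "\<Phi> f = g"
  using bij assms unfolding bij_betw_def by (metis imageE mem_Collect_eq)

lemma \<Phi>_eq_iff: "iet f \<Longrightarrow> iet g \<Longrightarrow> \<Phi> f = \<Phi> g \<longleftrightarrow> f = g"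
  using bij by (auto simp: bij_betw_def inj_on_def)

lemma \<Phi>_id [simp]: "\<Phi> id = id"
proof -
  have "\<Phi> id (\<Phi> id x) = \<Phi> id x" for x using hom[of id id] by (metis comp_apply comp_id iet_id)
  then show ?thesis using iet_inj[of "\<Phi> id"] by (auto simp: fun_eq_iff)
qed

lemma inverse: "iet_automorphism (inv_into (Collect iet) \<Phi>)"
proof
  let ?\<Psi> = "inv_into (Collect iet) \<Phi>"
  show "bij_betw ?\<Psi> (Collect iet) (Collect iet)" by (rule bij_betw_inv_into[OF bij])
  fix f g assume fg: "iet f" "iet g"
  obtain a where a: "iet a" "\<Phi> a = f" using \<Phi>_surj[OF fg(1)] .
  obtain b where b: "iet b" "\<Phi> b = g" using \<Phi>_surj[OF fg(2)] .
  have inv: "?\<Psi> (\<Phi> c) = c" if "iet c" for c using bij that by (simp add: bij_betw_def)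
  show "?\<Psi> (f \<circ> g) = ?\<Psi> f \<circ> ?\<Psi> g"
    using inv[OF iet_comp[OF a(1) b(1)]] inv[OF a(1)] inv[OF b(1)] hom[OF a(1) b(1)] a b by simp
qed

text \<open>Test elements are pulled back by surjectivity of \<open>\<Phi>\<close>, and the
  equations they must satisfy by injectivity.\<close>

lemma locU_image: assumes "iet p" "f \<in> locU p" shows "\<Phi> f \<in> locU (\<Phi> p)"
proof -
  have f: "iet f" "f \<circ> f = id" "f \<circ> p = p \<circ> f"
    and fc: "\<And>g h. iet g \<Longrightarrow> iet h \<Longrightarrow> g \<circ> h = id \<Longrightarrow> g \<circ> p = p \<circ> g \<Longrightarrow> f \<circ> g \<circ> f \<circ> h = g \<circ> f \<circ> h \<circ> f"
    using assms(2) by (auto simp: locU_def)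
  have "\<Phi> f \<circ> g \<circ> \<Phi> f \<circ> h = g \<circ> \<Phi> f \<circ> h \<circ> \<Phi> f"
    if gh: "iet g" "iet h" "g \<circ> h = id" "g \<circ> \<Phi> p = \<Phi> p \<circ> g" for g h
  proof -
    obtain a where a: "iet a" "\<Phi> a = g" using \<Phi>_surj[OF gh(1)] .
    obtain b where b: "iet b" "\<Phi> b = h" using \<Phi>_surj[OF gh(2)] .
    have "\<Phi> (a \<circ> b) = \<Phi> id" using gh(3) a b hom by simp
    then have 1: "a \<circ> b = id" using \<Phi>_eq_iff iet_comp[OF a(1) b(1)] iet_id by blast
    have "\<Phi> (a \<circ> p) = \<Phi> (p \<circ> a)" using gh(4) a assms(1) hom by simp
    then have 2: "a \<circ> p = p \<circ> a" using \<Phi>_eq_iff iet_comp assms(1) a(1) by blast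
    have "\<Phi> (f \<circ> a \<circ> f \<circ> b) = \<Phi> (a \<circ> f \<circ> b \<circ> f)" using fc[OF a(1) b(1) 1 2] by simp
    then show ?thesis using a b f(1) by (simp add: hom iet_comp)
  qed
  moreover have "\<Phi> f \<circ> \<Phi> f = id" using f hom by (metis \<Phi>_id)
  moreover have "\<Phi> f \<circ> \<Phi> p = \<Phi> p \<circ> \<Phi> f" using f hom assms(1) by metis
  ultimately show ?thesis using f(1) by (simp add: locU_def)
qed

lemma locU_iff: assumes "iet p" "iet f" shows "\<Phi> f \<in> locU (\<Phi> p) \<longleftrightarrow> f \<in> locU p"
proof -
  interpret inv: iet_automorphism "inv_into (Collect iet) \<Phi>" by (rule inverse)
  have inv: "inv_into (Collect iet) \<Phi> (\<Phi> c) = c" if "iet c" for c using bij that by (simp add: bij_betw_def)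
  show ?thesis using locU_image inv.locU_image[of "\<Phi> p" "\<Phi> f"] assms inv by auto
qed

lemma locV_iff: assumes "iet p" "iet f" shows "\<Phi> f \<in> locV (\<Phi> p) \<longleftrightarrow> f \<in> locV p"
proof -
  have eq: "\<Phi> f \<circ> \<Phi> u = \<Phi> u \<circ> \<Phi> f \<longleftrightarrow> f \<circ> u = u \<circ> f" if "iet u" for u
    using hom[OF assms(2) that] hom[OF that assms(2)] \<Phi>_eq_iff iet_comp assms(2) that by metis
  have "(\<forall>u\<in>locU (\<Phi> p). \<Phi> f \<circ> u = u \<circ> \<Phi> f) \<longleftrightarrow> (\<forall>u\<in>locU p. f \<circ> u = u \<circ> f)"
  proof (intro iffI ballI)
    fix u assume a: "\<forall>u\<in>locU (\<Phi> p). \<Phi> f \<circ> u = u \<circ> \<Phi> f" "u \<in> locU p"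
    then have "iet u" by (simp add: locU_def)
    then show "f \<circ> u = u \<circ> f" using a locU_iff[OF assms(1)] eq by blast
  next
    fix u assume a: "\<forall>u\<in>locU p. f \<circ> u = u \<circ> f" "u \<in> locU (\<Phi> p)"
    then have "iet u" by (simp add: locU_def)
    then obtain w where w: "iet w" "\<Phi> w = u" using \<Phi>_surj by blast
    then show "\<Phi> f \<circ> u = u \<circ> \<Phi> f" using a locU_iff[OF assms(1)] eq by blast
  qed
  then show ?thesis using assms by (simp add: locV_def)
qed

lemma locW_iff: assumes "iet p" "iet f" shows "\<Phi> f \<in> locW (\<Phi> p) \<longleftrightarrow> f \<in> locW p"
proof -
  have eq: "\<Phi> f \<circ> \<Phi> v \<circ> \<Phi> v = \<Phi> v \<circ> \<Phi> v \<circ> \<Phi> f \<longleftrightarrow> f \<circ> v \<circ> v = v \<circ> v \<circ> f" if v: "iet v" for v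
  proof -
    have "\<Phi> f \<circ> \<Phi> v \<circ> \<Phi> v = \<Phi> (f \<circ> v \<circ> v)" "\<Phi> v \<circ> \<Phi> v \<circ> \<Phi> f = \<Phi> (v \<circ> v \<circ> f)"
      using v assms by (simp_all add: hom iet_comp)
    then show ?thesis using \<Phi>_eq_iff v assms(2) by (simp add: iet_comp)
  qed
  have "(\<forall>v\<in>locV (\<Phi> p). \<Phi> f \<circ> v \<circ> v = v \<circ> v \<circ> \<Phi> f) \<longleftrightarrow> (\<forall>v\<in>locV p. f \<circ> v \<circ> v = v \<circ> v \<circ> f)"
  proof (intro iffI ballI)
    fix v assume a: "\<forall>v\<in>locV (\<Phi> p). \<Phi> f \<circ> v \<circ> v = v \<circ> v \<circ> \<Phi> f" "v \<in> locV p"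
    then have "iet v" by (simp add: locV_def)
    then show "f \<circ> v \<circ> v = v \<circ> v \<circ> f" using a locV_iff[OF assms(1)] eq by blast
  next
    fix v assume a: "\<forall>v\<in>locV p. f \<circ> v \<circ> v = v \<circ> v \<circ> f" "v \<in> locV (\<Phi> p)"
    then have "iet v" by (simp add: locV_def)
    then obtain w where w: "iet w" "\<Phi> w = v" using \<Phi>_surj by blast
    then show "\<Phi> f \<circ> v \<circ> v = v \<circ> v \<circ> \<Phi> f" using a locV_iff[OF assms(1)] eq by blast
  qed
  then show ?thesis using assms by (simp add: locW_def)
qed

lemma \<Phi>_involution: "iet p \<Longrightarrow> (\<And>x. p (p x) = x) \<Longrightarrow> \<Phi> p (\<Phi> p x) = x"
  using hom[of p p] \<Phi>_id by (metis comp_apply eq_id_iff)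

lemma supp_subset_iff:
  assumes "iet p" "\<And>x. p (p x) = x" "iet f"
  shows "supp (\<Phi> f) \<subseteq> supp (\<Phi> p) \<longleftrightarrow> supp f \<subseteq> supp p"
  using locW_iff[OF assms(1,3)] locW_eq[OF assms(1,2)] assms(3)
    locW_eq[OF iet_\<Phi>[OF assms(1)] \<Phi>_involution[OF assms(1,2)]] by simp

text \<open>The involution with support \<open>b\<close> is chosen arbitrarily; by
  \<open>supp_subset_iff\<close> the support of its image does not depend on the choice.\<close>

definition \<theta> :: "real set \<Rightarrow> real set" where
  "\<theta> b = supp (\<Phi> (SOME p. iet p \<and> (\<forall>x. p (p x) = x) \<and> supp p = b))"

lemma \<theta>_supp: assumes p: "iet p" "\<And>x. p (p x) = x" shows "\<theta> (supp p) = supp (\<Phi> p)"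
proof -
  define q where "q = (SOME q. iet q \<and> (\<forall>x. q (q x) = x) \<and> supp q = supp p)"
  have "iet q \<and> (\<forall>x. q (q x) = x) \<and> supp q = supp p"
    unfolding q_def by (rule someI[of _ p]) (use p in auto)
  then have q: "iet q" "\<And>x. q (q x) = x" "supp q = supp p" by auto
  have "supp (\<Phi> q) = supp (\<Phi> p)"
    using supp_subset_iff[OF p q(1)] supp_subset_iff[OF q(1,2) p(1)] q(3) by blast
  then show ?thesis by (simp add: \<theta>_def q_def)
qed

lemma clopen_\<theta> [simp]: assumes "clopen b" shows "clopen (\<theta> b)"
proof -
  obtain p where p: "iet p" "\<And>x. p (p x) = x" "supp p = b" using exists_involution_supp[OF assms] by metis
  then show ?thesis using \<theta>_supp[OF p(1,2)] clopen_supp[of "\<Phi> p"] by simp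
qed

lemma \<theta>_subset_iff: assumes "clopen a" "clopen b" shows "\<theta> a \<subseteq> \<theta> b \<longleftrightarrow> a \<subseteq> b"
proof -
  obtain p where p: "iet p" "\<And>x. p (p x) = x" "supp p = a" using exists_involution_supp[OF assms(1)] by metis
  obtain q where q: "iet q" "\<And>x. q (q x) = x" "supp q = b" using exists_involution_supp[OF assms(2)] by metis
  show ?thesis using supp_subset_iff[OF q(1,2) p(1)] \<theta>_supp[OF p(1,2)] \<theta>_supp[OF q(1,2)] p(3) q(3) by simp
qed

lemma \<theta>_surj: assumes "clopen c" obtains b where "clopen b" "\<theta> b = c"
proof -
  obtain q where q: "iet q" "\<And>x. q (q x) = x" "supp q = c" using exists_involution_supp[OF assms] by metis
  obtain p where p: "iet p" "\<Phi> p = q" using \<Phi>_surj[OF q(1)] .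
  have "\<Phi> (p \<circ> p) = \<Phi> id" using hom[OF p(1) p(1)] p(2) q(2) by (auto simp: fun_eq_iff)
  then have "p \<circ> p = id" using \<Phi>_eq_iff iet_comp[OF p(1) p(1)] iet_id by blast
  then have "p (p x) = x" for x by (metis comp_apply id_apply)
  then show thesis using \<theta>_supp[OF p(1)] p q clopen_supp by (intro that[of "supp p"]) auto
qed

lemma \<theta>_eq_iff: "clopen a \<Longrightarrow> clopen b \<Longrightarrow> \<theta> a = \<theta> b \<longleftrightarrow> a = b"
  using \<theta>_subset_iff by blast

text \<open>An order isomorphism preserves infima: the clopen set mapped to the intersection of the
  images lies below both \<open>a\<close> and \<open>b\<close>.\<close>

lemma \<theta>_Int: assumes "clopen a" "clopen b" shows "\<theta> (a \<inter> b) = \<theta> a \<inter> \<theta> b"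
proof
  show "\<theta> (a \<inter> b) \<subseteq> \<theta> a \<inter> \<theta> b" using assms by (simp add: \<theta>_subset_iff clopen_Int)
  obtain c where c: "clopen c" "\<theta> c = \<theta> a \<inter> \<theta> b"
    using \<theta>_surj[OF clopen_Int[OF clopen_\<theta>[OF assms(1)] clopen_\<theta>[OF assms(2)]]] .
  have "\<theta> c \<subseteq> \<theta> a" "\<theta> c \<subseteq> \<theta> b" using c(2) by auto
  then have "c \<subseteq> a \<inter> b" using \<theta>_subset_iff c(1) assms by blast
  then show "\<theta> a \<inter> \<theta> b \<subseteq> \<theta> (a \<inter> b)"
    using \<theta>_subset_iff[OF c(1) clopen_Int[OF assms]] c(2) by blast
qed

lemma \<theta>_circ [simp]: "\<theta> circ = circ"
proof -
  obtain c where c: "clopen c" "\<theta> c = circ" using \<theta>_surj[OF clopen_circ] .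
  then have "circ \<subseteq> \<theta> circ" using \<theta>_subset_iff[OF c(1) clopen_circ] clopen_subset by blast
  then show ?thesis using clopen_subset[OF clopen_\<theta>[OF clopen_circ]] by blast
qed

lemma \<theta>_empty [simp]: "\<theta> {} = {}"
proof -
  obtain c where c: "clopen c" "\<theta> c = {}" using \<theta>_surj[OF clopen_empty] .
  then show ?thesis using \<theta>_subset_iff[OF clopen_empty c(1)] by blast
qed

lemma \<theta>_Un: assumes "clopen a" "clopen b" shows "\<theta> (a \<union> b) = \<theta> a \<union> \<theta> b"
proof
  show "\<theta> a \<union> \<theta> b \<subseteq> \<theta> (a \<union> b)" using assms by (simp add: \<theta>_subset_iff clopen_Un)
  obtain c where c: "clopen c" "\<theta> c = \<theta> a \<union> \<theta> b"
    using \<theta>_surj[OF clopen_Un[OF clopen_\<theta>[OF assms(1)] clopen_\<theta>[OF assms(2)]]] .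
  have "\<theta> a \<subseteq> \<theta> c" "\<theta> b \<subseteq> \<theta> c" using c(2) by auto
  then have "a \<union> b \<subseteq> c" using \<theta>_subset_iff c(1) assms by blast
  then show "\<theta> (a \<union> b) \<subseteq> \<theta> a \<union> \<theta> b"
    using \<theta>_subset_iff[OF clopen_Un[OF assms] c(1)] c(2) by blast
qed

lemma \<theta>_Compl: assumes "clopen b" shows "\<theta> (circ - b) = circ - \<theta> b"
proof -
  have "b \<inter> (circ - b) = {}" "b \<union> (circ - b) = circ" using clopen_subset[OF assms] by auto
  then have "\<theta> b \<inter> \<theta> (circ - b) = {}" "\<theta> b \<union> \<theta> (circ - b) = circ"
    using \<theta>_Int[OF assms clopen_Compl[OF assms]] \<theta>_Un[OF assms clopen_Compl[OF assms]] by auto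
  then show ?thesis by blast
qed

lemma \<theta>_disjoint: "clopen a \<Longrightarrow> clopen b \<Longrightarrow> a \<inter> b = {} \<Longrightarrow> \<theta> a \<inter> \<theta> b = {}"
  using \<theta>_Int[of a b] by simp

lemma \<Phi>_inv: assumes "iet g" shows "\<Phi> (inv_into UNIV g) = inv_into UNIV (\<Phi> g)"
proof -
  have "\<Phi> g \<circ> \<Phi> (inv_into UNIV g) = id"
    using hom[OF assms iet_inv[OF assms]] assms by (metis (mono_tags, lifting) \<Phi>_id comp_apply eq_id_iff iet_f_inv)
  then have "\<Phi> g (\<Phi> (inv_into UNIV g) x) = x" for x by (metis comp_apply id_apply)
  then show ?thesis using iet_f_inv[OF iet_\<Phi>[OF assms]] iet_inj[OF iet_\<Phi>[OF assms]] by (metis ext)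
qed

text \<open>Conjugating an involution by \<open>g\<close> moves its support by \<open>g\<close>, and
  \<open>\<Phi>\<close> maps conjugates to conjugates.\<close>

lemma \<theta>_image: assumes g: "iet g" and b: "clopen b" shows "\<theta> (g ` b) = \<Phi> g ` \<theta> b"
proof -
  obtain p where p: "iet p" "\<And>x. p (p x) = x" "supp p = b" using exists_involution_supp[OF b] by metis
  let ?q = "g \<circ> p \<circ> inv_into UNIV g"
  have q: "iet ?q" using g p by (simp add: iet_comp iet_inv)
  have "?q (?q x) = x" for x using p(2) g by simp
  then have "\<theta> (supp ?q) = supp (\<Phi> ?q)" by (rule \<theta>_supp[OF q])
  also have "\<Phi> ?q = \<Phi> g \<circ> \<Phi> p \<circ> inv_into UNIV (\<Phi> g)"
    using g p by (simp add: hom iet_comp iet_inv \<Phi>_inv)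
  also have "supp \<dots> = \<Phi> g ` \<theta> b" using supp_conj[OF iet_\<Phi>[OF g]] \<theta>_supp[OF p(1,2)] p(3) by simp
  finally show ?thesis unfolding supp_conj[OF g] p(3) .
qed

lemma \<theta>_vimage: assumes g: "iet g" and b: "clopen b" shows "\<theta> (g -` b) = \<Phi> g -` \<theta> b"
proof -
  have "g ` (g -` b) = b" using iet_bij[OF g] by (simp add: bij_is_surj surj_image_vimage_eq)
  then have "\<theta> b = \<Phi> g ` \<theta> (g -` b)" using \<theta>_image[OF g clopen_vimage[OF g b]] by simp
  then show ?thesis using iet_bij[OF iet_\<Phi>[OF g]] by (simp add: bij_is_inj inj_vimage_image_eq)
qed

end

lemma iet_automorphism_comp:
  assumes "iet_automorphism \<Phi>" "iet_automorphism \<Psi>" shows "iet_automorphism (\<Phi> \<circ> \<Psi>)"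
proof -
  interpret A: iet_automorphism \<Phi> by fact
  interpret B: iet_automorphism \<Psi> by fact
  show ?thesis
  proof
    show "bij_betw (\<Phi> \<circ> \<Psi>) (Collect iet) (Collect iet)" by (rule bij_betw_trans[OF B.bij A.bij])
  qed (simp add: A.hom B.hom)
qed

text \<open>Needed to compute the Boolean map after composing a reversing automorphism with the
  reflection.\<close>

lemma \<theta>_comp:
  assumes "iet_automorphism \<Phi>" "iet_automorphism \<Psi>" "clopen b"
  shows "iet_automorphism.\<theta> (\<Phi> \<circ> \<Psi>) b = iet_automorphism.\<theta> \<Phi> (iet_automorphism.\<theta> \<Psi> b)"
proof -
  interpret A: iet_automorphism \<Phi> by fact
  interpret B: iet_automorphism \<Psi> by fact
  interpret C: iet_automorphism "\<Phi> \<circ> \<Psi>" using assms(1,2) by (rule iet_automorphism_comp)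
  obtain p where p: "iet p" "\<And>x. p (p x) = x" "supp p = b" using exists_involution_supp[OF assms(3)] by metis
  show ?thesis
    using C.\<theta>_supp[OF p(1,2)] B.\<theta>_supp[OF p(1,2)] A.\<theta>_supp[OF B.iet_\<Phi>[OF p(1)] B.\<Phi>_involution[OF p(1,2)]] p(3)
    by simp
qed

section \<open>Baire category, additive functions and Lebesgue measure\<close>

text \<open>If no closure contained a subinterval, the complements of the closures would be open and
  dense in the interval with empty intersection. The conclusion keeps the closure because the sets
  it serves are not known to be closed.\<close>

lemma closure_cover_interval:
  fixes A :: "nat \<Rightarrow> real set"
  assumes "p < q" "{p..q} \<subseteq> (\<Union>n. A n)"
  obtains n p' q' where "p \<le> p'" "p' < q'" "q' \<le> q" "{p'..q'} \<subseteq> closure (A n)"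
proof (rule ccontr)
  assume "\<not> thesis"
  then have no: "p \<le> p' \<Longrightarrow> p' < q' \<Longrightarrow> q' \<le> q \<Longrightarrow> \<not> {p'..q'} \<subseteq> closure (A n)" for n p' q'
    using that by blast
  let ?S = "{p..q}"
  let ?G = "range (\<lambda>n. ?S - closure (A n))"
  have "?S \<subseteq> closure (\<Inter>?G)"
  proof (rule Baire)
    fix T assume "T \<in> ?G"
    then obtain n where T: "T = ?S - closure (A n)" by blast
    have op: "openin (top_of_set ?S) T"
      unfolding T Diff_eq by (rule openin_open_Int) auto
    have "?S \<subseteq> closure T"
    proof
      fix x assume x: "x \<in> ?S"
      show "x \<in> closure T"
      proof (rule ccontr)
        assume "x \<notin> closure T"
        then obtain e where e: "e > 0" "\<And>y. y \<in> T \<Longrightarrow> dist y x \<ge> e"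
          unfolding closure_approachable by (meson not_le)
        define p' q' where "p' = max p (x - e / 2)" and "q' = min q (x + e / 2)"
        have pq: "p \<le> p'" "p' < q'" "q' \<le> q" using x e(1) assms(1) by (auto simp: p'_def q'_def)
        have "{p'..q'} \<subseteq> closure (A n)"
        proof
          fix y assume y: "y \<in> {p'..q'}"
          then have "dist y x < e" "y \<in> ?S" using e(1) by (auto simp: p'_def q'_def dist_real_def)
          then show "y \<in> closure (A n)" using e(2)[of y] T by force
        qed
        then show False using no[OF pq] by blast
      qed
    qed
    with op show "openin (top_of_set ?S) T \<and> ?S \<subseteq> closure T" by blast
  qed auto
  moreover have "\<Inter>?G = {}" using assms(2) closure_subset by blast
  ultimately have "{p..q} = {}" by (metis closure_empty subset_empty)
  then show False using assms(1) by simp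
qed

text \<open>Subtracting the linear function through one interior point \<open>a\<close> leaves an
  additive function that vanishes at the rational multiples of \<open>a\<close> inside the interval;
  right-continuity then annihilates it everywhere.\<close>

lemma additive_right_continuous_linear:
  fixes L :: "real \<Rightarrow> real"
  assumes eta: "\<eta> > 0"
    and add: "\<And>s t. 0 \<le> s \<Longrightarrow> 0 \<le> t \<Longrightarrow> s + t < \<eta> \<Longrightarrow> L (s + t) = L s + L t"
    and rc: "\<And>s \<delta>. 0 \<le> s \<Longrightarrow> s < \<eta> \<Longrightarrow> \<delta> > 0 \<Longrightarrow> \<exists>e>s. \<forall>t. s \<le> t \<longrightarrow> t < e \<longrightarrow> \<bar>L t - L s\<bar> \<le> \<delta>"
  obtains k where "\<And>s. 0 \<le> s \<Longrightarrow> s < \<eta> \<Longrightarrow> L s = k * s"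
proof -
  define a where "a = \<eta> / 2"
  have a: "0 < a" "a < \<eta>" using eta by (auto simp: a_def)
  define k where "k = L a / a"
  define M where "M s = L s - k * s" for s
  have Madd: "M (s + t) = M s + M t" if "0 \<le> s" "0 \<le> t" "s + t < \<eta>" for s t
    using add[OF that] by (simp add: M_def algebra_simps)
  have M0: "M 0 = 0" using Madd[of 0 0] eta by simp
  have Mmult: "M (real m * s) = real m * M s" if "0 \<le> s" "real m * s < \<eta>" for m s
    using that(2)
  proof (induction m)
    case (Suc m)
    have "real m * s < \<eta>" using Suc.prems that(1) by (simp add: algebra_simps)
    then show ?case using Suc Madd[of "real m * s" s] that(1) by (simp add: algebra_simps)
  qed (simp add: M0)
  have Ma: "M a = 0" using a by (simp add: M_def k_def)
  have Mfrac: "M (real m / real n * a) = 0" if "n \<noteq> 0" "real m / real n * a < \<eta>" for m n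
  proof -
    have "M (real n * (a / real n)) = real n * M (a / real n)" using a that(1) by (intro Mmult) auto
    then have "M (a / real n) = 0" using that(1) Ma by simp
    then show ?thesis using Mmult[of "a / real n" m] a that by simp
  qed
  have "M s = 0" if s: "0 \<le> s" "s < \<eta>" for s
  proof -
    have "\<bar>M s\<bar> \<le> \<epsilon>" if eps: "\<epsilon> > 0" for \<epsilon>
    proof -
      obtain e where e: "e > s" "\<And>t. s \<le> t \<Longrightarrow> t < e \<Longrightarrow> \<bar>L t - L s\<bar> \<le> \<epsilon> / 2"
        using rc[OF s, of "\<epsilon> / 2"] eps by auto
      \<comment> \<open>This bounds the linear term by half of \<open>\<epsilon>\<close>; adding 1
        to the absolute value of \<open>k\<close> avoids dividing by zero.\<close>
      define d where "d = \<epsilon> / (2 * (\<bar>k\<bar> + 1))"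
      have d: "d > 0" using eps by (auto simp: d_def)
      define u where "u = min e (min \<eta> (s + d))"
      have "s < u" using e(1) s d by (simp add: u_def)
      \<comment> \<open>A rational multiple of \<open>a\<close> slightly to the right of
        \<open>s\<close>, the side on which \<open>L\<close> is controlled.\<close>
      then obtain r where r: "r \<in> \<rat>" "s / a < r" "r < u / a"
        using Rats_dense_in_real[of "s / a" "u / a"] a by (auto simp: divide_strict_right_mono)
      have r0: "r > 0" using r(2) s a by (meson divide_nonneg_pos le_less_trans)
      obtain m n :: nat where mn: "n \<noteq> 0" "\<bar>r\<bar> = real m / real n"
        using Rats_abs_nat_div_natE[OF r(1)] by metis
      have ra: "s < r * a" "r * a < u" using r a by (auto simp: field_simps)
      have "M (r * a) = 0" using Mfrac[OF mn(1), of m] mn(2) r0 ra by (simp add: u_def)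
      then have "M s = (L s - L (r * a)) + k * (r * a - s)" by (simp add: M_def algebra_simps)
      moreover have "\<bar>L s - L (r * a)\<bar> \<le> \<epsilon> / 2" using e(2)[of "r * a"] ra by (simp add: u_def abs_minus_commute)
      moreover have "\<bar>k * (r * a - s)\<bar> \<le> \<epsilon> / 2"
      proof -
        have "\<bar>k * (r * a - s)\<bar> = \<bar>k\<bar> * (r * a - s)" using ra by (simp add: abs_mult)
        also have "\<dots> \<le> (\<bar>k\<bar> + 1) * d" using ra by (intro mult_mono) (auto simp: u_def)
        also have "\<dots> = \<epsilon> / 2"
        proof -
          have "\<bar>k\<bar> + 1 \<noteq> 0" by linarith
          then show ?thesis by (simp add: d_def divide_simps)
        qed
        finally show ?thesis .
      qed
      ultimately show ?thesis by linarith
    qed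
    then show ?thesis by (metis abs_le_zero_iff dense_ge)
  qed
  then show thesis by (intro that[of k]) (simp add: M_def)
qed

lemma clopen_lmeasurable: assumes "clopen b" shows "b \<in> lmeasurable"
proof -
  have "b \<inter> {0..<1} \<in> sets lebesgue"
  proof (induction rule: germ_interval_induct[where Q="\<lambda>s t. b \<inter> {s..<t} \<in> sets lebesgue"])
    case (trans r s t)
    have "b \<inter> {r..<t} = (b \<inter> {r..<s}) \<union> (b \<inter> {s..<t})" using trans by auto
    then show ?case using sets.Un[OF trans(5,6)] by simp
  next
    case (local F)
    from clopen_decide[OF assms local] show ?case
    proof
      assume ev: "\<forall>\<^sub>F y in F. y \<in> b"
      have "b \<inter> {s..<t} \<in> sets lebesgue" if "\<forall>y\<in>{s..<t}. y \<in> b" for s t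
      proof -
        have "b \<inter> {s..<t} = {s..<t}" using that by auto
        then show ?thesis by simp
      qed
      then show ?case using ev by blast
    next
      assume ev: "\<forall>\<^sub>F y in F. y \<notin> b"
      have "b \<inter> {s..<t} \<in> sets lebesgue" if "\<forall>y\<in>{s..<t}. y \<notin> b" for s t
      proof -
        have "b \<inter> {s..<t} = {}" using that by auto
        then show ?thesis by simp
      qed
      then show ?case using ev by blast
    qed
  qed simp
  moreover have "b \<subseteq> {0..1}" "b \<inter> {0..<1} = b"
    using clopen_subset[OF assms] by (auto simp: circ_def)
  moreover from this(1) have "bounded b" using bounded_closed_interval bounded_subset by blast
  ultimately show ?thesis by (simp add: bounded_set_imp_lmeasurable)
qed

lemma measure_clopen_Un:
  assumes "clopen a" "clopen b" "a \<inter> b = {}"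
  shows "measure lebesgue (a \<union> b) = measure lebesgue a + measure lebesgue b"
  using clopen_lmeasurable[OF assms(1)] clopen_lmeasurable[OF assms(2)] assms(3)
  by (intro measure_Union) (auto simp: fmeasurable_def)

lemma measure_iet_image:
  assumes f: "iet f" and b: "clopen b"
  shows "measure lebesgue (f ` b) = measure lebesgue b"
proof -
  define Q where "Q s t \<longleftrightarrow> (0 \<le> s \<longrightarrow> t \<le> 1 \<longrightarrow>
    measure lebesgue (f ` (b \<inter> {s..<t})) = measure lebesgue (b \<inter> {s..<t}))" for s t
  have "Q 0 1"
  proof (induction rule: germ_interval_induct[where Q=Q])
    case (refl x)
    show ?case by (simp add: Q_def)
  next
    case (trans r s t)
    let ?a = "b \<inter> {r..<s}" and ?c = "b \<inter> {s..<t}"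
    have cl: "clopen ?a" "clopen ?c" using trans b by (auto intro!: clopen_Int clopen_interval)
    have eq: "b \<inter> {r..<t} = ?a \<union> ?c" using trans by auto
    have disj: "?a \<inter> ?c = {}" by auto
    have "f ` ?a \<inter> f ` ?c = f ` (?a \<inter> ?c)" using iet_bij[OF f] by (simp add: bij_is_inj image_Int)
    then have disj': "f ` ?a \<inter> f ` ?c = {}" using disj by simp
    have "measure lebesgue (f ` ?a \<union> f ` ?c) = measure lebesgue (f ` ?a) + measure lebesgue (f ` ?c)"
      using cl f disj' by (intro measure_clopen_Un clopen_image)
    also have "\<dots> = measure lebesgue (?a \<union> ?c)"
      using trans measure_clopen_Un[OF cl disj] by (simp add: Q_def)
    finally show ?case by (simp add: Q_def eq image_Un)
  next
    case (local F)
    obtain c where c: "\<forall>\<^sub>F y in F. f y = y + c" using iet_translation[OF f local] .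
    have "Q s t" if "\<forall>y\<in>{s..<t}. f y = y + c" for s t
    proof -
      have "f ` (b \<inter> {s..<t}) = (+) c ` (b \<inter> {s..<t})" using that by (auto simp: add.commute)
      then show ?thesis by (simp add: Q_def measure_translation)
    qed
    then show ?case using c by blast
  qed
  moreover have "b \<inter> {0..<1} = b" using clopen_subset[OF b] by (auto simp: circ_def)
  ultimately show ?thesis by (simp add: Q_def)
qed

text \<open>The base point is the infimum \<open>y\<close> of all \<open>t\<close> with [0, t) in
  \<open>U\<close>. If it is attained, every [r, y) with r < y belongs to \<open>U\<close>, which is
  the left germ at \<open>y\<close>; otherwise every [y, t) with t > y does, which is the right
  germ.\<close>

lemma ultrafilter_is_germ:
  assumes compl: "\<And>b. clopen b \<Longrightarrow> U (circ - b) \<longleftrightarrow> \<not> U b"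
    and inter: "\<And>a b. clopen a \<Longrightarrow> clopen b \<Longrightarrow> U a \<Longrightarrow> U b \<Longrightarrow> U (a \<inter> b)"
    and mono: "\<And>a b. clopen a \<Longrightarrow> clopen b \<Longrightarrow> a \<subseteq> b \<Longrightarrow> U a \<Longrightarrow> U b"
    and circ: "U circ"
  obtains F where "F \<in> germs" "\<And>b. clopen b \<Longrightarrow> U b \<longleftrightarrow> (\<forall>\<^sub>F y in F. y \<in> b)"
proof -
  note result = that
  \<comment> \<open>Between ultrafilters one inclusion gives equality, by passing to
    complements.\<close>
  have suffices: thesis if F: "F \<in> germs" and imp: "\<And>b. clopen b \<Longrightarrow> \<forall>\<^sub>F y in F. y \<in> b \<Longrightarrow> U b" for F
  proof (rule result[OF F])
    fix b assume b: "clopen b"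
    show "U b \<longleftrightarrow> (\<forall>\<^sub>F y in F. y \<in> b)"
    proof
      assume "U b"
      show "\<forall>\<^sub>F y in F. y \<in> b"
      proof (rule ccontr)
        assume "\<not> ?thesis"
        then have "\<forall>\<^sub>F y in F. y \<notin> b" using clopen_decide[OF b F] by blast
        with germ_circ[OF F] have "\<forall>\<^sub>F y in F. y \<in> circ - b" by eventually_elim simp
        then have "U (circ - b)" using imp clopen_Compl[OF b] by blast
        then show False using compl[OF b] \<open>U b\<close> by blast
      qed
    qed (use imp b in blast)
  qed
  define S where "S = {t. 0 \<le> t \<and> t \<le> 1 \<and> U {0..<t}}"
  have S1: "1 \<in> S" using circ by (simp add: S_def circ_def)
  have S0: "0 \<notin> S" using compl[of circ] circ by (simp add: S_def)
  define y where "y = Inf S"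
  have bdd: "bdd_below S" by (rule bdd_belowI[of _ 0]) (simp add: S_def)
  have Sge: "0 \<le> t" if "t \<in> S" for t using that by (simp add: S_def)
  have y01: "0 \<le> y" "y \<le> 1"
    using cInf_greatest[of S 0] Sge S1 cInf_lower[OF S1 bdd] unfolding y_def by blast+
  have above: "t \<in> S" if "y < t" "t \<le> 1" for t
  proof -
    obtain r where r: "r \<in> S" "r < t"
      using \<open>y < t\<close> cInf_less_iff[OF _ bdd] S1 unfolding y_def by blast
    have "U {0..<t}" by (rule mono[of "{0..<r}"]) (use r that in \<open>auto simp: S_def intro!: clopen_interval\<close>)
    then show ?thesis using that y01 by (simp add: S_def)
  qed
  have below: "t \<notin> S" if "t < y" for t
    using that cInf_lower[OF _ bdd, of t] by (auto simp: y_def)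
  have between: "U {r..<t}" if "r \<notin> S" "t \<in> S" "0 \<le> r" "r \<le> 1" for r t
  proof -
    have "U (circ - {0..<r})" using compl[of "{0..<r}"] that by (simp add: S_def clopen_interval)
    then have "U ({0..<t} \<inter> (circ - {0..<r}))"
      using that by (intro inter clopen_Compl clopen_interval) (auto simp: S_def)
    moreover have "{0..<t} \<inter> (circ - {0..<r}) = {r..<t}" using that by (auto simp: circ_def S_def)
    ultimately show ?thesis by simp
  qed
  show thesis
  proof (cases "y \<in> S")
    case True
    then have y0: "y > 0" using S0 y01 by (metis less_eq_real_def)
    show thesis
    proof (rule suffices[of "at_left y"])
      fix b assume b: "clopen b" "\<forall>\<^sub>F z in at_left y. z \<in> b"
      then obtain e where e: "e < y" "\<And>z. e < z \<Longrightarrow> z < y \<Longrightarrow> z \<in> b"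
        unfolding eventually_at_left_field by blast
      define r where "r = max 0 ((e + y) / 2)"
      have r: "0 \<le> r" "r < y" "e < r" using e(1) y0 by (auto simp: r_def less_max_iff_disj)
      have "U {r..<y}" using between[OF below[OF r(2)] True] r y01 by simp
      moreover have "{r..<y} \<subseteq> b" using e(2) r by auto
      ultimately show "U b" using mono[OF _ b(1)] clopen_interval r y01 by blast
    qed (use y0 y01 in auto)
  next
    case False
    then have y1: "y < 1" using S1 y01 by (metis less_eq_real_def)
    show thesis
    proof (rule suffices[of "rgerm y"])
      fix b assume b: "clopen b" "\<forall>\<^sub>F z in rgerm y. z \<in> b"
      then obtain e where e: "e > y" "\<And>z. y \<le> z \<Longrightarrow> z < e \<Longrightarrow> z \<in> b"
        unfolding eventually_rgerm by blast
      have "U {y..<min e 1}" using between[OF False above] e(1) y1 y01 by simp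
      moreover have "{y..<min e 1} \<subseteq> b" using e(2) by auto
      ultimately show "U b" using mono[OF _ b(1)] clopen_interval[of y "min e 1"] y01 by auto
    qed (use y1 y01 in auto)
  qed
qed

section \<open>The induced map on germs is affine near 0\<close>

lemma germ_tendsto:
  assumes "F \<in> germs" obtains y where "0 \<le> y" "y \<le> 1" "((\<lambda>z. z) \<longlongrightarrow> y) F"
  using assms
proof (cases rule: germ_cases)
  case (right x)
  have "F \<le> nhds x" unfolding right rgerm_def by simp
  then show thesis using right by (intro that[of x]) (auto simp: filterlim_def filtermap_ident)
next
  case (left x)
  then show thesis by (intro that[of x]) (auto intro: tendsto_ident_at)
qed

lemma clopen_circ_Int_interval: "clopen (circ \<inter> {s..<t})"
proof -
  have "circ \<inter> {s..<t} = {max 0 s..<min 1 t}" by (auto simp: circ_def)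
  then show ?thesis by (simp add: clopen_interval)
qed

context iet_automorphism
begin

lemma exists_germ_image:
  assumes F: "F \<in> germs"
  obtains G where "G \<in> germs" "\<And>b. clopen b \<Longrightarrow> (\<forall>\<^sub>F y in G. y \<in> \<theta> b) \<longleftrightarrow> (\<forall>\<^sub>F y in F. y \<in> b)"
proof -
  define U where "U c \<longleftrightarrow> (\<exists>a. clopen a \<and> \<theta> a = c \<and> (\<forall>\<^sub>F y in F. y \<in> a))" for c
  have U: "U (\<theta> a) \<longleftrightarrow> (\<forall>\<^sub>F y in F. y \<in> a)" if "clopen a" for a
    using that \<theta>_eq_iff by (auto simp: U_def)
  obtain G where G: "G \<in> germs" "\<And>b. clopen b \<Longrightarrow> U b \<longleftrightarrow> (\<forall>\<^sub>F y in G. y \<in> b)"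
  proof (rule ultrafilter_is_germ[of U])
    fix b assume b: "clopen b"
    obtain a where a: "clopen a" "\<theta> a = b" using \<theta>_surj[OF b] .
    have "(\<forall>\<^sub>F y in F. y \<in> circ - a) \<longleftrightarrow> \<not> (\<forall>\<^sub>F y in F. y \<in> a)"
    proof
      assume ev: "\<forall>\<^sub>F y in F. y \<in> circ - a"
      then have "\<forall>\<^sub>F y in F. y \<notin> a" by eventually_elim simp
      then show "\<not> (\<forall>\<^sub>F y in F. y \<in> a)" using germ_not_both[OF F] by blast
    next
      assume "\<not> (\<forall>\<^sub>F y in F. y \<in> a)"
      then have "\<forall>\<^sub>F y in F. y \<notin> a" using clopen_decide[OF a(1) F] by blast
      with germ_circ[OF F] show "\<forall>\<^sub>F y in F. y \<in> circ - a" by eventually_elim simp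
    qed
    then show "U (circ - b) \<longleftrightarrow> \<not> U b"
      using U[OF a(1)] U[OF clopen_Compl[OF a(1)]] \<theta>_Compl[OF a(1)] a(2) by simp
  next
    fix a b assume ab: "clopen a" "clopen b" "U a" "U b"
    obtain a' where a': "clopen a'" "\<theta> a' = a" using \<theta>_surj[OF ab(1)] .
    obtain b' where b': "clopen b'" "\<theta> b' = b" using \<theta>_surj[OF ab(2)] .
    have "\<forall>\<^sub>F y in F. y \<in> a'" "\<forall>\<^sub>F y in F. y \<in> b'" using ab U a' b' by auto
    then have "\<forall>\<^sub>F y in F. y \<in> a' \<inter> b'" by eventually_elim simp
    then show "U (a \<inter> b)" using U[OF clopen_Int[OF a'(1) b'(1)]] \<theta>_Int a' b' by simp
  next
    fix a b assume ab: "clopen a" "clopen b" "a \<subseteq> b" "U a"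
    obtain a' where a': "clopen a'" "\<theta> a' = a" using \<theta>_surj[OF ab(1)] .
    obtain b' where b': "clopen b'" "\<theta> b' = b" using \<theta>_surj[OF ab(2)] .
    have "\<forall>\<^sub>F y in F. y \<in> a'" using ab U a' by auto
    moreover have "a' \<subseteq> b'" using \<theta>_subset_iff[OF a'(1) b'(1)] a' b' ab by simp
    ultimately have "\<forall>\<^sub>F y in F. y \<in> b'" by (auto elim: eventually_mono)
    then show "U b" using U b' by auto
  next
    show "U circ" using U[OF clopen_circ] germ_circ[OF F] by simp
  qed blast
  then show thesis using U by (intro that[of G]) auto
qed

definition germ_image :: "real filter \<Rightarrow> real filter" where
  "germ_image F = (SOME G. G \<in> germs \<and> (\<forall>b. clopen b \<longrightarrow> (\<forall>\<^sub>F y in G. y \<in> \<theta> b) = (\<forall>\<^sub>F y in F. y \<in> b)))"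

lemma germ_image:
  assumes "F \<in> germs"
  shows germ_image_germ: "germ_image F \<in> germs"
    and germ_image_iff: "clopen b \<Longrightarrow> (\<forall>\<^sub>F y in germ_image F. y \<in> \<theta> b) \<longleftrightarrow> (\<forall>\<^sub>F y in F. y \<in> b)"
proof -
  have "\<exists>G. G \<in> germs \<and> (\<forall>b. clopen b \<longrightarrow> (\<forall>\<^sub>F y in G. y \<in> \<theta> b) = (\<forall>\<^sub>F y in F. y \<in> b))"
    using exists_germ_image[OF assms] by metis
  then have "germ_image F \<in> germs \<and>
      (\<forall>b. clopen b \<longrightarrow> (\<forall>\<^sub>F y in germ_image F. y \<in> \<theta> b) = (\<forall>\<^sub>F y in F. y \<in> b))"
    unfolding germ_image_def by (rule someI_ex)
  then show "germ_image F \<in> germs"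
    "clopen b \<Longrightarrow> (\<forall>\<^sub>F y in germ_image F. y \<in> \<theta> b) \<longleftrightarrow> (\<forall>\<^sub>F y in F. y \<in> b)" by auto
qed

text \<open>The dual of the equivariance of \<open>\<theta>\<close>: it lets the translation
  constant of \<open>\<Phi> g\<close> at the image germ govern how the image germ moves.\<close>

lemma germ_image_iet:
  assumes g: "iet g" and F: "F \<in> germs"
  shows "germ_image (filtermap g F) = filtermap (\<Phi> g) (germ_image F)"
proof (rule germ_eqI)
  have gF: "filtermap g F \<in> germs" by (rule iet_germ[OF g F])
  show "germ_image (filtermap g F) \<in> germs" by (rule germ_image_germ[OF gF])
  show "filtermap (\<Phi> g) (germ_image F) \<in> germs" using iet_germ[OF iet_\<Phi>[OF g] germ_image_germ[OF F]] .
  fix b assume b: "clopen b" "\<forall>\<^sub>F y in germ_image (filtermap g F). y \<in> b"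
  obtain a where a: "clopen a" "\<theta> a = b" using \<theta>_surj[OF b(1)] .
  have "\<forall>\<^sub>F y in filtermap g F. y \<in> a" using germ_image_iff[OF gF a(1)] b(2) a(2) by simp
  then have "\<forall>\<^sub>F y in F. y \<in> g -` a" by (simp add: eventually_filtermap)
  then have "\<forall>\<^sub>F y in germ_image F. y \<in> \<theta> (g -` a)" using germ_image_iff[OF F clopen_vimage[OF g a(1)]] by simp
  then show "\<forall>\<^sub>F y in filtermap (\<Phi> g) (germ_image F). y \<in> b"
    using \<theta>_vimage[OF g a(1)] a(2) by (simp add: eventually_filtermap)
qed

text \<open>The image germ may be a right or a left one; only its base point is recorded. The value
  1 can occur, as the base point of a left germ.\<close>

definition \<phi> :: "real \<Rightarrow> real" where
  "\<phi> x = (SOME y. 0 \<le> y \<and> y \<le> 1 \<and> ((\<lambda>z. z) \<longlongrightarrow> y) (germ_image (rgerm x)))"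

lemma rgerm_circ: "x \<in> circ \<Longrightarrow> rgerm x \<in> germs"
  by (simp add: circ_def)

lemma \<phi>:
  assumes "x \<in> circ"
  shows \<phi>_ge0: "0 \<le> \<phi> x" and \<phi>_le1: "\<phi> x \<le> 1" and \<phi>_tendsto: "((\<lambda>z. z) \<longlongrightarrow> \<phi> x) (germ_image (rgerm x))"
proof -
  have "\<exists>y. 0 \<le> y \<and> y \<le> 1 \<and> ((\<lambda>z. z) \<longlongrightarrow> y) (germ_image (rgerm x))"
    using germ_tendsto[OF germ_image_germ[OF rgerm_circ[OF assms]]] by metis
  then have "0 \<le> \<phi> x \<and> \<phi> x \<le> 1 \<and> ((\<lambda>z. z) \<longlongrightarrow> \<phi> x) (germ_image (rgerm x))"
    unfolding \<phi>_def by (rule someI_ex)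
  then show "0 \<le> \<phi> x" "\<phi> x \<le> 1" "((\<lambda>z. z) \<longlongrightarrow> \<phi> x) (germ_image (rgerm x))" by auto
qed

lemma germ_image_mem:
  assumes "clopen b" "x \<in> b" shows "\<forall>\<^sub>F y in germ_image (rgerm x). y \<in> \<theta> b"
proof -
  have "x \<in> circ" using assms clopen_subset by blast
  then show ?thesis using germ_image_iff[OF rgerm_circ assms(1)] rgerm_clopen[OF assms] by blast
qed

lemma \<phi>_in_closed_interval:
  assumes b: "clopen b" "x \<in> b" and sub: "\<theta> b \<subseteq> {s..t}"
  shows "s \<le> \<phi> x" "\<phi> x \<le> t"
proof -
  have x: "x \<in> circ" using b clopen_subset by blast
  have ne: "germ_image (rgerm x) \<noteq> bot" using germ_image_germ[OF rgerm_circ[OF x]] by simp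
  have ev: "\<forall>\<^sub>F y in germ_image (rgerm x). s \<le> y \<and> y \<le> t"
    using germ_image_mem[OF b] sub by (auto elim!: eventually_mono)
  have "\<forall>\<^sub>F y in germ_image (rgerm x). s \<le> y" using ev by eventually_elim simp
  then show "s \<le> \<phi> x" using tendsto_lowerbound[OF \<phi>_tendsto[OF x]] ne by blast
  have "\<forall>\<^sub>F y in germ_image (rgerm x). y \<le> t" using ev by eventually_elim simp
  then show "\<phi> x \<le> t" using tendsto_upperbound[OF \<phi>_tendsto[OF x]] ne by blast
qed

text \<open>The clopen set that \<open>\<theta>\<close> maps to a neighbourhood of
  \<open>\<phi> x\<close> belongs to the right germ at \<open>x\<close>, hence contains some [x, e).
  The bound is not strict because \<open>\<phi> y\<close> is a limit of points of that
  neighbourhood.\<close>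

lemma \<phi>_right_continuous:
  assumes x: "x \<in> circ" and d: "\<delta> > 0"
  obtains e where "e > x" "\<And>y. x \<le> y \<Longrightarrow> y < e \<Longrightarrow> \<bar>\<phi> y - \<phi> x\<bar> \<le> \<delta>"
proof -
  let ?b = "circ \<inter> {\<phi> x - \<delta>..<\<phi> x + \<delta>}"
  have G: "germ_image (rgerm x) \<in> germs" by (rule germ_image_germ[OF rgerm_circ[OF x]])
  obtain a where a: "clopen a" "\<theta> a = ?b" using \<theta>_surj[OF clopen_circ_Int_interval] .
  have "\<forall>\<^sub>F y in germ_image (rgerm x). \<phi> x - \<delta> < y" "\<forall>\<^sub>F y in germ_image (rgerm x). y < \<phi> x + \<delta>"
    using order_tendstoD[OF \<phi>_tendsto[OF x]] d by auto
  with germ_circ[OF G] have "\<forall>\<^sub>F y in germ_image (rgerm x). y \<in> ?b"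
    by eventually_elim auto
  then have "\<forall>\<^sub>F y in rgerm x. y \<in> a" using germ_image_iff[OF rgerm_circ[OF x] a(1)] a(2) by simp
  then obtain e where e: "e > x" "\<And>y. x \<le> y \<Longrightarrow> y < e \<Longrightarrow> y \<in> a" unfolding eventually_rgerm by blast
  have sub: "\<theta> a \<subseteq> {\<phi> x - \<delta>..\<phi> x + \<delta>}" using a(2) by auto
  have "\<bar>\<phi> y - \<phi> x\<bar> \<le> \<delta>" if "x \<le> y" "y < e" for y
    using \<phi>_in_closed_interval[OF a(1) e(2)[OF that] sub] by linarith
  then show thesis using that[OF e(1)] by blast
qed

lemma \<phi>_shift:
  assumes g: "iet g" and x: "x \<in> circ" and ev: "\<forall>\<^sub>F z in germ_image (rgerm x). \<Phi> g z = z + c"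
  shows "\<phi> (g x) = \<phi> x + c"
proof -
  have gx: "g x \<in> circ" using iet_circ[OF g] x by blast
  have G: "germ_image (rgerm x) \<in> germs" by (rule germ_image_germ[OF rgerm_circ[OF x]])
  have "germ_image (rgerm (g x)) = filtermap (\<Phi> g) (germ_image (rgerm x))"
    using germ_image_iet[OF g rgerm_circ[OF x]] iet_rgerm[OF g x] by simp
  then have 1: "((\<lambda>z. \<Phi> g z) \<longlongrightarrow> \<phi> (g x)) (germ_image (rgerm x))"
    using \<phi>_tendsto[OF gx] by (simp add: filterlim_filtermap)
  have "((\<lambda>z. z + c) \<longlongrightarrow> \<phi> x + c) (germ_image (rgerm x))"
    using \<phi>_tendsto[OF x] by (intro tendsto_intros)
  then have "((\<lambda>z. \<Phi> g z) \<longlongrightarrow> \<phi> x + c) (germ_image (rgerm x))"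
    using tendsto_cong[OF ev] by blast
  then show ?thesis using tendsto_unique[OF germ_neq_bot[OF G] 1] by blast
qed

text \<open>The increment over \<open>\<alpha>\<close> is the translation constant of
  \<open>\<Phi> r\<close> at the image germ of 0, and remains so while image germs stay in one
  clopen piece of \<open>\<Phi> r\<close>. The bounds 1/4 and 1/2 keep \<open>x + \<alpha>\<close>
  from wrapping around.\<close>

lemma \<phi>_increment_locally_constant:
  assumes al: "0 \<le> \<alpha>" "\<alpha> \<le> 1/4"
  obtains e where "e > 0" "\<And>x. 0 \<le> x \<Longrightarrow> x < e \<Longrightarrow> x < 1/2 \<Longrightarrow> \<phi> (x + \<alpha>) - \<phi> x = \<phi> \<alpha> - \<phi> 0"
proof -
  obtain r where r: "iet r" "\<And>y. y \<in> circ \<Longrightarrow> y + \<alpha> \<in> circ \<Longrightarrow> r y = y + \<alpha>"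
    using exists_iet_shift[of \<alpha>] al by auto
  have 0: "0 \<in> circ" by (simp add: circ_def)
  have G: "germ_image (rgerm 0) \<in> germs" by (rule germ_image_germ[OF rgerm_circ[OF 0]])
  obtain c where c: "\<forall>\<^sub>F z in germ_image (rgerm 0). \<Phi> r z = z + c"
    using iet_translation[OF iet_\<Phi>[OF r(1)] G] .
  obtain b where b: "clopen b" "\<forall>\<^sub>F z in germ_image (rgerm 0). z \<in> b" "\<And>z. z \<in> b \<Longrightarrow> \<Phi> r z = z + c"
    by (rule germ_clopen_base[OF G c]) (rule that)
  obtain a where a: "clopen a" "\<theta> a = b" using \<theta>_surj[OF b(1)] .
  have "\<forall>\<^sub>F z in rgerm 0. z \<in> a" using germ_image_iff[OF rgerm_circ[OF 0] a(1)] a(2) b(2) by simp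
  then obtain e where e: "e > 0" "\<And>x. 0 \<le> x \<Longrightarrow> x < e \<Longrightarrow> x \<in> a" unfolding eventually_rgerm by blast
  have key: "\<phi> (x + \<alpha>) = \<phi> x + c" if x: "0 \<le> x" "x < e" "x < 1/2" for x
  proof -
    have xc: "x \<in> circ" "x + \<alpha> \<in> circ" using x al by (auto simp: circ_def)
    have "\<forall>\<^sub>F z in germ_image (rgerm x). z \<in> b" using germ_image_mem[OF a(1) e(2)[OF x(1,2)]] a(2) by simp
    then have "\<forall>\<^sub>F z in germ_image (rgerm x). \<Phi> r z = z + c" by eventually_elim (use b(3) in blast)
    then show ?thesis using \<phi>_shift[OF r(1) xc(1)] r(2)[OF xc] by simp
  qed
  show thesis
    by (rule that[OF e(1)]) (use key key[of 0] e(1) in auto)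
qed

lemma \<phi>_affine:
  obtains k \<eta> where "0 < \<eta>" "\<eta> \<le> 1/2" "\<And>s. 0 \<le> s \<Longrightarrow> s < \<eta> \<Longrightarrow> \<phi> s = \<phi> 0 + k * s"
proof -
  \<comment> \<open>Angles whose increment is constant on a window of length 1 / (n + 2). The added
    2 keeps the window within [0, 1/2), where increments are known to be constant near 0.\<close>
  define A where "A n = {\<alpha>. 0 \<le> \<alpha> \<and> \<alpha> \<le> 1/4 \<and>
    (\<forall>x. 0 \<le> x \<longrightarrow> x < 1 / (real n + 2) \<longrightarrow> \<phi> (x + \<alpha>) - \<phi> x = \<phi> \<alpha> - \<phi> 0)}" for n
  have cover: "{0..1/4} \<subseteq> (\<Union>n. A n)"
  proof
    fix \<alpha> :: real assume al: "\<alpha> \<in> {0..1/4}"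
    then obtain e where e: "e > 0" "\<And>x. 0 \<le> x \<Longrightarrow> x < e \<Longrightarrow> x < 1/2 \<Longrightarrow> \<phi> (x + \<alpha>) - \<phi> x = \<phi> \<alpha> - \<phi> 0"
      using \<phi>_increment_locally_constant[of \<alpha>] by auto
    obtain n where n: "inverse (real (Suc n)) < e" using reals_Archimedean[OF e(1)] by blast
    have "1 / (real n + 2) \<le> inverse (real (Suc n))" "1 / (real n + 2) \<le> 1/2" by (auto simp: field_simps)
    then have "x < e" "x < 1/2" if "x < 1 / (real n + 2)" for x using n that by linarith+
    then have "\<alpha> \<in> A n" using al e(2) unfolding A_def by auto
    then show "\<alpha> \<in> (\<Union>n. A n)" by blast
  qed
  have "0 < (1/4 :: real)" by simp
  from this cover obtain n p q where pq: "0 \<le> p" "p < q" "q \<le> 1/4" "{p..q} \<subseteq> closure (A n)"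
    by (rule closure_cover_interval) (rule that)
  define m where "m = 1 / (real n + 2)"
  have m: "0 < m" "m \<le> 1/2" by (auto simp: m_def field_simps)
  \<comment> \<open>Angles of \<open>A n\<close> approximating \<open>\<alpha>\<close> from the
    right carry the identity over to \<open>\<alpha>\<close> itself, by right-continuity at
    \<open>\<alpha>\<close> and at \<open>x + \<alpha>\<close>. Excluding \<open>q\<close> leaves
    room on the right.\<close>
  have shift: "\<phi> (x + \<alpha>) - \<phi> x = \<phi> \<alpha> - \<phi> 0" if al: "p \<le> \<alpha>" "\<alpha> < q" and x: "0 \<le> x" "x < m" for x \<alpha>
  proof -
    have "\<bar>(\<phi> (x + \<alpha>) - \<phi> x) - (\<phi> \<alpha> - \<phi> 0)\<bar> \<le> \<epsilon>" if eps: "\<epsilon> > 0" for \<epsilon>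
    proof -
      have c: "x + \<alpha> \<in> circ" "\<alpha> \<in> circ" using al x pq m by (auto simp: circ_def)
      obtain e1 where e1: "e1 > x + \<alpha>" "\<And>y. x + \<alpha> \<le> y \<Longrightarrow> y < e1 \<Longrightarrow> \<bar>\<phi> y - \<phi> (x + \<alpha>)\<bar> \<le> \<epsilon> / 2"
        using \<phi>_right_continuous[OF c(1), of "\<epsilon> / 2"] eps by auto
      obtain e2 where e2: "e2 > \<alpha>" "\<And>y. \<alpha> \<le> y \<Longrightarrow> y < e2 \<Longrightarrow> \<bar>\<phi> y - \<phi> \<alpha>\<bar> \<le> \<epsilon> / 2"
        using \<phi>_right_continuous[OF c(2), of "\<epsilon> / 2"] eps by auto
      define u where "u = min (min (e1 - x) e2) q"
      have u: "\<alpha> < u" using e1(1) e2(1) al by (simp add: u_def)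
      have "u \<le> q" by (simp add: u_def)
      \<comment> \<open>Approximating the midpoint to within half the length puts
        \<open>\<beta>\<close> strictly between \<open>\<alpha>\<close> and
        \<open>u\<close>.\<close>
      then have "(\<alpha> + u) / 2 \<in> {p..q}" using al u by simp
      then have "(\<alpha> + u) / 2 \<in> closure (A n)" using pq(4) by blast
      then obtain \<beta> where b: "\<beta> \<in> A n" "dist \<beta> ((\<alpha> + u) / 2) < (u - \<alpha>) / 2"
        using u unfolding closure_approachable by (metis diff_gt_0_iff_gt half_gt_zero)
      have "\<bar>\<beta> - (\<alpha> + u) / 2\<bar> < (u - \<alpha>) / 2" using b(2) by (simp add: dist_real_def)
      then have bu: "\<alpha> < \<beta>" "\<beta> < u" by (auto simp: abs_less_iff field_simps)
      have "\<phi> (x + \<beta>) - \<phi> x = \<phi> \<beta> - \<phi> 0" using b(1) x by (simp add: A_def m_def)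
      moreover have "\<bar>\<phi> (x + \<beta>) - \<phi> (x + \<alpha>)\<bar> \<le> \<epsilon> / 2" using bu by (intro e1(2)) (auto simp: u_def)
      moreover have "\<bar>\<phi> \<beta> - \<phi> \<alpha>\<bar> \<le> \<epsilon> / 2" using bu by (intro e2(2)) (auto simp: u_def)
      ultimately show ?thesis by linarith
    qed
    then have "\<bar>(\<phi> (x + \<alpha>) - \<phi> x) - (\<phi> \<alpha> - \<phi> 0)\<bar> \<le> 0" by (rule dense_ge)
    then show ?thesis by linarith
  qed
  \<comment> \<open>\<open>m\<close> bounds the base points of the shifts, and \<open>q - p\<close>
    keeps the angle \<open>s + p\<close> below \<open>q\<close>.\<close>
  define \<eta> where "\<eta> = min m (q - p)"
  have eta: "0 < \<eta>" "\<eta> \<le> 1/2" using m pq(2) unfolding \<eta>_def by linarith+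
  define L where "L s = \<phi> s - \<phi> 0" for s
  have addL: "L (s + t) = L s + L t" if st: "0 \<le> s" "0 \<le> t" "s + t < \<eta>" for s t
  proof -
    \<comment> \<open>The value at \<open>s + t + p\<close> is computed in two ways: over the angle
      \<open>p\<close> from \<open>s + t\<close>, and over the angle \<open>s + p\<close> from
      \<open>t\<close>.\<close>
    have "\<phi> ((s + t) + p) - \<phi> (s + t) = \<phi> p - \<phi> 0" using st by (intro shift) (auto simp: \<eta>_def pq(2))
    moreover have "\<phi> (s + p) - \<phi> s = \<phi> p - \<phi> 0" using st by (intro shift) (auto simp: \<eta>_def pq(2))
    moreover have "\<phi> (t + (s + p)) - \<phi> t = \<phi> (s + p) - \<phi> 0" using st by (intro shift) (auto simp: \<eta>_def)
    moreover have "(s + t) + p = t + (s + p)" by simp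
    ultimately show ?thesis by (simp add: L_def)
  qed
  have rcL: "\<exists>e>s. \<forall>t. s \<le> t \<longrightarrow> t < e \<longrightarrow> \<bar>L t - L s\<bar> \<le> \<delta>" if "0 \<le> s" "s < \<eta>" "\<delta> > 0" for s \<delta>
  proof -
    have "s \<in> circ" using that eta by (simp add: circ_def)
    then obtain e where "e > s" "\<And>y. s \<le> y \<Longrightarrow> y < e \<Longrightarrow> \<bar>\<phi> y - \<phi> s\<bar> \<le> \<delta>"
      using \<phi>_right_continuous[of s \<delta>] \<open>\<delta> > 0\<close> by metis
    then show ?thesis by (intro exI[of _ e]) (auto simp: L_def)
  qed
  have "\<exists>k. \<forall>s. 0 \<le> s \<longrightarrow> s < \<eta> \<longrightarrow> L s = k * s"
    by (rule additive_right_continuous_linear[OF eta(1) addL rcL]) (assumption | blast)+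
  then obtain k where k: "\<And>s. 0 \<le> s \<Longrightarrow> s < \<eta> \<Longrightarrow> L s = k * s" by blast
  have "\<phi> s = \<phi> 0 + k * s" if "0 \<le> s" "s < \<eta>" for s using k[OF that] by (simp add: L_def)
  then show thesis using that[OF eta] by blast
qed

end

section \<open>Orientation-preserving automorphisms are inner\<close>

lemma iet_eqI_image:
  assumes f: "iet f" and g: "iet g" and eq: "\<And>b. clopen b \<Longrightarrow> f ` b = g ` b"
  shows "f = g"
proof
  fix x
  show "f x = g x"
  proof (rule ccontr)
    assume ne: "f x \<noteq> g x"
    then have "x \<in> circ" using iet_outside[OF f, of x] iet_outside[OF g, of x] by metis
    then have "f x \<in> circ" using iet_circ[OF f] by blast
    then obtain c where c: "clopen c" "f x \<in> c" "g x \<notin> c" using separate_points[of "f x" "g x"] ne by metis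
    have "g x \<in> g ` (f -` c)" using c(2) by blast
    then have "g x \<in> f ` (f -` c)" using eq[OF clopen_vimage[OF f c(1)]] by simp
    then show False using c(3) by auto
  qed
qed

lemma germ_small_interval:
  assumes "F \<in> germs" "\<eta> > 0"
  obtains p q where "0 \<le> p" "p < q" "q \<le> 1" "q - p \<le> \<eta>" "\<forall>\<^sub>F y in F. y \<in> {p..<q}"
  using assms(1)
proof (cases rule: germ_cases)
  case (right x)
  show thesis
    by (rule that[of x "min 1 (x + \<eta>)"])
      (use right assms(2) in \<open>auto simp: eventually_rgerm intro!: exI[of _ "min 1 (x + \<eta>)"]\<close>)
next
  case (left x)
  show thesis
    by (rule that[of "max 0 (x - \<eta>)" x])
      (use left assms(2) in \<open>auto simp: eventually_at_left_field intro!: exI[of _ "max 0 (x - \<eta>)"]\<close>)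
qed

context iet_automorphism
begin

text \<open>\<open>\<phi>\<close> only locates base points, so images are first enclosed in closed
  intervals, and the half-open shape of clopen sets then decides the endpoints. For negative slope
  the image is still closed on the left, although \<open>\<phi>\<close> maps [s, t) onto an interval
  closed on the right.\<close>

lemma \<theta>_interval_affine:
  obtains k \<eta> c where "0 < \<eta>" "\<eta> \<le> 1/2" "k \<noteq> 0"
    "\<And>s t. 0 \<le> s \<Longrightarrow> s < t \<Longrightarrow> t < \<eta> \<Longrightarrow>
      \<theta> {s..<t} = {min (c + k * s) (c + k * t)..<max (c + k * s) (c + k * t)}"
proof -
  obtain k \<eta> where eta: "0 < \<eta>" "\<eta> \<le> 1/2" and aff: "\<And>s. 0 \<le> s \<Longrightarrow> s < \<eta> \<Longrightarrow> \<phi> s = \<phi> 0 + k * s"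
    by (rule \<phi>_affine) (rule that)
  define c where "c = \<phi> 0"
  note aff = aff[folded c_def]
  have sub: "\<theta> {s..<t} \<subseteq> {min (c + k * s) (c + k * t)..max (c + k * s) (c + k * t)}"
    if st: "0 \<le> s" "s < t" "t < \<eta>" for s t
  proof
    fix z assume z: "z \<in> \<theta> {s..<t}"
    let ?lo = "min (c + k * s) (c + k * t)" and ?hi = "max (c + k * s) (c + k * t)"
    have cl: "clopen {s..<t}" using st eta by (intro clopen_interval) auto
    have zc: "z \<in> circ" using z clopen_subset[OF clopen_\<theta>[OF cl]] by blast
    \<comment> \<open>A short interval [z, r) inside the image is itself the image of a nonempty
      clopen \<open>a\<close>, and \<open>\<phi>\<close> sends points of \<open>a\<close> into
      [z, r].\<close>
    have near: "\<exists>x. s \<le> x \<and> x < t \<and> z \<le> \<phi> x \<and> \<phi> x \<le> e" if e: "e > z" for e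
    proof -
      obtain r where r: "z < r" "r \<le> min e 1" "{z..<r} \<subseteq> \<theta> {s..<t}"
        using clopen_contains_interval[OF clopen_\<theta>[OF cl] z, of "min e 1"] e zc by (auto simp: circ_def)
      have "clopen {z..<r}" using r zc by (intro clopen_interval) (auto simp: circ_def)
      then obtain a where a: "clopen a" "\<theta> a = {z..<r}" by (rule \<theta>_surj)
      have asub: "a \<subseteq> {s..<t}" using \<theta>_subset_iff[OF a(1) cl] a(2) r(3) by simp
      have "a \<noteq> {}" using a(2) r(1) by auto
      then obtain x where x: "x \<in> a" by blast
      have "\<theta> a \<subseteq> {z..r}" using a(2) by auto
      then have "z \<le> \<phi> x" "\<phi> x \<le> r" using \<phi>_in_closed_interval[OF a(1) x] by blast+
      then show ?thesis using x asub r(2) by (intro exI[of _ x]) auto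
    qed
    have range: "?lo \<le> \<phi> x \<and> \<phi> x \<le> ?hi" if x: "s \<le> x" "x < t" for x
    proof -
      have "\<phi> x = c + k * x" using aff x st by simp
      moreover have "min (k * s) (k * t) \<le> k * x \<and> k * x \<le> max (k * s) (k * t)"
        using x by (cases "k \<ge> 0") (auto simp: mult_left_mono mult_left_mono_neg min_le_iff_disj le_max_iff_disj)
      ultimately show ?thesis by (auto simp: min_def max_def split: if_splits)
    qed
    have "z \<le> ?hi" using near[of "z + 1"] range by force
    moreover have "?lo \<le> z"
    proof (rule ccontr)
      assume "\<not> ?lo \<le> z"
      then have "z < (z + ?lo) / 2" "(z + ?lo) / 2 < ?lo" by (auto simp: field_simps)
      then show False using near[of "(z + ?lo) / 2"] range by force
    qed
    ultimately show "z \<in> {?lo..?hi}" by simp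
  qed
  \<comment> \<open>Slope 0 would squeeze the image of an interval into one point, but a finite
    clopen set is empty.\<close>
  have k: "k \<noteq> 0"
  proof
    assume k0: "k = 0"
    let ?I = "{0..<\<eta> / 2}"
    have cl: "clopen ?I" using eta by (intro clopen_interval) auto
    have "\<theta> ?I \<subseteq> {c}" using sub[of 0 "\<eta> / 2"] eta k0 by auto
    then have "\<theta> ?I = {}" using clopen_finite_empty[OF clopen_\<theta>[OF cl]] finite_subset by blast
    then have "?I = {}" using \<theta>_eq_iff[OF cl clopen_empty] by simp
    then show False using eta by simp
  qed
  have "\<theta> {s..<t} = {min (c + k * s) (c + k * t)..<max (c + k * s) (c + k * t)}"
    if st: "0 \<le> s" "s < t" "t < \<eta>" for s t
  proof -
    define lo hi where "lo = min (c + k * s) (c + k * t)" and "hi = max (c + k * s) (c + k * t)"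
    have cl: "clopen {s..<t}" using st eta by (intro clopen_interval) auto
    note cl\<theta> = clopen_\<theta>[OF cl]
    have sub': "\<theta> {s..<t} \<subseteq> {lo..hi}" using sub[OF st] by (simp add: lo_def hi_def)
    have "hi \<notin> \<theta> {s..<t}"
    proof
      assume "hi \<in> \<theta> {s..<t}"
      then obtain r where r: "hi < r" "{hi..<r} \<subseteq> \<theta> {s..<t}"
        using clopen_contains_interval[OF cl\<theta>, of hi "hi + 1"] by auto
      then have "(hi + r) / 2 \<in> \<theta> {s..<t}" by auto
      then show False using sub' r(1) by auto
    qed
    then have 1: "\<theta> {s..<t} \<subseteq> {lo..<hi}" using sub' by (force simp: less_le)
    have "{lo..<hi} \<subseteq> \<theta> {s..<t}"
    proof
      fix z assume z: "z \<in> {lo..<hi}"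
      have "s \<in> circ" "t \<in> circ" using st eta by (auto simp: circ_def)
      then have "0 \<le> lo" "hi \<le> 1"
        using \<phi>_ge0[of s] \<phi>_ge0[of t] \<phi>_le1[of s] \<phi>_le1[of t] aff[of s] aff[of t] st by (auto simp: lo_def hi_def)
      then have zc: "z \<in> circ" using z by (auto simp: circ_def)
      show "z \<in> \<theta> {s..<t}"
      proof (rule ccontr)
        assume "z \<notin> \<theta> {s..<t}"
        then have "z \<in> circ - \<theta> {s..<t}" using zc by blast
        then obtain r where r: "z < r" "r \<le> hi" "{z..<r} \<subseteq> circ - \<theta> {s..<t}"
          using clopen_contains_interval[OF clopen_Compl[OF cl\<theta>], of z hi] z by auto
        \<comment> \<open>The interior point \<open>w\<close> is the base point of the image germ at
          some \<open>x\<close> strictly inside (s, t), so that germ lies in (z, r) whichever its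
          side.\<close>
        define w where "w = (z + r) / 2"
        have w: "z < w" "w < r" "lo < w" "w < hi" using r z by (auto simp: w_def)
        define x where "x = (w - c) / k"
        have kx: "c + k * x = w" using k by (simp add: x_def)
        have x: "s < x" "x < t"
        proof -
          have "s < x \<and> x < t"
          proof (cases "k > 0")
            case True
            then have "lo = c + k * s" "hi = c + k * t" using st by (auto simp: lo_def hi_def)
            then have "k * s < k * x" "k * x < k * t" using w kx by auto
            then show ?thesis using True by simp
          next
            case False
            then have kn: "k < 0" using k by simp
            then have "lo = c + k * t" "hi = c + k * s" using st by (auto simp: lo_def hi_def mult_left_mono_neg min_def max_def)
            then have "k * t < k * x" "k * x < k * s" using w kx by auto
            then show ?thesis using kn by simp
          qed
          then show "s < x" "x < t" by auto
        qed
        have xc: "x \<in> circ" using x st eta by (auto simp: circ_def)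
        have \<phi>x: "\<phi> x = w" using aff[of x] x st kx by simp
        have "\<forall>\<^sub>F y in germ_image (rgerm x). z < y" "\<forall>\<^sub>F y in germ_image (rgerm x). y < r"
          using order_tendstoD[OF \<phi>_tendsto[OF xc]] w \<phi>x by auto
        then have "\<forall>\<^sub>F y in germ_image (rgerm x). y \<notin> \<theta> {s..<t}"
        proof eventually_elim
          case (elim y)
          then have "y \<in> {z..<r}" by simp
          then show ?case using r(3) by blast
        qed
        moreover have "\<forall>\<^sub>F y in germ_image (rgerm x). y \<in> \<theta> {s..<t}"
          using germ_image_mem[OF cl, of x] x by simp
        ultimately show False using germ_not_both[OF germ_image_germ[OF rgerm_circ[OF xc]]] by blast
      qed
    qed
    with 1 show ?thesis by (simp add: lo_def hi_def)
  qed
  then show thesis using that[OF eta k] by blast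
qed

text \<open>The length \<open>l\<close> is 1 / N, so that \<open>N\<close> shifted copies of [0, l)
  tile the circle exactly. Exchanges carry their images onto one another, so each has the measure of
  the first, and the total measure 1 forces the absolute slope to be 1.\<close>

lemma \<theta>_interval_isometry:
  obtains c \<eta> where "0 < \<eta>" "\<eta> \<le> 1/2"
    "(\<forall>s t. 0 \<le> s \<longrightarrow> s < t \<longrightarrow> t < \<eta> \<longrightarrow> \<theta> {s..<t} = {s + c..<t + c}) \<or>
     (\<forall>s t. 0 \<le> s \<longrightarrow> s < t \<longrightarrow> t < \<eta> \<longrightarrow> \<theta> {s..<t} = {c - t..<c - s})"
proof -
  obtain k \<eta> c where eta: "0 < \<eta>" "\<eta> \<le> 1/2" and k: "k \<noteq> 0" and aff:
    "\<And>s t. 0 \<le> s \<Longrightarrow> s < t \<Longrightarrow> t < \<eta> \<Longrightarrow>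
      \<theta> {s..<t} = {min (c + k * s) (c + k * t)..<max (c + k * s) (c + k * t)}"
    by (rule \<theta>_interval_affine) (rule that)
  obtain n where n: "inverse (real (Suc n)) < \<eta>" using reals_Archimedean[OF eta(1)] by blast
  define N where "N = Suc n"
  define l where "l = 1 / real N"
  have l: "0 < l" "l < \<eta>" "real N * l = 1" using n by (auto simp: l_def N_def inverse_eq_divide)
  have m0: "measure lebesgue (\<theta> {0..<l}) = \<bar>k\<bar> * l"
  proof -
    have "measure lebesgue (\<theta> {0..<l}) = max c (c + k * l) - min c (c + k * l)"
      unfolding aff[OF order.refl l(1,2)] by (simp add: measure_completion)
    also have "\<dots> = \<bar>k * l\<bar>" by (simp add: max_def min_def abs_if)
    finally show ?thesis using l(1) by (simp add: abs_mult)
  qed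
  have "measure lebesgue (\<theta> {0..<real i * l}) = real i * (\<bar>k\<bar> * l)" if "i \<le> N" for i
    using that
  proof (induction i)
    case (Suc i)
    have il: "real i * l + l \<le> 1"
    proof -
      have "(real i + 1) * l \<le> real N * l" using Suc.prems l(1) by (intro mult_right_mono) auto
      then show ?thesis using l(3) by (simp add: algebra_simps)
    qed
    have i0: "0 \<le> real i * l" using l(1) by simp
    let ?a = "{0..<real i * l}" and ?b = "{real i * l..<real i * l + l}"
    have cl: "clopen ?a" "clopen ?b" "clopen {0..<l}" using il i0 l eta by (auto intro!: clopen_interval)
    obtain r where r: "iet r" "\<And>y. y \<in> circ \<Longrightarrow> y + real i * l \<in> circ \<Longrightarrow> r y = y + real i * l"
      using exists_iet_shift[of "real i * l"] il i0 l(1) by auto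
    have "r y = y + real i * l" if "y \<in> {0..<l}" for y
      using that il i0 l(2) eta(2) by (intro r(2)) (auto simp: circ_def)
    then have "r ` {0..<l} = ?b" using iet_shift_interval[OF r(1), of 0 l "real i * l"] by (simp add: add.commute)
    then have mb: "measure lebesgue (\<theta> ?b) = \<bar>k\<bar> * l"
      using \<theta>_image[OF r(1) cl(3)] measure_iet_image[OF iet_\<Phi>[OF r(1)] clopen_\<theta>[OF cl(3)]] m0 by simp
    have "real (Suc i) * l = real i * l + l" by (simp add: algebra_simps)
    then have eq: "{0..<real (Suc i) * l} = ?a \<union> ?b"
      using ivl_disj_un_two(3)[OF i0, of "real i * l + l"] l(1) by simp
    have "?a \<inter> ?b = {}" by auto
    then have "\<theta> ?a \<inter> \<theta> ?b = {}" by (rule \<theta>_disjoint[OF cl(1,2)])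
    then have "measure lebesgue (\<theta> {0..<real (Suc i) * l}) = measure lebesgue (\<theta> ?a) + measure lebesgue (\<theta> ?b)"
      unfolding eq \<theta>_Un[OF cl(1,2)] using cl by (intro measure_clopen_Un clopen_\<theta>)
    then show ?case using Suc mb by (simp add: algebra_simps)
  qed simp
  from this[of N] have "measure lebesgue (\<theta> {0..<1}) = \<bar>k\<bar>" using l(3) by simp
  moreover have "\<theta> {0..<1} = {0..<1}" using \<theta>_circ by (simp add: circ_def)
  ultimately have "\<bar>k\<bar> = 1" by (simp add: measure_completion)
  then consider "k = 1" | "k = -1" by linarith
  then show thesis
  proof cases
    case 1
    have "\<theta> {s..<t} = {s + c..<t + c}" if "0 \<le> s" "s < t" "t < \<eta>" for s t
      using aff[OF that] that by (simp add: 1 min_def max_def add.commute)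
    then show thesis using that[OF eta] by blast
  next
    case 2
    have "\<theta> {s..<t} = {c - t..<c - s}" if "0 \<le> s" "s < t" "t < \<eta>" for s t
      using aff[OF that] that by (simp add: 2 min_def max_def)
    then show thesis using that[OF eta] by blast
  qed
qed

section \<open>From translation on one window to a conjugating interval exchange\<close>

definition translates :: "real \<Rightarrow> real \<Rightarrow> real \<Rightarrow> bool" where
  "translates u \<eta> d \<longleftrightarrow> 0 \<le> u \<and> 0 < \<eta> \<and> u + \<eta> \<le> 1 \<and>
     (\<forall>s t. u \<le> s \<longrightarrow> s < t \<longrightarrow> t \<le> u + \<eta> \<longrightarrow> \<theta> {s..<t} = {s + d..<t + d})"

text \<open>Every point of a clopen set starts an interval inside it, so the translate is contained
  in the image; the same fact for the complement within the window gives the other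
  inclusion.\<close>

lemma \<theta>_translation:
  assumes tr: "translates u \<eta> d" and b: "clopen b" "b \<subseteq> {u..<u + \<eta>}"
  shows "\<theta> b = (\<lambda>y. y + d) ` b"
proof -
  have u: "0 \<le> u" "0 < \<eta>" "u + \<eta> \<le> 1"
    and tr': "\<And>s t. u \<le> s \<Longrightarrow> s < t \<Longrightarrow> t \<le> u + \<eta> \<Longrightarrow> \<theta> {s..<t} = {s + d..<t + d}"
    using tr by (auto simp: translates_def)
  have inc: "y + d \<in> \<theta> a" if a: "clopen a" "a \<subseteq> {u..<u + \<eta>}" "y \<in> a" for a y
  proof -
    have "y < u + \<eta>" "u \<le> y" using a by auto
    then obtain t where t: "y < t" "t \<le> u + \<eta>" "{y..<t} \<subseteq> a"
      using clopen_contains_interval[OF a(1,3), of "u + \<eta>"] by auto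
    have "clopen {y..<t}" using t u \<open>u \<le> y\<close> by (intro clopen_interval) auto
    then have "\<theta> {y..<t} \<subseteq> \<theta> a" using \<theta>_subset_iff a(1) t(3) by blast
    then show ?thesis using tr'[OF \<open>u \<le> y\<close> t(1,2)] t(1) by auto
  qed
  let ?I = "{u..<u + \<eta>}"
  have I: "clopen ?I" using u by (intro clopen_interval) auto
  have "z \<in> (\<lambda>y. y + d) ` b" if z: "z \<in> \<theta> b" for z
  proof -
    have "z \<in> \<theta> ?I" using z \<theta>_subset_iff[OF b(1) I] b(2) by blast
    then have zd: "z - d \<in> ?I" using tr'[of u "u + \<eta>"] u by auto
    have "z - d \<in> b"
    proof (rule ccontr)
      assume "z - d \<notin> b"
      then have "z - d \<in> ?I - b" using zd by blast
      then have "z - d + d \<in> \<theta> (?I - b)" using I b by (intro inc clopen_Diff) auto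
      moreover have "\<theta> b \<inter> \<theta> (?I - b) = {}" using I b by (intro \<theta>_disjoint clopen_Diff) auto
      ultimately show False using z by auto
    qed
    then show ?thesis by (intro image_eqI[of _ _ "z - d"]) auto
  qed
  then show ?thesis using inc[OF b] by blast
qed

text \<open>A shift \<open>r\<close> brings a small interval at \<open>F\<close> into the window
  where \<open>\<theta>\<close> translates by \<open>d\<close>, and the inverse of
  \<open>\<Phi> r\<close> brings the result back. The exchange obtained depends on
  \<open>F\<close>.\<close>

lemma \<theta>_locally_iet:
  assumes tr: "translates u \<eta> d" and F: "F \<in> germs"
  obtains f I where "iet f" "clopen I" "\<forall>\<^sub>F y in F. y \<in> I" "\<And>b. clopen b \<Longrightarrow> b \<subseteq> I \<Longrightarrow> \<theta> b = f ` b"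
proof -
  have u: "0 \<le> u" "0 < \<eta>" "u + \<eta> \<le> 1" using tr by (auto simp: translates_def)
  obtain p q where pq: "0 \<le> p" "p < q" "q \<le> 1" "q - p \<le> \<eta>" "\<forall>\<^sub>F y in F. y \<in> {p..<q}"
    by (rule germ_small_interval[OF F u(2)]) (rule that)
  have "\<bar>u - p\<bar> < 1" using u pq by linarith
  then obtain r where r: "iet r" "\<And>y. y \<in> circ \<Longrightarrow> y + (u - p) \<in> circ \<Longrightarrow> r y = y + (u - p)"
    by (rule exists_iet_shift) (rule that)
  have I: "clopen {u..<u + \<eta>}" using u by (intro clopen_interval) auto
  have \<theta>I: "\<theta> {u..<u + \<eta>} = (\<lambda>y. y + d) ` {u..<u + \<eta>}" by (rule \<theta>_translation[OF tr I order.refl])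
  then have dc: "y + d \<in> circ" if "y \<in> {u..<u + \<eta>}" for y
    using that clopen_subset[OF clopen_\<theta>[OF I]] by blast
  have "\<bar>d\<bar> < 1" using dc[of u] u by (auto simp: circ_def)
  then obtain \<tau> where \<tau>: "iet \<tau>" "\<And>y. y \<in> circ \<Longrightarrow> y + d \<in> circ \<Longrightarrow> \<tau> y = y + d"
    by (rule exists_iet_shift) (rule that)
  let ?f = "inv_into UNIV (\<Phi> r) \<circ> \<tau> \<circ> r"
  show thesis
  proof (rule that[of ?f "{p..<q}"])
    show "iet ?f" using r \<tau> by (simp add: iet_comp iet_inv)
    show "clopen {p..<q}" using pq by (intro clopen_interval) auto
    fix b assume b: "clopen b" "b \<subseteq> {p..<q}"
    have rb: "r y \<in> {u..<u + \<eta>}" if "y \<in> b" for y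
    proof -
      have "y \<in> {p..<q}" using b that by blast
      then have "y \<in> circ" "y + (u - p) \<in> {u..<u + \<eta>}" "y + (u - p) \<in> circ" using pq u by (auto simp: circ_def)
      then show ?thesis using r(2) by simp
    qed
    have "\<tau> y = y + d" if "y \<in> {u..<u + \<eta>}" for y
      using that dc[OF that] u by (intro \<tau>(2)) (auto simp: circ_def)
    then have "\<tau> ` r ` b = (\<lambda>y. y + d) ` r ` b" using rb by (intro image_cong) auto
    also have "\<dots> = \<theta> (r ` b)"
      using rb by (intro \<theta>_translation[OF tr clopen_image[OF r(1) b(1)], symmetric]) auto
    also have "\<dots> = \<Phi> r ` \<theta> b" by (rule \<theta>_image[OF r(1) b(1)])
    finally have "inv_into UNIV (\<Phi> r) ` \<tau> ` r ` b = inv_into UNIV (\<Phi> r) ` \<Phi> r ` \<theta> b" by simp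
    then show "\<theta> b = ?f ` b"
      using iet_bij[OF iet_\<Phi>[OF r(1)]] by (simp add: image_comp image_inv_f_f bij_is_inj)
  qed (use pq in auto)
qed

text \<open>\<open>follows x z\<close> says that \<open>\<theta>\<close> sends the right germ at \<open>x\<close> to the right germ at \<open>z\<close>.\<close>

definition follows :: "real \<Rightarrow> real \<Rightarrow> bool" where
  "follows x z \<longleftrightarrow> (\<forall>b. clopen b \<longrightarrow> x \<in> b \<longrightarrow> z \<in> \<theta> b)"

lemma follows_iff:
  assumes "follows x z" "x \<in> circ" "clopen b" shows "z \<in> \<theta> b \<longleftrightarrow> x \<in> b"
  using assms \<theta>_Compl[OF assms(3)] clopen_Compl[OF assms(3)] unfolding follows_def by blast

lemma follows_unique:
  assumes "follows x z" "follows x z'" "x \<in> circ" shows "z = z'"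
proof (rule ccontr)
  assume "z \<noteq> z'"
  moreover have "z \<in> circ" using assms(1,3) \<theta>_circ clopen_circ unfolding follows_def by blast
  ultimately obtain c where c: "clopen c" "z \<in> c" "z' \<notin> c" using separate_points by metis
  obtain a where "clopen a" "\<theta> a = c" using \<theta>_surj[OF c(1)] .
  then show False using follows_iff[OF assms(1,3)] follows_iff[OF assms(2,3)] c by blast
qed

lemma follows_local:
  assumes "clopen I" "\<And>b. clopen b \<Longrightarrow> b \<subseteq> I \<Longrightarrow> \<theta> b = f ` b" "x \<in> I"
  shows "follows x (f x)"
  unfolding follows_def
proof (intro allI impI)
  fix b assume b: "clopen b" "x \<in> b"
  have "clopen (b \<inter> I)" using assms(1) b(1) by (rule clopen_Int[rotated])
  then have "f x \<in> \<theta> (b \<inter> I)" using assms b by auto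
  then show "f x \<in> \<theta> b" using \<theta>_Int[OF b(1) assms(1)] by blast
qed

lemma follows_exists:
  assumes "translates u \<eta> d" "x \<in> circ" shows "\<exists>z. follows x z"
proof -
  obtain f I where fI: "iet f" "clopen I" "\<forall>\<^sub>F y in rgerm x. y \<in> I" "\<And>b. clopen b \<Longrightarrow> b \<subseteq> I \<Longrightarrow> \<theta> b = f ` b"
    by (rule \<theta>_locally_iet[OF assms(1) rgerm_circ[OF assms(2)]]) (rule that)
  then show ?thesis using follows_local[OF fI(2,4)] rgerm_self[OF fI(3)] by blast
qed

end

text \<open>Locally \<open>\<theta>\<close> acts by exchanges, so every \<open>x\<close> has a point
  following it; this defines \<open>f\<close>, whose images of clopen sets are given by
  \<open>\<theta>\<close>. Equivariance makes \<open>\<Phi> g \<circ> f\<close> and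
  \<open>f \<circ> g\<close> agree on clopen sets, hence as maps.\<close>

lemma (in iet_automorphism) inner_if_translates:
  assumes tr: "translates u \<eta> d"
  obtains f where "iet f" "\<And>g. iet g \<Longrightarrow> \<Phi> g = f \<circ> g \<circ> inv_into UNIV f"
proof -
  define f where "f x = (if x \<in> circ then SOME z. follows x z else x)" for x
  have fol: "follows x (f x)" if "x \<in> circ" for x
    using someI_ex[OF follows_exists[OF tr that]] that by (simp add: f_def)
  have f\<theta>: "f x \<in> \<theta> b \<longleftrightarrow> x \<in> b" if "x \<in> circ" "clopen b" for x b
    using follows_iff[OF fol[OF that(1)] that] .
  have maps: "f x \<in> circ" if "x \<in> circ" for x using f\<theta>[OF that clopen_circ] that by simp
  \<comment> \<open>Surjectivity is the existence of followers for the inverse automorphism, whose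
    Boolean map inverts \<open>\<theta>\<close> and so translates by \<open>- d\<close> on the
    shifted window.\<close>
  have surj: "\<exists>x\<in>circ. f x = z" if z: "z \<in> circ" for z
  proof -
    let ?\<Psi> = "inv_into (Collect iet) \<Phi>"
    interpret inv: iet_automorphism ?\<Psi> by (rule inverse)
    have \<theta>inv: "inv.\<theta> (\<theta> b) = b" if b: "clopen b" for b
    proof -
      obtain p where p: "iet p" "\<And>x. p (p x) = x" "supp p = b" using exists_involution_supp[OF b] by metis
      have "?\<Psi> (\<Phi> p) = p" using bij p(1) by (simp add: bij_betw_def)
      then show ?thesis
        using \<theta>_supp[OF p(1,2)] inv.\<theta>_supp[OF iet_\<Phi>[OF p(1)] \<Phi>_involution[OF p(1,2)]] p(3) by simp
    qed
    have u: "0 \<le> u" "0 < \<eta>" "u + \<eta> \<le> 1"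
      and tr': "\<And>s t. u \<le> s \<Longrightarrow> s < t \<Longrightarrow> t \<le> u + \<eta> \<Longrightarrow> \<theta> {s..<t} = {s + d..<t + d}"
      using tr by (auto simp: translates_def)
    have cl: "clopen {s..<t}" if "u \<le> s" "t \<le> u + \<eta>" for s t using that u by (intro clopen_interval) auto
    have "{u + d..<u + \<eta> + d} \<subseteq> circ" using clopen_subset[OF clopen_\<theta>[OF cl]] tr'[of u "u + \<eta>"] u by auto
    then have ud: "0 \<le> u + d" "u + d + \<eta> \<le> 1" using u by (auto simp: circ_def atLeastLessThan_subset_iff)
    have "inv.translates (u + d) \<eta> (- d)"
      unfolding inv.translates_def
    proof (intro conjI allI impI)
      fix s t assume st: "u + d \<le> s" "s < t" "t \<le> u + d + \<eta>"
      have "\<theta> {s - d..<t - d} = {s..<t}" using tr'[of "s - d" "t - d"] st by simp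
      then show "inv.\<theta> {s..<t} = {s + - d..<t + - d}" using \<theta>inv[OF cl, of "s - d" "t - d"] st by simp
    qed (use u ud in auto)
    then obtain x where x: "inv.follows z x" using inv.follows_exists z by blast
    have xc: "x \<in> circ" using x z inv.\<theta>_circ clopen_circ unfolding inv.follows_def by blast
    have "follows x z" unfolding follows_def
    proof (intro allI impI)
      fix b assume b: "clopen b" "x \<in> b"
      show "z \<in> \<theta> b" using inv.follows_iff[OF x z clopen_\<theta>[OF b(1)]] \<theta>inv[OF b(1)] b(2) by simp
    qed
    then show ?thesis using follows_unique[OF fol[OF xc] _ xc] xc by blast
  qed
  have iet: "iet f" unfolding iet_def
  proof (intro conjI allI impI ballI)
    show "f x = x" if "x \<notin> circ" for x using that by (simp add: f_def)
    show "bij_betw f circ circ"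
    proof (rule bij_betw_imageI)
      show "inj_on f circ"
      proof (rule inj_onI, rule ccontr)
        fix x y assume xy: "x \<in> circ" "y \<in> circ" "f x = f y" "x \<noteq> y"
        then obtain b where "clopen b" "x \<in> b" "y \<notin> b" using separate_points by metis
        then show False using f\<theta> xy by metis
      qed
      show "f ` circ = circ" using maps surj by blast
    qed
    fix F assume F: "F \<in> germs"
    obtain f' I where fI: "iet f'" "clopen I" "\<forall>\<^sub>F y in F. y \<in> I" "\<And>b. clopen b \<Longrightarrow> b \<subseteq> I \<Longrightarrow> \<theta> b = f' ` b"
      by (rule \<theta>_locally_iet[OF tr F]) (rule that)
    have eq: "f y = f' y" if "y \<in> I" for y
    proof -
      have "y \<in> circ" using that clopen_subset[OF fI(2)] by blast
      then show ?thesis using follows_unique[OF fol follows_local[OF fI(2,4) that]] by blast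
    qed
    obtain c where "\<forall>\<^sub>F y in F. f' y = y + c" using iet_translation[OF fI(1) F] .
    with fI(3) have "\<forall>\<^sub>F y in F. f y = y + c" by eventually_elim (simp add: eq)
    then show "\<exists>c. \<forall>\<^sub>F y in F. f y = y + c" ..
  qed
  have img: "\<theta> b = f ` b" if b: "clopen b" for b
  proof
    show "f ` b \<subseteq> \<theta> b" using f\<theta>[OF _ b] clopen_subset[OF b] by blast
    show "\<theta> b \<subseteq> f ` b"
    proof
      fix z assume z: "z \<in> \<theta> b"
      then have "z \<in> circ" using clopen_subset[OF clopen_\<theta>[OF b]] by blast
      then obtain x where "x \<in> circ" "f x = z" using surj by blast
      then show "z \<in> f ` b" using f\<theta>[OF _ b] z by blast
    qed
  qed
  have "\<Phi> g = f \<circ> g \<circ> inv_into UNIV f" if g: "iet g" for g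
  proof -
    have "\<Phi> g \<circ> f = f \<circ> g"
    proof (rule iet_eqI_image)
      fix b assume b: "clopen b"
      show "(\<Phi> g \<circ> f) ` b = (f \<circ> g) ` b"
        unfolding image_comp[symmetric] using \<theta>_image[OF g b] img[OF b] img[OF clopen_image[OF g b]] by simp
    qed (use g iet in \<open>simp_all add: iet_comp\<close>)
    then have "\<Phi> g (f x) = f (g x)" for x by (metis comp_apply)
    then show ?thesis using iet_f_inv[OF iet] by (auto simp: fun_eq_iff) metis
  qed
  then show thesis using that[OF iet] by blast
qed

section \<open>The reflection automorphism\<close>

text \<open>The left limit as a real number, not mod 1: for an exchange and \<open>z\<close> in (0,
  1] it again lies in (0, 1].\<close>

definition llim :: "(real \<Rightarrow> real) \<Rightarrow> real \<Rightarrow> real" where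
  "llim f z = z + (THE c. \<forall>\<^sub>F y in at_left z. f y = y + c)"

lemma llim_eq: assumes "\<forall>\<^sub>F y in at_left z. f y = y + c" shows "llim f z = z + c"
proof -
  have "(THE c. \<forall>\<^sub>F y in at_left z. f y = y + c) = c"
  proof (rule the_equality)
    show "\<forall>\<^sub>F y in at_left z. f y = y + c" by fact
    fix d assume "\<forall>\<^sub>F y in at_left z. f y = y + d"
    with assms have "\<forall>\<^sub>F y in at_left z. c = d" by eventually_elim simp
    then show "d = c" by simp
  qed
  then show ?thesis by (simp add: llim_def)
qed

text \<open>\<open>1 - x\<close> identifies [0, 1) with (0, 1], where left limits of exchanges live.
  The point 0 is paired with 1, so no case distinction mod 1 arises.\<close>

definition reflect :: "(real \<Rightarrow> real) \<Rightarrow> real \<Rightarrow> real" where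
  "reflect f x = (if x \<in> circ then 1 - llim f (1 - x) else x)"

lemma reflect_right:
  assumes "x \<in> circ" "\<forall>\<^sub>F y in at_left (1 - x). f y = y + c"
  shows "\<forall>\<^sub>F y in rgerm x. reflect f y = y - c"
proof -
  obtain e where e: "e < 1 - x" "\<And>y. e < y \<Longrightarrow> y < 1 - x \<Longrightarrow> f y = y + c"
    using assms(2) unfolding eventually_at_left_field by blast
  have "reflect f y = y - c" if y: "x \<le> y" "y < min 1 (1 - e)" for y
  proof -
    have "\<forall>\<^sub>F z in at_left (1 - y). f z = z + c"
      unfolding eventually_at_left_field by (rule exI[of _ e]) (use e(2) y in auto)
    then have "llim f (1 - y) = 1 - y + c" by (rule llim_eq)
    moreover have "y \<in> circ" using assms(1) y by (auto simp: circ_def)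
    ultimately show ?thesis by (simp add: reflect_def)
  qed
  moreover have "x < min 1 (1 - e)" using e(1) assms(1) by (auto simp: circ_def)
  ultimately show ?thesis unfolding eventually_rgerm by blast
qed

text \<open>Points \<open>y\<close> just below \<open>x\<close> have \<open>1 - y\<close> just above
  \<open>1 - x\<close>, and the left limit there still sees the piece of \<open>f\<close> that
  starts at \<open>1 - x\<close>.\<close>

lemma reflect_left:
  assumes "0 < x" "x \<le> 1" "\<forall>\<^sub>F y in rgerm (1 - x). f y = y + c"
  shows "\<forall>\<^sub>F y in at_left x. reflect f y = y - c"
proof -
  obtain e where e: "e > 1 - x" "\<And>y. 1 - x \<le> y \<Longrightarrow> y < e \<Longrightarrow> f y = y + c"
    using assms(3) unfolding eventually_rgerm by blast
  have "reflect f y = y - c" if y: "y < x" "max 0 (1 - e) < y" for y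
  proof -
    have "\<forall>\<^sub>F z in at_left (1 - y). f z = z + c"
      unfolding eventually_at_left_field by (rule exI[of _ "1 - x"]) (use e(2) y in auto)
    then have "llim f (1 - y) = 1 - y + c" by (rule llim_eq)
    moreover have "y \<in> circ" using assms y by (auto simp: circ_def)
    ultimately show ?thesis by (simp add: reflect_def)
  qed
  moreover have "max 0 (1 - e) < x" using e(1) assms(1) by auto
  ultimately show ?thesis unfolding eventually_at_left_field by blast
qed

lemma circ_compl: "x \<in> circ \<longleftrightarrow> 0 < 1 - x \<and> 1 - x \<le> 1"
  by (auto simp: circ_def)

lemma iet_left_translation:
  assumes "iet f" "x \<in> circ"
  obtains c where "\<forall>\<^sub>F y in at_left (1 - x). f y = y + c"
  using iet_translation[OF assms(1), of "at_left (1 - x)"] assms(2) circ_compl by auto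

lemma reflect_eq:
  assumes "x \<in> circ" "\<forall>\<^sub>F y in at_left (1 - x). f y = y + c" shows "reflect f x = x - c"
  using llim_eq[OF assms(2)] assms(1) by (simp add: reflect_def)

lemma reflect_circ: assumes "iet f" "x \<in> circ" shows "reflect f x \<in> circ"
proof -
  obtain c where c: "\<forall>\<^sub>F y in at_left (1 - x). f y = y + c" using iet_left_translation[OF assms] .
  have x: "0 < 1 - x" "1 - x \<le> 1" using assms(2) circ_compl by auto
  show ?thesis using iet_at_left(2,3)[OF assms(1) x c] reflect_eq[OF assms(2) c] by (auto simp: circ_def)
qed

text \<open>Left limits compose because an exchange carries a left germ to the left germ at its left
  limit.\<close>

lemma reflect_comp:
  assumes f: "iet f" and g: "iet g" shows "reflect (f \<circ> g) = reflect f \<circ> reflect g"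
proof
  fix x
  show "reflect (f \<circ> g) x = (reflect f \<circ> reflect g) x"
  proof (cases "x \<in> circ")
    case x: True
    obtain c where c: "\<forall>\<^sub>F y in at_left (1 - x). g y = y + c" using iet_left_translation[OF g x] .
    have gx: "reflect g x = x - c" "x - c \<in> circ" using reflect_eq[OF x c] reflect_circ[OF g x] by auto
    obtain d where d: "\<forall>\<^sub>F y in at_left (1 - (x - c)). f y = y + d" using iet_left_translation[OF f gx(2)] .
    have "filtermap g (at_left (1 - x)) = at_left (1 - x + c)"
      using iet_at_left(1)[OF g _ _ c] x circ_compl by blast
    then have "\<forall>\<^sub>F y in filtermap g (at_left (1 - x)). f y = y + d" using d by (simp add: algebra_simps)
    then have "\<forall>\<^sub>F y in at_left (1 - x). f (g y) = g y + d" by (simp add: eventually_filtermap)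
    with c have "\<forall>\<^sub>F y in at_left (1 - x). (f \<circ> g) y = y + (c + d)" by eventually_elim simp
    then show ?thesis using reflect_eq[OF x] reflect_eq[OF gx(2) d] gx(1) by simp
  next
    case False
    then show ?thesis by (simp add: reflect_def)
  qed
qed

lemma reflect_id [simp]: "reflect id = id"
proof
  fix x :: real
  have "\<forall>\<^sub>F y in at_left (1 - x). id y = y + 0" by simp
  then show "reflect id x = id x" using reflect_eq[of x id 0] by (cases "x \<in> circ") (auto simp: reflect_def)
qed

lemma reflect_inverse: assumes "iet f" shows "reflect f (reflect (inv_into UNIV f) x) = x"
  and "reflect (inv_into UNIV f) (reflect f x) = x"
proof -
  have "f \<circ> inv_into UNIV f = id" "inv_into UNIV f \<circ> f = id" using assms by (auto simp: fun_eq_iff)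
  then show "reflect f (reflect (inv_into UNIV f) x) = x" "reflect (inv_into UNIV f) (reflect f x) = x"
    using reflect_comp[OF assms iet_inv[OF assms]] reflect_comp[OF iet_inv[OF assms] assms]
    by (metis comp_apply id_apply reflect_id)+
qed

lemma iet_reflect: assumes f: "iet f" shows "iet (reflect f)"
  unfolding iet_def
proof (intro conjI allI impI ballI)
  show "reflect f x = x" if "x \<notin> circ" for x using that by (simp add: reflect_def)
  show "bij_betw (reflect f) circ circ"
    by (rule bij_betw_byWitness[where f'="reflect (inv_into UNIV f)"])
      (use reflect_inverse[OF f] reflect_circ[OF f] reflect_circ[OF iet_inv[OF f]] in auto)
  fix F assume "F \<in> germs"
  then show "\<exists>c. \<forall>\<^sub>F y in F. reflect f y = y + c"
  proof (cases rule: germ_cases)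
    case (right x)
    then have x: "x \<in> circ" by (simp add: circ_def)
    obtain c where c: "\<forall>\<^sub>F y in at_left (1 - x). f y = y + c" using iet_left_translation[OF f x] .
    show ?thesis using reflect_right[OF x c] right by (intro exI[of _ "- c"]) simp
  next
    case (left x)
    then obtain c where c: "\<forall>\<^sub>F y in rgerm (1 - x). f y = y + c"
      using iet_translation[OF f, of "rgerm (1 - x)"] by auto
    show ?thesis using reflect_left[OF left(1,2) c] left by (intro exI[of _ "- c"]) simp
  qed
qed

lemma reflect_reflect: assumes f: "iet f" shows "reflect (reflect f) = f"
proof
  fix x
  show "reflect (reflect f) x = f x"
  proof (cases "x \<in> circ")
    case x: True
    obtain c where c: "\<forall>\<^sub>F y in rgerm x. f y = y + c"
      using iet_translation[OF f, of "rgerm x"] x by (auto simp: circ_def)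
    have "\<forall>\<^sub>F y in at_left (1 - x). reflect f y = y - c"
      by (rule reflect_left) (use c x circ_compl in auto)
    then have "\<forall>\<^sub>F y in at_left (1 - x). reflect f y = y + (- c)" by simp
    then have "reflect (reflect f) x = x + c" using reflect_eq[OF x] by fastforce
    moreover have "f x = x + c" using rgerm_self[OF c] .
    ultimately show ?thesis by simp
  next
    case False
    then show ?thesis using iet_outside[OF f] by (simp add: reflect_def)
  qed
qed

lemma iet_automorphism_reflect: "iet_automorphism reflect"
proof
  show "bij_betw reflect (Collect iet) (Collect iet)"
    by (rule bij_betw_byWitness[where f'=reflect]) (auto simp: reflect_reflect iet_reflect)
qed (rule reflect_comp)

interpretation reflect: iet_automorphism reflect
  by (rule iet_automorphism_reflect)

lemma supp_reflect:
  assumes "iet p" shows "supp (reflect p) = {x \<in> circ. \<forall>\<^sub>F y in at_left (1 - x). y \<in> supp p}"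
proof -
  have "reflect p x \<noteq> x \<longleftrightarrow> (\<forall>\<^sub>F y in at_left (1 - x). y \<in> supp p)" if x: "x \<in> circ" for x
  proof -
    obtain c where c: "\<forall>\<^sub>F y in at_left (1 - x). p y = y + c" using iet_left_translation[OF assms x] .
    have "(\<forall>\<^sub>F y in at_left (1 - x). y \<in> supp p) \<longleftrightarrow> (\<forall>\<^sub>F y in at_left (1 - x). c \<noteq> 0)"
      by (rule eventually_subst, use c in eventually_elim) (auto simp: supp_def)
    then show ?thesis using reflect_eq[OF x c] by simp
  qed
  moreover have "reflect p x = x" if "x \<notin> circ" for x using that by (simp add: reflect_def)
  ultimately show ?thesis by (auto simp: supp_def)
qed

text \<open>A left germ lies in [s, t) exactly when its base point is in (s, t], and reflecting (s,
  t] makes it closed on the left again.\<close>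

lemma reflect_interval:
  assumes "0 \<le> s" "s < t" "t \<le> 1" shows "reflect.\<theta> {s..<t} = {1 - t..<1 - s}"
proof -
  obtain p where p: "iet p" "\<And>x. p (p x) = x" "supp p = {s..<t}"
    using exists_involution_supp[OF clopen_interval] assms by metis
  have *: "(\<forall>\<^sub>F y in at_left z. y \<in> {s..<t}) \<longleftrightarrow> s < z \<and> z \<le> t" for z
  proof
    assume "\<forall>\<^sub>F y in at_left z. y \<in> {s..<t}"
    then obtain e where e: "e < z" "\<And>y. e < y \<Longrightarrow> y < z \<Longrightarrow> s \<le> y \<and> y < t"
      unfolding eventually_at_left_field by auto
    obtain y where y: "e < y" "y < z" using dense[OF e(1)] by blast
    have "s < z" using e(2)[OF y] y by linarith
    moreover have "z \<le> t"
    proof (rule ccontr)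
      assume "\<not> z \<le> t"
      then have "e < max y t" "max y t < z" using y by auto
      then show False using e(2)[of "max y t"] by auto
    qed
    ultimately show "s < z \<and> z \<le> t" by blast
  next
    assume "s < z \<and> z \<le> t"
    then show "\<forall>\<^sub>F y in at_left z. y \<in> {s..<t}"
      unfolding eventually_at_left_field by (intro exI[of _ s]) auto
  qed
  have "reflect.\<theta> {s..<t} = {x \<in> circ. s < 1 - x \<and> 1 - x \<le> t}"
    using reflect.\<theta>_supp[OF p(1,2)] supp_reflect[OF p(1)] p(3) * by simp
  also have "\<dots> = {1 - t..<1 - s}" using assms by (auto simp: circ_def)
  finally show ?thesis .
qed

section \<open>Identification of the reflection with \<open>Psi_T\<close>\<close>

lemma finite_llim_neq: assumes f: "iet f" shows "finite {z. 0 < z \<and> z < 1 \<and> llim f z \<noteq> f z}"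
proof -
  let ?D = "{z. 0 < z \<and> z < 1 \<and> llim f z \<noteq> f z}"
  have "finite (?D \<inter> {0..<1})"
  proof (induction rule: germ_interval_induct[where Q="\<lambda>s t. finite (?D \<inter> {s..<t})"])
    case (trans r s t)
    have "?D \<inter> {r..<t} = (?D \<inter> {r..<s}) \<union> (?D \<inter> {s..<t})" using trans by auto
    then show ?case using trans by simp
  next
    case (local F)
    obtain c where c: "\<forall>\<^sub>F y in F. f y = y + c" using iet_translation[OF f local] .
    have "finite (?D \<inter> {s..<t})" if st: "\<forall>y\<in>{s..<t}. f y = y + c" for s t
    proof -
      have "llim f z = f z" if z: "s < z" "z < t" for z
      proof -
        have "\<forall>\<^sub>F y in at_left z. f y = y + c"
          unfolding eventually_at_left_field by (rule exI[of _ s]) (use st z in auto)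
        then show ?thesis using llim_eq st z by simp
      qed
      then have "?D \<inter> {s..<t} \<subseteq> {s}" by force
      then show ?thesis using finite_subset by blast
    qed
    then show ?case using c by blast
  qed simp
  moreover have "?D \<inter> {0..<1} = ?D" by auto
  ultimately show ?thesis by simp
qed

lemma Tref_eq: "0 < x \<Longrightarrow> x < 1 \<Longrightarrow> Tref x = 1 - x"
proof -
  assume x: "0 < x" "x < 1"
  then have "\<lfloor>- x\<rfloor> = - 1" by linarith
  then show ?thesis using x by (simp add: Tref_def circ_def frac_def)
qed

text \<open>Exceptions come from jumps of \<open>f\<close>, where value and left limit differ, and
  from the point 0, which \<open>Tref\<close> fixes while \<open>1 - x\<close> sends it to 1; the
  latter matters both at \<open>x = 0\<close> and where \<open>f (1 - x)\<close> is 0.\<close>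

lemma finite_reflect_neq:
  assumes f: "iet f" shows "finite {x \<in> circ. reflect f x \<noteq> (Tref \<circ> f \<circ> Tref) x}"
proof -
  let ?D = "{z. 0 < z \<and> z < 1 \<and> llim f z \<noteq> f z}"
  let ?Z = "f -` {0}"
  have "finite ?Z" using iet_bij[OF f] by (simp add: bij_is_inj finite_vimageI)
  then have "finite ({0} \<union> (\<lambda>z. 1 - z) ` (?D \<union> ?Z))" using finite_llim_neq[OF f] by blast
  moreover have "{x \<in> circ. reflect f x \<noteq> (Tref \<circ> f \<circ> Tref) x} \<subseteq> {0} \<union> (\<lambda>z. 1 - z) ` (?D \<union> ?Z)"
  proof
    fix x assume x: "x \<in> {x \<in> circ. reflect f x \<noteq> (Tref \<circ> f \<circ> Tref) x}"
    show "x \<in> {0} \<union> (\<lambda>z. 1 - z) ` (?D \<union> ?Z)"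
    proof (rule ccontr)
      assume n: "\<not> ?thesis"
      have xc: "x \<in> circ" "x \<noteq> 0" using x n by auto
      have z: "1 - x \<notin> ?D" "1 - x \<notin> ?Z" using n by (auto intro: image_eqI[of _ _ "1 - x"])
      have x01: "0 < x" "x < 1" using xc by (auto simp: circ_def)
      have "f (1 - x) \<in> circ" using iet_circ[OF f, of "1 - x"] x01 by (simp add: circ_def)
      then have "0 < f (1 - x)" "f (1 - x) < 1" using z(2) by (auto simp: circ_def less_le)
      then have "(Tref \<circ> f \<circ> Tref) x = 1 - f (1 - x)" using Tref_eq x01 by simp
      moreover have "reflect f x = 1 - f (1 - x)" using z(1) x01 xc by (simp add: reflect_def)
      ultimately show False using x by simp
    qed
  qed
  ultimately show ?thesis by (rule rev_finite_subset)
qed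

text \<open>Uniqueness holds because two candidates differ on a set that is both finite and clopen,
  hence empty.\<close>

lemma Psi_T_eq_reflect: assumes f: "iet f" shows "Psi_T f = reflect f"
  unfolding Psi_T_def is_iet_iff_iet
proof (rule the_equality)
  let ?h = "Tref \<circ> f \<circ> Tref"
  show *: "iet (reflect f) \<and> finite {x \<in> circ. reflect f x \<noteq> ?h x}"
    using iet_reflect[OF f] finite_reflect_neq[OF f] by blast
  fix g assume g: "iet g \<and> finite {x \<in> circ. g x \<noteq> ?h x}"
  have cl: "clopen {x. g x \<noteq> reflect f x}" using g * by (intro clopen_neq) auto
  then have "{x. g x \<noteq> reflect f x} \<subseteq> {x \<in> circ. g x \<noteq> ?h x} \<union> {x \<in> circ. reflect f x \<noteq> ?h x}"
    using clopen_subset by fastforce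
  then have "finite {x. g x \<noteq> reflect f x}" using g * by (meson finite_UnI finite_subset)
  then have "{x. g x \<noteq> reflect f x} = {}" using clopen_finite_empty[OF cl] by blast
  then show "g = reflect f" by auto
qed

text \<open>A conjugating exchange would translate all short intervals [0, t) by one constant,
  whereas their reflections start at the varying points 1 - t.\<close>

lemma reflect_not_inner:
  assumes f: "iet f" and inner: "\<And>g. iet g \<Longrightarrow> reflect g = f \<circ> g \<circ> inv_into UNIV f"
  shows False
proof -
  have img: "f ` b = reflect.\<theta> b" if b: "clopen b" for b
  proof -
    obtain p where p: "iet p" "\<And>x. p (p x) = x" "supp p = b" using exists_involution_supp[OF b] by metis
    show ?thesis using reflect.\<theta>_supp[OF p(1,2)] inner[OF p(1)] supp_conj[OF f] p(3) by simp
  qed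
  obtain c where "\<forall>\<^sub>F y in rgerm 0. f y = y + c" using iet_translation[OF f, of "rgerm 0"] by auto
  then obtain e where e: "e > 0" "\<And>y. 0 \<le> y \<Longrightarrow> y < e \<Longrightarrow> f y = y + c"
    unfolding eventually_rgerm by blast
  define m where "m = min 1 e"
  have "m > 0" using e(1) by (simp add: m_def)
  have key: "c = 1 - t" if t: "0 < t" "t \<le> m" for t
  proof -
    have "{c..<t + c} = {1 - t..<1}"
      using img[OF clopen_interval, of 0 t] reflect_interval[of 0 t] t
        iet_shift_interval[OF f, of 0 t c] e(2) by (auto simp: m_def)
    then show ?thesis using t by (simp add: atLeastLessThan_eq_iff)
  qed
  show False using key[of m] key[of "m / 2"] \<open>m > 0\<close> by simp
qed

theorem iet_automorphism_classification:
  assumes "iet_automorphism \<Phi>"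
  obtains f where "iet f" "(\<forall>g. iet g \<longrightarrow> \<Phi> g = f \<circ> g \<circ> inv_into UNIV f) \<or>
    (\<forall>g. iet g \<longrightarrow> \<Phi> (reflect g) = f \<circ> g \<circ> inv_into UNIV f)"
proof -
  interpret iet_automorphism \<Phi> by fact
  obtain c \<eta> where eta: "0 < \<eta>" "\<eta> \<le> 1/2" and or:
    "(\<forall>s t. 0 \<le> s \<longrightarrow> s < t \<longrightarrow> t < \<eta> \<longrightarrow> \<theta> {s..<t} = {s + c..<t + c}) \<or>
     (\<forall>s t. 0 \<le> s \<longrightarrow> s < t \<longrightarrow> t < \<eta> \<longrightarrow> \<theta> {s..<t} = {c - t..<c - s})"
    by (rule \<theta>_interval_isometry) (rule that)
  from or show thesis
  proof
    assume a: "\<forall>s t. 0 \<le> s \<longrightarrow> s < t \<longrightarrow> t < \<eta> \<longrightarrow> \<theta> {s..<t} = {s + c..<t + c}"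
    have "translates 0 (\<eta> / 2) c" unfolding translates_def using a eta by auto
    then obtain f where "iet f" "\<And>g. iet g \<Longrightarrow> \<Phi> g = f \<circ> g \<circ> inv_into UNIV f"
      by (rule inner_if_translates) blast
    then show thesis using that by blast
  next
    assume a: "\<forall>s t. 0 \<le> s \<longrightarrow> s < t \<longrightarrow> t < \<eta> \<longrightarrow> \<theta> {s..<t} = {c - t..<c - s}"
    interpret C: iet_automorphism "\<Phi> \<circ> reflect"
      by (rule iet_automorphism_comp[OF assms iet_automorphism_reflect])
    \<comment> \<open>The reflection puts the window at the end of the circle, and c - (1 - s) = s +
      (c - 1) gives the constant. Halving \<open>\<eta>\<close> turns the strict bound
      \<open>t < \<eta>\<close> into a closed window.\<close>
    have "C.translates (1 - \<eta> / 2) (\<eta> / 2) (c - 1)"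
      unfolding C.translates_def
    proof (intro conjI allI impI)
      fix s t assume st: "1 - \<eta> / 2 \<le> s" "s < t" "t \<le> 1 - \<eta> / 2 + \<eta> / 2"
      have "C.\<theta> {s..<t} = \<theta> (reflect.\<theta> {s..<t})"
        using st eta by (intro \<theta>_comp[OF assms iet_automorphism_reflect] clopen_interval) auto
      also have "reflect.\<theta> {s..<t} = {1 - t..<1 - s}" using st eta by (intro reflect_interval) auto
      also have "\<theta> \<dots> = {c - (1 - s)..<c - (1 - t)}" using a st eta by auto
      also have "\<dots> = {s + (c - 1)..<t + (c - 1)}" by (simp add: algebra_simps)
      finally show "C.\<theta> {s..<t} = {s + (c - 1)..<t + (c - 1)}" .
    qed (use eta in auto)
    then obtain f where "iet f" "\<And>g. iet g \<Longrightarrow> (\<Phi> \<circ> reflect) g = f \<circ> g \<circ> inv_into UNIV f"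
      by (rule C.inner_if_translates) blast
    then show thesis using that by auto
  qed
qed

section \<open>The automorphism group\<close>

definition conj_map :: "('a, 'b) monoid_scheme \<Rightarrow> 'a \<Rightarrow> 'a \<Rightarrow> 'a" where
  "conj_map G g = (\<lambda>x\<in>carrier G. g \<otimes>\<^bsub>G\<^esub> x \<otimes>\<^bsub>G\<^esub> inv\<^bsub>G\<^esub> g)"

lemma Inn_eq: "Inn G = conj_map G ` carrier G"
  by (auto simp: Inn_def conj_map_def)

lemma carrier_AutoGroup: "carrier (AutoGroup G) = auto G"
  by (simp add: AutoGroup_def)

lemma one_AutoGroup: "\<one>\<^bsub>AutoGroup G\<^esub> = (\<lambda>x\<in>carrier G. x)"
  by (simp add: AutoGroup_def BijGroup_def)

lemma mult_AutoGroup: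
  "a \<in> auto G \<Longrightarrow> b \<in> auto G \<Longrightarrow> a \<otimes>\<^bsub>AutoGroup G\<^esub> b = compose (carrier G) a b"
  by (simp add: AutoGroup_def BijGroup_def auto_def)

context group
begin

lemma conj_map_comp:
  assumes "g \<in> carrier G" "h \<in> carrier G" "x \<in> carrier G"
  shows "conj_map G (g \<otimes> h) x = conj_map G g (conj_map G h x)"
  using assms by (simp add: conj_map_def inv_mult_group m_assoc)

lemma conj_map_auto: assumes g: "g \<in> carrier G" shows "conj_map G g \<in> auto G"
proof -
  have "bij_betw (conj_map G g) (carrier G) (carrier G)"
  proof (rule bij_betw_byWitness[where f'="conj_map G (inv g)"])
    show "\<forall>x\<in>carrier G. conj_map G (inv g) (conj_map G g x) = x"
      using g conj_map_comp[of "inv g" g] by (simp add: conj_map_def)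
    show "\<forall>x\<in>carrier G. conj_map G g (conj_map G (inv g) x) = x"
      using g conj_map_comp[of g "inv g"] by (simp add: conj_map_def)
  qed (use g in \<open>auto simp: conj_map_def\<close>)
  moreover have "conj_map G g \<in> hom G G"
  proof (rule homI)
    fix x y assume xy: "x \<in> carrier G" "y \<in> carrier G"
    have "(g \<otimes> x \<otimes> inv g) \<otimes> (g \<otimes> y \<otimes> inv g) = g \<otimes> (x \<otimes> ((inv g \<otimes> g) \<otimes> (y \<otimes> inv g)))"
      using g xy by (simp only: m_assoc m_closed inv_closed)
    then show "conj_map G g (x \<otimes> y) = conj_map G g x \<otimes> conj_map G g y"
      using g xy by (simp add: conj_map_def m_assoc)
  qed (use g in \<open>simp add: conj_map_def\<close>)
  ultimately show ?thesis by (simp add: auto_def Bij_def conj_map_def)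
qed

lemma conj_map_group_hom: "group_hom G (AutoGroup G) (conj_map G)"
proof -
  have "conj_map G (g \<otimes> h) = compose (carrier G) (conj_map G g) (conj_map G h)"
    if "g \<in> carrier G" "h \<in> carrier G" for g h
  proof
    fix x
    show "conj_map G (g \<otimes> h) x = compose (carrier G) (conj_map G g) (conj_map G h) x"
      using conj_map_comp[OF that, of x] by (cases "x \<in> carrier G") (auto simp: compose_def conj_map_def)
  qed
  then have "conj_map G \<in> hom G (AutoGroup G)"
    by (intro homI) (auto simp: carrier_AutoGroup conj_map_auto mult_AutoGroup)
  then show ?thesis by (simp add: group_hom_def group_hom_axioms_def AutoGroup is_group)
qed

text \<open>The rule that conjugating the inner automorphism of \<open>g\<close> by \<open>a\<close>
  gives that of \<open>a g\<close>, in a form without inverses.\<close>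

lemma auto_conj_map:
  assumes a: "a \<in> auto G" and g: "g \<in> carrier G"
  shows "a \<otimes>\<^bsub>AutoGroup G\<^esub> conj_map G g = conj_map G (a g) \<otimes>\<^bsub>AutoGroup G\<^esub> a"
proof -
  have hom: "a \<in> hom G G" and closed: "\<And>x. x \<in> carrier G \<Longrightarrow> a x \<in> carrier G"
    using a by (auto simp: auto_def hom_def)
  interpret h: group_hom G G a by (simp add: group_hom_def group_hom_axioms_def is_group hom)
  have "compose (carrier G) a (conj_map G g) = compose (carrier G) (conj_map G (a g)) a"
    using g by (auto simp: compose_def conj_map_def fun_eq_iff)
  then show ?thesis using a conj_map_auto g closed by (simp add: mult_AutoGroup)
qed

lemma Inn_normal: "Inn G \<lhd> AutoGroup G"
proof -
  interpret A: group "AutoGroup G" by (rule AutoGroup)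
  interpret c: group_hom G "AutoGroup G" "conj_map G" by (rule conj_map_group_hom)
  have "a \<otimes>\<^bsub>AutoGroup G\<^esub> h \<otimes>\<^bsub>AutoGroup G\<^esub> inv\<^bsub>AutoGroup G\<^esub> a \<in> Inn G"
    if a: "a \<in> carrier (AutoGroup G)" and h: "h \<in> Inn G" for a h
  proof -
    obtain g where g: "g \<in> carrier G" "h = conj_map G g" using h by (auto simp: Inn_eq)
    have ag: "a g \<in> carrier G" using a g(1) by (auto simp: carrier_AutoGroup auto_def hom_def)
    have "a \<otimes>\<^bsub>AutoGroup G\<^esub> h \<otimes>\<^bsub>AutoGroup G\<^esub> inv\<^bsub>AutoGroup G\<^esub> a = conj_map G (a g)"
      using auto_conj_map[of a g] a g ag c.hom_closed[OF ag]
      by (simp add: carrier_AutoGroup[symmetric] A.m_assoc A.r_inv)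
    then show ?thesis using ag by (simp add: Inn_eq)
  qed
  then show ?thesis using c.img_is_subgroup by (simp add: A.normal_inv_iff Inn_eq)
qed

text \<open>The isomorphism is the inverse of sending \<open>(g, b)\<close> to conjugation by
  \<open>g\<close> times a power of \<open>\<psi>\<close>; injectivity of \<open>conj_map G\<close>,
  that is a trivial centre, makes the inner part a copy of \<open>G\<close>. A separate
  \<open>\<phi>\<close> appears because elements of \<open>auto G\<close> are extensional, while the
  map given to \<open>sdp_Z2\<close> need only agree with \<open>\<psi>\<close> on the
  carrier.\<close>

theorem AutoGroup_split_by_involution:
  assumes psi: "\<psi> \<in> auto G" and invol: "\<psi> \<otimes>\<^bsub>AutoGroup G\<^esub> \<psi> = \<one>\<^bsub>AutoGroup G\<^esub>"
    and outer: "\<psi> \<notin> Inn G"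
    and decomp: "\<And>a. a \<in> auto G \<Longrightarrow> a \<in> Inn G \<or> a \<otimes>\<^bsub>AutoGroup G\<^esub> \<psi> \<in> Inn G"
    and inj: "inj_on (conj_map G) (carrier G)"
    and phi: "\<And>x. x \<in> carrier G \<Longrightarrow> \<phi> x = \<psi> x"
  shows "\<psi> \<noteq> \<one>\<^bsub>AutoGroup G\<^esub> \<and> Inn G \<lhd> AutoGroup G
       \<and> subgroup (generate (AutoGroup G) {\<psi>}) (AutoGroup G)
       \<and> Inn G \<inter> generate (AutoGroup G) {\<psi>} = {\<one>\<^bsub>AutoGroup G\<^esub>}
       \<and> Inn G <#>\<^bsub>AutoGroup G\<^esub> generate (AutoGroup G) {\<psi>} = carrier (AutoGroup G)
       \<and> AutoGroup G \<cong> sdp_Z2 G \<phi>"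
proof -
  define A where "A = AutoGroup G"
  interpret A: group A unfolding A_def by (rule AutoGroup)
  interpret c: group_hom G A "conj_map G" unfolding A_def by (rule conj_map_group_hom)
  have psiA: "\<psi> \<in> carrier A" and psi2: "\<psi> \<otimes>\<^bsub>A\<^esub> \<psi> = \<one>\<^bsub>A\<^esub>"
    using psi invol by (auto simp: A_def carrier_AutoGroup)
  have normal: "Inn G \<lhd> A" unfolding A_def by (rule Inn_normal)
  then interpret I: subgroup "Inn G" A by (rule normal_imp_subgroup)
  have ne: "\<psi> \<noteq> \<one>\<^bsub>A\<^esub>" using outer I.one_closed by blast
  have "subgroup {\<one>\<^bsub>A\<^esub>, \<psi>} A"
  proof (rule A.subgroupI)
    show "inv\<^bsub>A\<^esub> a \<in> {\<one>\<^bsub>A\<^esub>, \<psi>}" if "a \<in> {\<one>\<^bsub>A\<^esub>, \<psi>}" for a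
      using that psiA psi2 A.inv_equality[OF psi2 psiA psiA] by auto
  qed (use psiA psi2 in auto)
  then have "generate A {\<psi>} \<subseteq> {\<one>\<^bsub>A\<^esub>, \<psi>}" by (intro A.generate_subgroup_incl) auto
  moreover have "{\<one>\<^bsub>A\<^esub>, \<psi>} \<subseteq> generate A {\<psi>}" by (auto intro: generate.one generate.incl)
  ultimately have gen: "generate A {\<psi>} = {\<one>\<^bsub>A\<^esub>, \<psi>}" by blast
  have sub: "subgroup (generate A {\<psi>}) A" using psiA by (intro A.generate_is_subgroup) auto
  have int: "Inn G \<inter> generate A {\<psi>} = {\<one>\<^bsub>A\<^esub>}" using gen outer I.one_closed by auto
  have split: "\<exists>h\<in>Inn G. a = h \<or> a = h \<otimes>\<^bsub>A\<^esub> \<psi>" if a: "a \<in> carrier A" for a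
  proof -
    from decomp[of a] a consider "a \<in> Inn G" | "a \<otimes>\<^bsub>A\<^esub> \<psi> \<in> Inn G" by (auto simp: A_def carrier_AutoGroup)
    then show ?thesis
    proof cases
      case 2
      have "a = (a \<otimes>\<^bsub>A\<^esub> \<psi>) \<otimes>\<^bsub>A\<^esub> \<psi>" using a psiA psi2 by (simp add: A.m_assoc)
      then show ?thesis using 2 by blast
    qed blast
  qed
  have prod: "Inn G <#>\<^bsub>A\<^esub> generate A {\<psi>} = carrier A"
  proof
    show "Inn G <#>\<^bsub>A\<^esub> generate A {\<psi>} \<subseteq> carrier A"
      using psiA I.subset by (auto simp: gen set_mult_def)
    show "carrier A \<subseteq> Inn G <#>\<^bsub>A\<^esub> generate A {\<psi>}"
    proof
      fix a assume a: "a \<in> carrier A"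
      then obtain h where h: "h \<in> Inn G" "a = h \<otimes>\<^bsub>A\<^esub> \<one>\<^bsub>A\<^esub> \<or> a = h \<otimes>\<^bsub>A\<^esub> \<psi>"
        using split[OF a] I.subset by force
      then show "a \<in> Inn G <#>\<^bsub>A\<^esub> generate A {\<psi>}" unfolding gen set_mult_def by blast
    qed
  qed
  define S where "S = sdp_Z2 G \<phi>"
  define pow where "pow b = (if b then \<psi> else \<one>\<^bsub>A\<^esub>)" for b
  define f where "f = (\<lambda>(g, b). conj_map G g \<otimes>\<^bsub>A\<^esub> pow b)"
  have pow: "pow b \<in> carrier A" for b using psiA by (simp add: pow_def)
  have carS: "carrier S = carrier G \<times> UNIV" by (simp add: S_def sdp_Z2_def)
  have psi_closed: "\<phi> g \<in> carrier G" if "g \<in> carrier G" for g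
    using psi phi[OF that] that by (auto simp: auto_def hom_def)
  have mulS: "(g, a) \<otimes>\<^bsub>S\<^esub> (h, b) = (g \<otimes> (if a then \<phi> h else h), a \<noteq> b)" for g h a b
    by (simp add: S_def sdp_Z2_def)
  have f_hom: "f (p \<otimes>\<^bsub>S\<^esub> q) = f p \<otimes>\<^bsub>A\<^esub> f q" if pq: "p \<in> carrier S" "q \<in> carrier S" for p q
  proof -
    obtain g a where p: "p = (g, a)" "g \<in> carrier G" using pq carS by auto
    obtain h b where q: "q = (h, b)" "h \<in> carrier G" using pq carS by auto
    define h' where "h' = (if a then \<phi> h else h)"
    have h': "h' \<in> carrier G" using q psi_closed by (simp add: h'_def)
    have comm: "pow a \<otimes>\<^bsub>A\<^esub> conj_map G h = conj_map G h' \<otimes>\<^bsub>A\<^esub> pow a"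
      using auto_conj_map[OF psi q(2)] q(2) phi by (auto simp: pow_def h'_def A_def[symmetric])
    have powmul: "pow a \<otimes>\<^bsub>A\<^esub> pow b = pow (a \<noteq> b)" using psiA psi2 by (auto simp: pow_def)
    have cl: "conj_map G g \<in> carrier A" "conj_map G h \<in> carrier A" "conj_map G h' \<in> carrier A"
      using p q h' by auto
    have "f p \<otimes>\<^bsub>A\<^esub> f q = conj_map G g \<otimes>\<^bsub>A\<^esub> ((pow a \<otimes>\<^bsub>A\<^esub> conj_map G h) \<otimes>\<^bsub>A\<^esub> pow b)"
      using cl pow by (simp add: f_def p q A.m_assoc)
    also have "\<dots> = (conj_map G g \<otimes>\<^bsub>A\<^esub> conj_map G h') \<otimes>\<^bsub>A\<^esub> (pow a \<otimes>\<^bsub>A\<^esub> pow b)"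
      unfolding comm using cl pow by (simp add: A.m_assoc)
    also have "\<dots> = f (p \<otimes>\<^bsub>S\<^esub> q)"
      unfolding powmul using p q h' by (simp add: f_def mulS h'_def[symmetric])
    finally show ?thesis by simp
  qed
  have f_bij: "bij_betw f (carrier S) (carrier A)"
  proof (rule bij_betw_imageI)
    show "inj_on f (carrier S)"
    proof (rule inj_onI)
      fix p q assume pq: "p \<in> carrier S" "q \<in> carrier S" "f p = f q"
      obtain g a where p: "p = (g, a)" "g \<in> carrier G" using pq carS by auto
      obtain h b where q: "q = (h, b)" "h \<in> carrier G" using pq carS by auto
      have cl: "conj_map G g \<in> carrier A" "conj_map G h \<in> carrier A" using p q by auto
      have Inn: "conj_map G g \<in> Inn G" "conj_map G h \<in> Inn G" using p q by (auto simp: Inn_eq)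
      have eq: "conj_map G g \<otimes>\<^bsub>A\<^esub> pow a = conj_map G h \<otimes>\<^bsub>A\<^esub> pow b" using pq(3) p q by (simp add: f_def)
      \<comment> \<open>As \<open>\<psi>\<close> is outer, \<open>Inn G\<close> is disjoint from its
        coset through \<open>\<psi>\<close>, which recovers the Boolean component.\<close>
      have no: "u = v \<otimes>\<^bsub>A\<^esub> \<psi> \<Longrightarrow> False" if "u \<in> Inn G" "v \<in> Inn G" for u v
      proof -
        assume u: "u = v \<otimes>\<^bsub>A\<^esub> \<psi>"
        have "v \<in> carrier A" using that I.subset by blast
        then have "\<psi> = inv\<^bsub>A\<^esub> v \<otimes>\<^bsub>A\<^esub> u" using u psiA by (simp add: A.m_assoc[symmetric])
        then show False using outer that by (simp add: I.m_inv_closed I.m_closed)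
      qed
      have "a = b"
        using eq no[OF Inn] no[OF Inn(2,1)] cl by (cases a; cases b) (auto simp: pow_def)
      then have "conj_map G g = conj_map G h" using eq cl pow by simp
      then show "p = q" using inj_onD[OF inj] p q \<open>a = b\<close> by simp
    qed
    show "f ` carrier S = carrier A"
    proof
      show "f ` carrier S \<subseteq> carrier A" using pow by (auto simp: carS f_def)
      show "carrier A \<subseteq> f ` carrier S"
      proof
        fix a assume a: "a \<in> carrier A"
        obtain g where g: "g \<in> carrier G" "a = conj_map G g \<or> a = conj_map G g \<otimes>\<^bsub>A\<^esub> \<psi>"
          using split[OF a] by (auto simp: Inn_eq)
        then have "a = f (g, False) \<or> a = f (g, True)" by (auto simp: f_def pow_def)
        then show "a \<in> f ` carrier S" using g(1) by (auto simp: carS)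
      qed
    qed
  qed
  have "inv_into (carrier S) f \<in> iso A S"
  proof (rule isoI)
    show "bij_betw (inv_into (carrier S) f) (carrier A) (carrier S)" by (rule bij_betw_inv_into[OF f_bij])
    show "inv_into (carrier S) f \<in> hom A S"
    proof (rule homI)
      show closed: "inv_into (carrier S) f a \<in> carrier S" if "a \<in> carrier A" for a
        using bij_betw_apply[OF bij_betw_inv_into[OF f_bij] that] .
      fix a b assume ab: "a \<in> carrier A" "b \<in> carrier A"
      have "a \<in> f ` carrier S" "b \<in> f ` carrier S" using ab bij_betw_imp_surj_on[OF f_bij] by auto
      then obtain p q where p: "p \<in> carrier S" "a = f p" and q: "q \<in> carrier S" "b = f q" by blast
      have "p \<otimes>\<^bsub>S\<^esub> q \<in> carrier S" 
        using p(1) q(1) psi_closed by (cases p, cases q) (simp add: carS mulS)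
      then show "inv_into (carrier S) f (a \<otimes>\<^bsub>A\<^esub> b) = inv_into (carrier S) f a \<otimes>\<^bsub>S\<^esub> inv_into (carrier S) f b"
        using f_hom[OF p(1) q(1), symmetric] p q inv_into_f_f[OF bij_betw_imp_inj_on[OF f_bij]]
        by simp
    qed
  qed
  then have "A \<cong> S" by (auto simp: is_iso_def)
  then show ?thesis using ne normal sub int prod unfolding A_def S_def by blast
qed

end

section \<open>Specialization to the group of interval exchanges\<close>

lemma carrier_IET_group: "carrier IET_group = Collect iet"
  by (simp add: IET_group_def is_iet_iff_iet)

lemma mult_IET_group: "f \<otimes>\<^bsub>IET_group\<^esub> g = f \<circ> g"
  by (simp add: IET_group_def)

lemma one_IET_group: "\<one>\<^bsub>IET_group\<^esub> = id"
  by (simp add: IET_group_def)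

lemmas IET_group_simps = carrier_IET_group mult_IET_group one_IET_group

lemma group_IET_group: "group IET_group"
proof (rule groupI)
  fix f assume "f \<in> carrier IET_group"
  then have f: "iet f" by (simp add: IET_group_simps)
  then have "inv_into UNIV f \<circ> f = id" by (auto simp: fun_eq_iff)
  then show "\<exists>g\<in>carrier IET_group. g \<otimes>\<^bsub>IET_group\<^esub> f = \<one>\<^bsub>IET_group\<^esub>"
    using iet_inv[OF f] by (auto simp: IET_group_simps)
qed (auto simp: IET_group_simps iet_comp o_assoc)

lemma inv_IET_group: assumes "iet f" shows "inv\<^bsub>IET_group\<^esub> f = inv_into UNIV f"
proof (rule group.inv_equality[OF group_IET_group])
  show "inv_into UNIV f \<otimes>\<^bsub>IET_group\<^esub> f = \<one>\<^bsub>IET_group\<^esub>" using assms by (auto simp: IET_group_simps fun_eq_iff)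
qed (use assms iet_inv in \<open>auto simp: IET_group_simps\<close>)

lemma conj_map_IET:
  assumes "iet f" "iet g" shows "conj_map IET_group f g = f \<circ> g \<circ> inv_into UNIV f"
  using assms by (simp add: conj_map_def IET_group_simps inv_IET_group)

lemma auto_IET_imp_iet_automorphism:
  assumes "a \<in> auto IET_group" shows "iet_automorphism a"
proof
  show "bij_betw a (Collect iet) (Collect iet)"
    using assms by (simp add: auto_def Bij_def carrier_IET_group)
  fix f g :: "real \<Rightarrow> real" assume "iet f" "iet g"
  then show "a (f \<circ> g) = a f \<circ> a g"
    using assms hom_mult[of a IET_group IET_group f g] by (simp add: auto_def IET_group_simps)
qed

text \<open>Conjugation by \<open>f\<close> determines the supports of conjugated involutions, hence
  the image of every clopen set under \<open>f\<close>, hence \<open>f\<close>.\<close>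

lemma inj_conj_map_IET: "inj_on (conj_map IET_group) (carrier IET_group)"
proof (rule inj_onI)
  fix f g assume "f \<in> carrier IET_group" "g \<in> carrier IET_group"
    and eq: "conj_map IET_group f = conj_map IET_group g"
  then have fg: "iet f" "iet g" by (auto simp: IET_group_simps)
  show "f = g"
  proof (rule iet_eqI_image[OF fg])
    fix b assume b: "clopen b"
    obtain p where p: "iet p" "\<And>x. p (p x) = x" "supp p = b" using exists_involution_supp[OF b] by metis
    have "f \<circ> p \<circ> inv_into UNIV f = g \<circ> p \<circ> inv_into UNIV g"
      using conj_map_IET[OF fg(1) p(1)] conj_map_IET[OF fg(2) p(1)] eq by simp
    then show "f ` b = g ` b" using supp_conj[OF fg(1), of p] supp_conj[OF fg(2), of p] p(3) by simp
  qed
qed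

lemma auto_IET_eq_conj_map:
  assumes a: "a \<in> auto IET_group" and f: "iet f"
    and eq: "\<And>g. iet g \<Longrightarrow> a g = f \<circ> g \<circ> inv_into UNIV f"
  shows "a \<in> Inn IET_group"
proof -
  have "a = conj_map IET_group f"
  proof (rule extensionalityI)
    show "a \<in> extensional (carrier IET_group)" using a by (simp add: auto_def Bij_def)
    show "conj_map IET_group f \<in> extensional (carrier IET_group)" by (simp add: conj_map_def)
  qed (use eq conj_map_IET[OF f] in \<open>simp add: carrier_IET_group\<close>)
  then show ?thesis using f by (simp add: Inn_eq carrier_IET_group)
qed

theorem theorem1p6:
  defines "E \<equiv> IET_group"
      and "A \<equiv> AutoGroup IET_group"
      and "Psi \<equiv> restrict Psi_T (carrier IET_group)"
  shows "Psi \<in> carrier A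
       \<and> Psi \<noteq> \<one>\<^bsub>A\<^esub> \<and> Psi \<otimes>\<^bsub>A\<^esub> Psi = \<one>\<^bsub>A\<^esub>
       \<and> Inn E \<lhd> A
       \<and> subgroup (generate A {Psi}) A
       \<and> Inn E \<inter> generate A {Psi} = {\<one>\<^bsub>A\<^esub>}
       \<and> Inn E <#>\<^bsub>A\<^esub> generate A {Psi} = carrier A
       \<and> A \<cong> sdp_Z2 E Psi_T"
proof -
  interpret group IET_group by (rule group_IET_group)
  have Psi: "Psi g = reflect g" if "iet g" for g
    using that by (simp add: Psi_def carrier_IET_group Psi_T_eq_reflect)
  have auto: "Psi \<in> auto IET_group"
    unfolding auto_def Bij_def
  proof (intro IntI CollectI)
    show "Psi \<in> hom IET_group IET_group"
      by (rule homI) (simp_all add: IET_group_simps Psi iet_reflect iet_comp reflect_comp)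
    show "Psi \<in> extensional (carrier IET_group)" by (simp add: Psi_def)
    show "bij_betw Psi (carrier IET_group) (carrier IET_group)"
      using reflect.bij bij_betw_cong[of "Collect iet" Psi reflect] Psi by (simp add: carrier_IET_group)
  qed
  have invol: "Psi \<otimes>\<^bsub>A\<^esub> Psi = \<one>\<^bsub>A\<^esub>"
    unfolding A_def mult_AutoGroup[OF auto auto] one_AutoGroup
    by (auto simp: compose_def fun_eq_iff carrier_IET_group Psi iet_reflect reflect_reflect)
  have outer: "Psi \<notin> Inn IET_group"
  proof
    assume "Psi \<in> Inn IET_group"
    then obtain f where f: "iet f" "Psi = conj_map IET_group f" by (auto simp: Inn_eq carrier_IET_group)
    then show False using reflect_not_inner[OF f(1)] Psi conj_map_IET[OF f(1)] by metis
  qed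
  have decomp: "a \<in> Inn IET_group \<or> a \<otimes>\<^bsub>A\<^esub> Psi \<in> Inn IET_group" if a: "a \<in> auto IET_group" for a
  proof -
    obtain f where f: "iet f" and cases: "(\<forall>g. iet g \<longrightarrow> a g = f \<circ> g \<circ> inv_into UNIV f) \<or>
        (\<forall>g. iet g \<longrightarrow> a (reflect g) = f \<circ> g \<circ> inv_into UNIV f)"
      by (rule iet_automorphism_classification[OF auto_IET_imp_iet_automorphism[OF a]]) (rule that)
    from cases show ?thesis
    proof
      assume "\<forall>g. iet g \<longrightarrow> a g = f \<circ> g \<circ> inv_into UNIV f"
      then show ?thesis using auto_IET_eq_conj_map[OF a f] by blast
    next
      assume b: "\<forall>g. iet g \<longrightarrow> a (reflect g) = f \<circ> g \<circ> inv_into UNIV f"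
      have aP: "a \<otimes>\<^bsub>A\<^esub> Psi \<in> auto IET_group"
        using group.is_monoid[OF AutoGroup] a auto monoid.m_closed by (fastforce simp: A_def carrier_AutoGroup[symmetric])
      have "(a \<otimes>\<^bsub>A\<^esub> Psi) g = f \<circ> g \<circ> inv_into UNIV f" if "iet g" for g
        using b that by (simp add: A_def mult_AutoGroup[OF a auto] compose_def carrier_IET_group Psi)
      then show ?thesis using auto_IET_eq_conj_map[OF aP f] by blast
    qed
  qed
  have "Psi_T x = Psi x" if "x \<in> carrier IET_group" for x using that by (simp add: Psi_def)
  then show ?thesis
    using AutoGroup_split_by_involution[OF auto invol[unfolded A_def] outer decomp[unfolded A_def] inj_conj_map_IET]
      auto invol unfolding A_def E_def carrier_AutoGroup by blast
qed

end
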